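(* Let $A\in L(\mathbb{C}^n,\mathbb{C}^n)$ with $m(A)>0$. Then the class $\hat S_A(B^n)$ of normalized univalent mappings on $B^n$ that are spirallike with respect to $A$ is compact if and only if $A$ is nonresonant.
   Context: $\mathbb{C}^n$ carries the Euclidean inner product and norm, $B^n$ is the open unit ball, and $m(A):=\min\{\operatorname{Re}\langle A(z),z\rangle:\|z\|=1\}$. $S(B^n)$ is the set of univalent (holomorphic and injective) $f:B^n\to\mathbb{C}^n$ with $f(0)=0$, $Df(0)=I$. A domain $\Omega\subset\mathbb{C}^n$ containing $0$ is spirallike with respect to $A$ if $e^{-tA}w\in\Omega$ for all $w\in\Omega$, $t\ge0$. $\hat S_A(B^n)$ is the set of $f\in S(B^n)$ such that $f(B^n)$ is spirallike with respect to $A$. Compactness is with respect to the topology of locally uniform convergence on $B^n$ (on the space of holomorphic mappings $B^n\to\mathbb{C}^n$). If $\lambda_1,\dots,\lambda_n$ are the eigenvalues of $A$ (with multiplicity), $A$ is called nonresonant if $\sum_{i=1}^n m_i\lambda_i-\lambda_s\neq0$ for all $s\in\{1,\dots,n\}$ and all $(m_1,\dots,m_n)\in\mathbb{N}^n$ ($\mathbb{N}$ including $0$) with $m_1+\dots+m_n\ge2$. Equivalently, for every $k\ge2$ the operator $B_k$, $(B_kQ)(z)=DQ(z)Az-AQ(z)$, on the space of homogeneous polynomial mappings of degree $k$ from $\mathbb{C}^n$ to $\mathbb{C}^n$ is invertible. *)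

theory Defs
  imports
    "HOL-Analysis.Analysis"
    "HOL-Computational_Algebra.Polynomial"
    "HOL-Computational_Algebra.Fundamental_Theorem_Algebra"
begin

text \<open>
  Linear operators on \<open>\<complex>\<^sup>n\<close> are matrices of type \<open>complex^'n^'n\<close>. The library norm on
  \<open>complex^'n\<close> is the Euclidean one, so \<open>ball 0 1\<close> is the open Euclidean unit ball.
\<close>

definition cinner :: "complex^'n \<Rightarrow> complex^'n \<Rightarrow> complex" where
  "cinner z w = (\<Sum>i\<in>UNIV. z $ i * cnj (w $ i))"

definition m_op :: "complex^'n^'n \<Rightarrow> real" where
  "m_op A = (INF z\<in>sphere 0 1. Re (cinner (A *v z) z))"

lemma Re_cinner: "Re (cinner z w) = z \<bullet> w"
  by (simp add: cinner_def inner_vec_def inner_complex_def)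

text \<open>The infimum in \<open>m_op\<close> is a minimum.\<close>

lemma m_op_attained:
  fixes A :: "complex^'n^'n"
  shows "\<exists>z. norm z = 1 \<and> m_op A = Re (cinner (A *v z) z) \<and>
             (\<forall>w. norm w = 1 \<longrightarrow> Re (cinner (A *v z) z) \<le> Re (cinner (A *v w) w))"
proof -
  let ?g = "\<lambda>z. Re (cinner (A *v z) z)"
  have "continuous_on (sphere 0 1) ?g"
    unfolding Re_cinner
    by (intro continuous_intros linear_continuous_on matrix_vector_mul_bounded_linear)
  moreover have "sphere (0::complex^'n) 1 \<noteq> {}"
    by simp
  ultimately obtain z where z: "z \<in> sphere 0 1" "\<And>w. w \<in> sphere 0 1 \<Longrightarrow> ?g z \<le> ?g w"
    using continuous_attains_inf[OF compact_sphere] by blast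
  have "m_op A = ?g z"
    unfolding m_op_def by (rule cInf_eq_minimum) (use z in auto)
  with z show ?thesis by auto
qed

definition matrix_power :: "complex^'n^'n \<Rightarrow> nat \<Rightarrow> complex^'n^'n" where
  "matrix_power A k = (((**) A) ^^ k) (mat 1)"

text \<open>The library multiplication \<open>*\<close> on vectors is componentwise, hence \<open>exp\<close> is not available
  for matrices.\<close>

definition matrix_exp :: "complex^'n^'n \<Rightarrow> complex^'n^'n" where
  "matrix_exp A = (\<Sum>k. matrix_power A k /\<^sub>R fact k)"

lemma summable_matrix_exp:
  fixes A :: "complex^'n^'n"
  shows "summable (\<lambda>k. matrix_power A k /\<^sub>R fact k)"
proof -
  have "linear (\<lambda>B :: complex^'n^'n. A ** B)"
    by (intro linearI)
       (simp_all add: matrix_matrix_mult_def vec_eq_iff sum.distrib distrib_left scaleR_sum_right)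
  then have "bounded_linear (\<lambda>B :: complex^'n^'n. A ** B)"
    by (simp add: linear_conv_bounded_linear)
  then obtain C where C: "C > 0" "\<And>B :: complex^'n^'n. norm (A ** B) \<le> norm B * C"
    using bounded_linear.pos_bounded by blast
  have *: "norm (matrix_power A k) \<le> C ^ k * norm (mat 1 :: complex^'n^'n)" for k
  proof (induction k)
    case 0
    show ?case by (simp add: matrix_power_def)
  next
    case (Suc k)
    have "norm (matrix_power A (Suc k)) \<le> norm (matrix_power A k) * C"
      using C(2) by (simp add: matrix_power_def)
    also have "\<dots> \<le> C ^ k * norm (mat 1 :: complex^'n^'n) * C"
      using Suc C(1) by (intro mult_right_mono) auto
    finally show ?case by (simp add: mult_ac)
  qed
  have "summable (\<lambda>k. (C ^ k /\<^sub>R fact k) * norm (mat 1 :: complex^'n^'n))"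
    by (intro summable_mult2 summable_exp_generic)
  then show ?thesis
  proof (rule summable_comparison_test'[where N = 0])
    fix k :: nat
    show "norm (matrix_power A k /\<^sub>R fact k)
            \<le> (C ^ k /\<^sub>R fact k) * norm (mat 1 :: complex^'n^'n)"
      using *[of k] by (simp add: divide_simps mult_ac)
  qed
qed

definition charpoly :: "complex^'n^'n \<Rightarrow> complex poly" where
  "charpoly A = det (mat [:0, 1:] - (\<chi> i j. [:A $ i $ j:]))"

definition is_eigenvalue_family :: "complex^'n^'n \<Rightarrow> ('n \<Rightarrow> complex) \<Rightarrow> bool" where
  "is_eigenvalue_family A ev \<longleftrightarrow> charpoly A = (\<Prod>i\<in>UNIV. [:- ev i, 1:])"

definition nonresonant :: "complex^'n^'n \<Rightarrow> bool" where
  "nonresonant A \<longleftrightarrow>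
     (\<forall>ev. is_eigenvalue_family A ev \<longrightarrow>
        (\<forall>s. \<forall>m :: 'n \<Rightarrow> nat. (\<Sum>i\<in>UNIV. m i) \<ge> 2 \<longrightarrow>
           (\<Sum>i\<in>UNIV. of_nat (m i) * ev i) - ev s \<noteq> 0))"

text \<open>The universal quantifier over enumerations \<open>ev\<close> in \<open>nonresonant\<close> is not vacuous; as any two
  enumerations agree up to a permutation, the choice does not matter.\<close>

lemma charpoly_monic:
  fixes A :: "complex^'n^'n"
  shows "degree (charpoly A) = CARD('n) \<and> lead_coeff (charpoly A) = 1"
proof -
  let ?M = "mat [:0, 1:] - (\<chi> i j. [:A $ i $ j:]) :: complex poly^'n^'n"
  let ?t = "\<lambda>p. of_int (sign p) * (\<Prod>i\<in>UNIV. ?M $ i $ p i)"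
  let ?P = "{p. p permutes (UNIV :: 'n set)}"
  have fin: "finite ?P" by (simp add: finite_permutations)
  have split: "charpoly A = ?t id + (\<Sum>p\<in>?P - {id}. ?t p)"
    unfolding charpoly_def det_def
    by (subst sum.remove[OF fin, of id]) (auto simp: permutes_id)
  have diag: "?M $ i $ i = [:- (A $ i $ i), 1:]" for i
    by (simp add: mat_def)
  have off: "i \<noteq> j \<Longrightarrow> ?M $ i $ j = [:- (A $ i $ j):]" for i j
    by (simp add: mat_def)
  have tid: "?t id = (\<Prod>i\<in>UNIV. [:- (A $ i $ i), 1:])"
    using diag by simp
  have deg_id: "degree (?t id) = CARD('n)"
    unfolding tid by (subst degree_prod_eq_sum_degree) auto
  have lc_id: "lead_coeff (?t id) = 1"
    unfolding tid by (simp add: lead_coeff_prod)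
  have small: "degree (?t p) < CARD('n)" if "p \<in> ?P - {id}" for p
  proof -
    from that obtain k where k: "p k \<noteq> k" by (auto simp: fun_eq_iff)
    have "degree (?t p) \<le> degree (\<Prod>i\<in>UNIV. ?M $ i $ p i)"
      by (cases "sign p = 1") (auto simp: sign_def)
    also have "\<dots> \<le> (\<Sum>i\<in>UNIV. degree (?M $ i $ p i))"
      by (rule order.trans[OF degree_prod_sum_le]) (simp_all add: o_def)
    also have "\<dots> < (\<Sum>i\<in>(UNIV::'n set). 1)"
    proof (rule sum_strict_mono_ex1)
      show "\<forall>i\<in>UNIV. degree (?M $ i $ p i) \<le> 1"
      proof
        fix i show "degree (?M $ i $ p i) \<le> 1"
          by (cases "p i = i") (use diag off[of i "p i"] in auto)
      qed
      show "\<exists>i\<in>UNIV. degree (?M $ i $ p i) < 1"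
        using off[of k "p k"] k by (intro bexI[of _ k]) auto
    qed simp
    finally show ?thesis by simp
  qed
  have "degree (\<Sum>p\<in>?P - {id}. ?t p) < CARD('n)"
    by (rule degree_sum_less) (use small in auto)
  with deg_id lc_id split show ?thesis
    by (simp add: degree_add_eq_left lead_coeff_add_le coeff_eq_0)
qed

lemma eigenvalue_family_exists:
  fixes A :: "complex^'n^'n"
  shows "\<exists>ev. is_eigenvalue_family A ev"
proof -
  obtain root where
    root: "smult (lead_coeff (charpoly A)) (\<Prod>i<degree (charpoly A). [:- root i, 1:]) = charpoly A"
    by (rule complex_poly_decompose')
  obtain h where h: "bij_betw h (UNIV :: 'n set) {..<CARD('n)}"
    using ex_bij_betw_finite_nat[of "UNIV :: 'n set"] by (auto simp: atLeast0LessThan)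
  have "charpoly A = (\<Prod>i<CARD('n). [:- root i, 1:])"
    using root charpoly_monic[of A] by (metis smult_1_left)
  also have "\<dots> = (\<Prod>i\<in>UNIV. [:- root (h i), 1:])"
    by (rule prod.reindex_bij_betw[OF h, symmetric])
  finally show ?thesis
    unfolding is_eigenvalue_family_def by (intro exI[of _ "root \<circ> h"]) simp
qed

definition holomorphic_map_on :: "(complex^'n \<Rightarrow> complex^'n) \<Rightarrow> (complex^'n) set \<Rightarrow> bool" where
  "holomorphic_map_on f S \<longleftrightarrow>
     (\<forall>z\<in>S. \<exists>J :: complex^'n^'n. (f has_derivative (\<lambda>h. J *v h)) (at z))"

text \<open>A mapping defined on the unit ball only is represented by its extensional extension
  (value \<open>undefined\<close> off the ball), so that equality of functions is equality of mappings on the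
  ball.\<close>

definition holo_ball :: "(complex^'n \<Rightarrow> complex^'n) set" where
  "holo_ball = {f \<in> extensional (ball 0 1). holomorphic_map_on f (ball 0 1)}"

definition S_ball :: "(complex^'n \<Rightarrow> complex^'n) set" where
  "S_ball = {f \<in> holo_ball. inj_on f (ball 0 1) \<and> f 0 = 0 \<and> (f has_derivative (\<lambda>h. h)) (at 0)}"

definition spirallike :: "complex^'n^'n \<Rightarrow> (complex^'n) set \<Rightarrow> bool" where
  "spirallike A \<Omega> \<longleftrightarrow>
     open \<Omega> \<and> connected \<Omega> \<and> 0 \<in> \<Omega> \<and>
     (\<forall>w\<in>\<Omega>. \<forall>t::real. t \<ge> 0 \<longrightarrow> matrix_exp (- (t *\<^sub>R A)) *v w \<in> \<Omega>)"

definition S_hat :: "complex^'n^'n \<Rightarrow> (complex^'n \<Rightarrow> complex^'n) set" where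
  "S_hat A = {f \<in> S_ball. spirallike A (f ` ball 0 1)}"

text \<open>The topology of locally uniform convergence on the ball. As the ball is locally compact, a
  neighbourhood base at \<open>f\<close> is given by uniform \<open>\<epsilon>\<close>-closeness to \<open>f\<close> on compact subsets of it.\<close>

definition openin_loc_unif :: "(complex^'n \<Rightarrow> complex^'n) set \<Rightarrow> bool" where
  "openin_loc_unif U \<longleftrightarrow>
     U \<subseteq> holo_ball \<and>
     (\<forall>f\<in>U. \<exists>K \<epsilon>. compact K \<and> K \<subseteq> ball 0 1 \<and> \<epsilon> > 0 \<and>
        {g \<in> holo_ball. \<forall>z\<in>K. dist (g z) (f z) < \<epsilon>} \<subseteq> U)"

definition loc_unif_topology :: "(complex^'n \<Rightarrow> complex^'n) topology" where
  "loc_unif_topology = topology openin_loc_unif"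

lemma istopology_loc_unif: "istopology (openin_loc_unif :: (complex^'n \<Rightarrow> complex^'n) set \<Rightarrow> bool)"
  unfolding istopology_def
proof (intro conjI allI impI)
  fix U V :: "(complex^'n \<Rightarrow> complex^'n) set"
  assume U: "openin_loc_unif U" and V: "openin_loc_unif V"
  show "openin_loc_unif (U \<inter> V)"
    unfolding openin_loc_unif_def
  proof (intro conjI ballI)
    show "U \<inter> V \<subseteq> holo_ball" using U by (auto simp: openin_loc_unif_def)
  next
    fix f assume f: "f \<in> U \<inter> V"
    obtain K d where K: "compact K" "K \<subseteq> ball 0 1" "d > 0"
      "{g \<in> holo_ball. \<forall>z\<in>K. dist (g z) (f z) < d} \<subseteq> U"
      using U f unfolding openin_loc_unif_def by blast
    obtain L e where L: "compact L" "L \<subseteq> ball 0 1" "e > 0"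
      "{g \<in> holo_ball. \<forall>z\<in>L. dist (g z) (f z) < e} \<subseteq> V"
      using V f unfolding openin_loc_unif_def by blast
    show "\<exists>K \<epsilon>. compact K \<and> K \<subseteq> ball 0 1 \<and> \<epsilon> > 0 \<and>
        {g \<in> holo_ball. \<forall>z\<in>K. dist (g z) (f z) < \<epsilon>} \<subseteq> U \<inter> V"
      using K L by (intro exI[of _ "K \<union> L"] exI[of _ "min d e"]) (auto intro: compact_Un)
  qed
next
  fix \<U> :: "(complex^'n \<Rightarrow> complex^'n) set set"
  assume *: "\<forall>U\<in>\<U>. openin_loc_unif U"
  show "openin_loc_unif (\<Union>\<U>)"
    unfolding openin_loc_unif_def
  proof (intro conjI ballI)
    show "\<Union>\<U> \<subseteq> holo_ball" using * by (auto simp: openin_loc_unif_def)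
  next
    fix f assume "f \<in> \<Union>\<U>"
    then obtain U where U: "U \<in> \<U>" "f \<in> U" by blast
    with * have "openin_loc_unif U" by simp
    with U(2) obtain K d where "compact K" "K \<subseteq> ball 0 1" "d > 0"
      "{g \<in> holo_ball. \<forall>z\<in>K. dist (g z) (f z) < d} \<subseteq> U"
      unfolding openin_loc_unif_def by blast
    moreover from U have "U \<subseteq> \<Union>\<U>" by blast
    ultimately show "\<exists>K \<epsilon>. compact K \<and> K \<subseteq> ball 0 1 \<and> \<epsilon> > 0 \<and>
        {g \<in> holo_ball. \<forall>z\<in>K. dist (g z) (f z) < \<epsilon>} \<subseteq> \<Union>\<U>"
      by (intro exI[of _ K] exI[of _ d] conjI) (auto simp only: intro: order_trans)
  qed
qed

lemma openin_loc_unif_topology: "openin loc_unif_topology U \<longleftrightarrow> openin_loc_unif U"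
  unfolding loc_unif_topology_def by (simp add: topology_inverse' istopology_loc_unif)

lemma topspace_loc_unif_topology: "topspace loc_unif_topology = holo_ball"
proof
  show "topspace loc_unif_topology \<subseteq> holo_ball"
    using openin_topspace[of loc_unif_topology]
    unfolding openin_loc_unif_topology openin_loc_unif_def by blast
  have "openin loc_unif_topology holo_ball"
    unfolding openin_loc_unif_topology openin_loc_unif_def
    by (intro conjI ballI exI[of _ "{}"] exI[of _ 1]) auto
  then show "holo_ball \<subseteq> topspace loc_unif_topology"
    by (rule openin_subset)
qed

end

theory Submission
  imports Defs "HOL-Complex_Analysis.Complex_Analysis"
begin

text \<open>
  For \<open>f\<close> in the class, the transition maps \<open>v\<^sub>t = f\<^sup>-\<^sup>1 \<circ> e\<^bsup>-tA\<^esup> \<circ> f\<close> are holomorphic self-maps of the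
  ball (the inverse of an injective holomorphic map is holomorphic), and the Schwarz lemma together
  with Harnack's inequality bounds them uniformly in \<open>f\<close>: \<open>v\<^sub>t\<close> contracts every smaller ball and is
  close to the identity for small \<open>t\<close>.

  Suppose \<open>A\<close> is nonresonant. The identity \<open>f \<circ> v\<^sub>t = e\<^bsup>-tA\<^esup> f\<close> expresses the commutator of the
  homogeneous part \<open>F\<^sub>k\<close> of \<open>f\<close> with the flow through the parts of lower order. If \<open>F\<^sub>k\<close> were unbounded
  over the class, a limit of normalized \<open>F\<^sub>k\<close> would be a nonzero homogeneous map commuting with the
  flow, which nonresonance excludes. Once the parts of order less than a large \<open>K\<close> are bounded, the
  remainder is controlled by the contraction property of \<open>v\<^sub>t\<close>, so the class is locally bounded.
  The functional equation also yields a uniform lower Lipschitz bound for \<open>f\<close>, so limits remain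
  injective, and the class is a closed subset of a compact product of balls.

  Conversely, a resonance gives shears \<open>z \<mapsto> z + c q(z) u\<close>, \<open>c\<close> arbitrary, which commute with the flow
  and therefore form an unbounded family in the class.
\<close>

section \<open>Estimates for holomorphic functions on a disc\<close>

text \<open>The transition maps are controlled uniformly because their derivative at 0 is
  \<open>flow A t\<close> whatever \<open>f\<close> is, whereas the constants available for
  \<open>f\<close> itself depend on \<open>f\<close>. Such constants serve only to certify an order
  of vanishing, after which a Schwarz lemma of that order replaces them by uniform ones, or they die
  out in an iteration.

  The obstacle to a direct bound for \<open>f\<close> is that undoing \<open>flow A 1\<close> costs
  a factor b which may exceed the gain of one contraction. On terms of order K the gain is q^K, so
  only finitely many orders escape this comparison; these are the ones handed to nonresonance. Since
  A need not be diagonalizable, nonresonance is exploited through eigenvectors modulo invariant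
  subspaces.

  The derivative of an injective map is known to be invertible only at 0, which is why inverses are
  treated by removing the critical values. Holomorphy is tested along complex lines, so that every
  estimate comes from one complex variable.\<close>

lemma mult_le_limit_left:
  fixes x M \<rho> a :: real
  assumes "a < \<rho>" "\<And>s. a < s \<Longrightarrow> s < \<rho> \<Longrightarrow> x * s \<le> M"
  shows "x * \<rho> \<le> M"
proof (rule tendsto_upperbound)
  show "((\<lambda>s. x * s) \<longlongrightarrow> x * \<rho>) (at_left \<rho>)"
    by (intro tendsto_intros)
  show "eventually (\<lambda>s. x * s \<le> M) (at_left \<rho>)"
    using assms eventually_at_left by blast
qed auto

text \<open>The maximum principle is applied on circles of radius s < \<rho>, where the numerator is
  at most \<open>M\<close> and the denominator is s. As the bound is given on the open disc only,
  the result follows by s \<rightarrow> \<rho>.\<close>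

lemma schwarz_quotient:
  fixes G :: "complex \<Rightarrow> complex"
  assumes hol: "G holomorphic_on ball 0 \<rho>" and "\<rho> > 0"
    and M: "\<And>\<zeta>. \<zeta> \<in> ball 0 \<rho> \<Longrightarrow> norm (G \<zeta>) \<le> M" and G0: "G 0 = 0"
  defines "H \<equiv> \<lambda>\<zeta>. if \<zeta> = 0 then deriv G 0 else G \<zeta> / \<zeta>"
  shows "H holomorphic_on ball 0 \<rho>" and "\<And>\<zeta>. \<zeta> \<in> ball 0 \<rho> \<Longrightarrow> norm (H \<zeta>) \<le> M / \<rho>"
proof -
  show H: "H holomorphic_on ball 0 \<rho>"
  proof -
    have "H = (\<lambda>z. if z = 0 then deriv G 0 else (G z - G 0) / (z - 0))"
      by (auto simp: H_def G0)
    then show ?thesis using pole_lemma[OF hol, of 0] \<open>\<rho> > 0\<close>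
      by (simp only: interior_ball centre_in_ball)
  qed
  fix \<zeta> :: complex assume z: "\<zeta> \<in> ball 0 \<rho>"
  have "norm (H \<zeta>) * \<rho> \<le> M"
  proof (rule mult_le_limit_left[of "norm \<zeta>"])
    show "norm \<zeta> < \<rho>" using z by simp
    fix s assume s: "norm \<zeta> < s" "s < \<rho>"
    then have "s > 0" using norm_ge_zero[of \<zeta>] by linarith
    have "norm (H \<zeta>) \<le> M / s"
    proof (rule maximum_modulus_frontier[of H "ball 0 s"])
      show "H holomorphic_on interior (ball 0 s)"
        using s by (auto intro!: holomorphic_on_subset[OF H])
      show "continuous_on (closure (ball 0 s)) H"
        using s \<open>s > 0\<close>
        by (auto intro!: continuous_on_subset[OF holomorphic_on_imp_continuous_on[OF H]])
      show "norm (H w) \<le> M / s" if "w \<in> frontier (ball 0 s)" for w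
      proof -
        have w: "norm w = s" using that \<open>s > 0\<close> by simp
        then have "norm (G w) \<le> M" using s by (intro M) auto
        with w \<open>s > 0\<close> show ?thesis
          by (auto simp: H_def norm_divide divide_right_mono)
      qed
    qed (use s in auto)
    then show "norm (H \<zeta>) * s \<le> M" using \<open>s > 0\<close> by (simp add: field_simps)
  qed
  then show "norm (H \<zeta>) \<le> M / \<rho>" using \<open>\<rho> > 0\<close> by (simp add: field_simps)
qed

text \<open>One zero at the origin is divided out in each induction step by
  \<open>schwarz_quotient\<close>. The constants \<open>C\<close> and \<open>\<delta>\<close> merely
  certify the order of vanishing; the conclusion contains only \<open>M\<close> and
  \<open>\<rho>\<close>, which is what later makes bounds uniform over the class.\<close>

lemma schwarz_order:
  fixes G :: "complex \<Rightarrow> complex"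
  assumes "G holomorphic_on ball 0 \<rho>" "\<rho> > 0"
    and "\<And>\<zeta>. \<zeta> \<in> ball 0 \<rho> \<Longrightarrow> norm (G \<zeta>) \<le> M"
    and "\<delta> > 0" "\<And>\<zeta>. \<zeta> \<noteq> 0 \<Longrightarrow> norm \<zeta> < \<delta> \<Longrightarrow> norm (G \<zeta>) \<le> C * norm \<zeta> ^ k"
    and "\<zeta> \<in> ball 0 \<rho>"
  shows "norm (G \<zeta>) \<le> M * (norm \<zeta> / \<rho>) ^ k"
  using assms
proof (induction k arbitrary: G M C \<zeta>)
  case 0
  then show ?case by simp
next
  case (Suc k)
  let ?d = "min \<delta> \<rho>"
  \<comment> \<open>The growth condition omits the origin, so the value there is obtained from
    continuity.\<close>
  have G0: "G 0 = 0"
  proof (rule ccontr)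
    assume "G 0 \<noteq> 0"
    have "isCont G 0"
      using Suc.prems(1,2) holomorphic_on_imp_continuous_on continuous_on_interior
      by (metis centre_in_ball interior_ball)
    then have a: "((\<lambda>\<zeta>. norm (G \<zeta>)) \<longlongrightarrow> norm (G 0)) (at 0)"
      by (intro tendsto_norm) (simp add: isCont_def)
    have b: "((\<lambda>\<zeta>::complex. C * norm \<zeta> ^ Suc k) \<longlongrightarrow> C * norm (0::complex) ^ Suc k) (at 0)"
      by (intro tendsto_intros)
    have ev: "eventually (\<lambda>\<zeta>. norm (G \<zeta>) \<le> C * norm \<zeta> ^ Suc k) (at 0)"
      unfolding eventually_at using Suc.prems(4,5) by (intro exI[of _ \<delta>]) auto
    have "norm (G 0) \<le> C * norm (0::complex) ^ Suc k"
      by (rule tendsto_le[OF _ b a ev]) simp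
    then show False using \<open>G 0 \<noteq> 0\<close> by simp
  qed
  let ?H = "\<lambda>\<zeta>. if \<zeta> = 0 then deriv G 0 else G \<zeta> / \<zeta>"
  note H = schwarz_quotient[OF Suc.prems(1,2,3) G0]
  have "norm (?H \<zeta>) \<le> M / \<rho> * (norm \<zeta> / \<rho>) ^ k"
  proof (rule Suc.IH[of ?H "M / \<rho>" C])
    show "norm (?H \<zeta>) \<le> C * norm \<zeta> ^ k" if "\<zeta> \<noteq> 0" "norm \<zeta> < \<delta>" for \<zeta>
      using Suc.prems(5)[OF that] that by (simp add: norm_divide field_simps)
  qed (use H Suc.prems in \<open>auto simp: if_distrib\<close>)
  moreover have "norm (G \<zeta>) = norm \<zeta> * norm (?H \<zeta>)"
    using G0 by (auto simp: norm_divide)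
  ultimately have "norm (G \<zeta>) \<le> norm \<zeta> * (M / \<rho> * (norm \<zeta> / \<rho>) ^ k)"
    by (metis mult_left_mono norm_ge_zero)
  then show ?case by (simp add: field_simps)
qed

lemma taylor_coeff_bound:
  fixes g :: "complex \<Rightarrow> complex"
  assumes hol: "g holomorphic_on ball 0 \<rho>" and "\<rho> > 0"
    and M: "\<And>\<zeta>. \<zeta> \<in> ball 0 \<rho> \<Longrightarrow> norm (g \<zeta>) \<le> M"
  shows "norm ((deriv ^^ j) g 0 / fact j) \<le> M / \<rho> ^ j"
proof -
  let ?a = "norm ((deriv ^^ j) g 0 / fact j)"
  have M0: "M \<ge> 0" by (rule order_trans[OF norm_ge_zero M[of 0]]) (use \<open>\<rho> > 0\<close> in simp)
  have "?a * s ^ j \<le> M" if "0 < s" "s < \<rho>" for s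
  proof -
    have "norm ((deriv ^^ j) g 0) \<le> fact j * M / s ^ j"
    proof (rule Cauchy_inequality)
      show "g holomorphic_on ball 0 s"
        using that by (auto intro!: holomorphic_on_subset[OF hol])
      show "continuous_on (cball 0 s) g"
        using that by (auto intro!: continuous_on_subset[OF holomorphic_on_imp_continuous_on[OF hol]])
      show "norm (g x) \<le> M" if "norm (0 - x) = s" for x
        using that \<open>s < \<rho>\<close> by (intro M) auto
    qed fact
    then show ?thesis using that by (simp add: norm_divide field_simps)
  qed
  moreover have "((\<lambda>s. ?a * s ^ j) \<longlongrightarrow> ?a * \<rho> ^ j) (at_left \<rho>)"
    by (intro tendsto_intros)
  moreover have "eventually (\<lambda>s. 0 < s \<and> s < \<rho>) (at_left \<rho>)"
    using \<open>\<rho> > 0\<close> eventually_at_left by blast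
  ultimately have "?a * \<rho> ^ j \<le> M"
    by (intro tendsto_upperbound[where F="at_left \<rho>"]) (auto elim!: eventually_mono)
  then show ?thesis using \<open>\<rho> > 0\<close> by (simp add: field_simps)
qed

text \<open>On the whole disc the partial sum adds at most k terms of size \<open>M\<close>, whence
  the factor k + 1. On half the radius the tail of the power series is dominated by a geometric
  series, so the remainder vanishes to order k and \<open>schwarz_order\<close> applies.\<close>

lemma taylor_remainder_bound:
  fixes g :: "complex \<Rightarrow> complex"
  assumes hol: "g holomorphic_on ball 0 \<rho>" and "\<rho> > 0"
    and M: "\<And>\<zeta>. \<zeta> \<in> ball 0 \<rho> \<Longrightarrow> norm (g \<zeta>) \<le> M"
    and "\<zeta> \<in> ball 0 \<rho>"
  shows "norm (g \<zeta> - (\<Sum>j<k. (deriv ^^ j) g 0 / fact j * \<zeta> ^ j))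
           \<le> (real k + 1) * M * (norm \<zeta> / \<rho>) ^ k"
proof (rule schwarz_order[where G = "\<lambda>\<zeta>. g \<zeta> - (\<Sum>j<k. (deriv ^^ j) g 0 / fact j * \<zeta> ^ j)"
      and \<delta> = "\<rho> / 2" and C = "2 * M / \<rho> ^ k" and \<zeta> = \<zeta>])
  let ?a = "\<lambda>j. (deriv ^^ j) g 0 / fact j"
  have M0: "M \<ge> 0" by (rule order_trans[OF norm_ge_zero M[of 0]]) (use \<open>\<rho> > 0\<close> in simp)
  have a: "norm (?a j) \<le> M / \<rho> ^ j" for j
    by (rule taylor_coeff_bound[OF hol \<open>\<rho> > 0\<close> M])
  have trm: "norm (?a j * w ^ j) \<le> M * (norm w / \<rho>) ^ j" for j w
  proof -
    have "norm (?a j * w ^ j) \<le> M / \<rho> ^ j * norm w ^ j"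
      unfolding norm_mult norm_power by (intro mult_right_mono a) auto
    then show ?thesis by (simp add: power_divide)
  qed
  show "(\<lambda>\<zeta>. g \<zeta> - (\<Sum>j<k. ?a j * \<zeta> ^ j)) holomorphic_on ball 0 \<rho>"
    by (intro holomorphic_intros hol)
  show "norm (g w - (\<Sum>j<k. ?a j * w ^ j)) \<le> (real k + 1) * M" if w: "w \<in> ball 0 \<rho>" for w
  proof -
    have "norm (\<Sum>j<k. ?a j * w ^ j) \<le> (\<Sum>j<k. M)"
    proof (rule sum_norm_le)
      fix j
      have "norm (?a j * w ^ j) \<le> M * (norm w / \<rho>) ^ j" by (rule trm)
      also have "\<dots> \<le> M * 1"
        using w \<open>\<rho> > 0\<close> M0 by (intro mult_left_mono power_le_one) auto
      finally show "norm (?a j * w ^ j) \<le> M" by simp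
    qed
    then have "norm (g w - (\<Sum>j<k. ?a j * w ^ j)) \<le> M + real k * M"
      using M[OF w] norm_triangle_ineq4[of "g w" "\<Sum>j<k. ?a j * w ^ j"] by simp
    then show ?thesis by (simp add: algebra_simps)
  qed
  show "norm (g w - (\<Sum>j<k. ?a j * w ^ j)) \<le> 2 * M / \<rho> ^ k * norm w ^ k"
    if w: "norm w < \<rho> / 2" for w
  proof -
    define x where "x = norm w / \<rho>"
    have x: "0 \<le> x" "x < 1/2" using w \<open>\<rho> > 0\<close> by (auto simp: x_def field_simps)
    have x2: "1 / (1 - x) \<le> 2" using x by (simp add: divide_simps)
    have "(\<lambda>j. ?a j * (w - 0) ^ j) sums g w"
      by (rule holomorphic_power_series[OF hol]) (use w \<open>\<rho> > 0\<close> in auto)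
    then have s: "(\<lambda>j. ?a (j + k) * w ^ (j + k)) sums (g w - (\<Sum>j<k. ?a j * w ^ j))"
      by (subst sums_iff_shift) (simp add: lessThan_atLeast0)
    have geo: "(\<lambda>j. M * x ^ k * x ^ j) sums (M * x ^ k * (1 / (1 - x)))"
      by (intro sums_mult geometric_sums) (use x in auto)
    have "norm (g w - (\<Sum>j<k. ?a j * w ^ j)) \<le> M * x ^ k * (1 / (1 - x))"
    proof (rule norm_sums_le[OF s geo])
      show "norm (?a (j + k) * w ^ (j + k)) \<le> M * x ^ k * x ^ j" for j
        using trm[of "j + k" w] by (simp add: power_add mult_ac x_def)
    qed
    also have "\<dots> \<le> M * x ^ k * 2"
      using x x2 M0 by (intro mult_left_mono) auto
    finally show ?thesis by (simp add: power_divide mult_ac x_def)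
  qed
qed (use assms in auto)

lemma poly_small_imp_coeffs_0:
  fixes d :: "nat \<Rightarrow> complex"
  assumes "\<delta> > 0"
    and "\<And>\<zeta>. \<zeta> \<noteq> 0 \<Longrightarrow> norm \<zeta> < \<delta> \<Longrightarrow> norm (\<Sum>j<k. d j * \<zeta> ^ j) \<le> C * norm \<zeta> ^ k"
    and "j < k"
  shows "d j = 0"
  using assms
proof (induction k arbitrary: d j)
  case 0
  then show ?case by simp
next
  case (Suc k)
  have split: "(\<Sum>j<Suc k. d j * \<zeta> ^ j) = d 0 + \<zeta> * (\<Sum>j<k. d (Suc j) * \<zeta> ^ j)" for \<zeta>
    by (subst sum.lessThan_Suc_shift) (simp add: sum_distrib_left mult_ac)
  have d0: "d 0 = 0"
  proof -
    have a: "((\<lambda>\<zeta>. norm (\<Sum>j<Suc k. d j * \<zeta> ^ j)) \<longlongrightarrow> norm (\<Sum>j<Suc k. d j * 0 ^ j)) (at 0)"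
      by (intro tendsto_intros)
    have b: "((\<lambda>\<zeta>::complex. C * norm \<zeta> ^ Suc k) \<longlongrightarrow> C * norm (0::complex) ^ Suc k) (at 0)"
      by (intro tendsto_intros)
    have ev: "eventually (\<lambda>\<zeta>. norm (\<Sum>j<Suc k. d j * \<zeta> ^ j) \<le> C * norm \<zeta> ^ Suc k) (at 0)"
      unfolding eventually_at using Suc.prems(1,2) by (intro exI[of _ \<delta>]) auto
    have "norm (\<Sum>j<Suc k. d j * 0 ^ j) \<le> C * norm (0::complex) ^ Suc k"
      by (rule tendsto_le[OF _ b a ev]) simp
    then show ?thesis by (simp only: split) simp
  qed
  have "d (Suc i) = 0" if "i < k" for i
  proof (rule Suc.IH[of "\<lambda>i. d (Suc i)", OF Suc.prems(1) _ that])
    fix \<zeta> :: complex assume z: "\<zeta> \<noteq> 0" "norm \<zeta> < \<delta>"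
    have "norm \<zeta> * norm (\<Sum>j<k. d (Suc j) * \<zeta> ^ j) \<le> C * norm \<zeta> ^ Suc k"
      using Suc.prems(2)[OF z] unfolding split d0 by (simp add: norm_mult)
    then show "norm (\<Sum>j<k. d (Suc j) * \<zeta> ^ j) \<le> C * norm \<zeta> ^ k"
      using z by (simp add: field_simps)
  qed
  with d0 Suc.prems(3) show ?case by (cases j) auto
qed

text \<open>A polynomial that approximates \<open>g\<close> to order k carries the Taylor
  coefficients of \<open>g\<close>, and these obey Cauchy's estimate. A coefficient can thus be read
  off an asymptotic identity, with a bound that does not involve \<open>C\<close>.\<close>

lemma expansion_coeff_bound:
  fixes g :: "complex \<Rightarrow> complex"
  assumes hol: "g holomorphic_on ball 0 1"
    and M: "\<And>\<zeta>. \<zeta> \<in> ball 0 1 \<Longrightarrow> norm (g \<zeta>) \<le> M"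
    and "\<delta> > 0"
    and ex: "\<And>\<zeta>. \<zeta> \<noteq> 0 \<Longrightarrow> norm \<zeta> < \<delta> \<Longrightarrow> norm (g \<zeta> - (\<Sum>j<k. c j * \<zeta> ^ j)) \<le> C * norm \<zeta> ^ k"
    and "j < k"
  shows "norm (c j) \<le> M"
proof -
  let ?a = "\<lambda>j. (deriv ^^ j) g 0 / fact j"
  have "c j - ?a j = 0"
  proof (rule poly_small_imp_coeffs_0[of "min \<delta> 1" "\<lambda>j. c j - ?a j" k "C + (real k + 1) * M"])
    fix \<zeta> :: complex assume z: "\<zeta> \<noteq> 0" "norm \<zeta> < min \<delta> 1"
    have "norm (g \<zeta> - (\<Sum>j<k. ?a j * \<zeta> ^ j)) \<le> (real k + 1) * M * norm \<zeta> ^ k"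
      using taylor_remainder_bound[OF hol _ M, of \<zeta> k] z by simp
    moreover have "norm (g \<zeta> - (\<Sum>j<k. c j * \<zeta> ^ j)) \<le> C * norm \<zeta> ^ k" using ex z by simp
    moreover have "(\<Sum>j<k. (c j - ?a j) * \<zeta> ^ j) =
      (g \<zeta> - (\<Sum>j<k. ?a j * \<zeta> ^ j)) - (g \<zeta> - (\<Sum>j<k. c j * \<zeta> ^ j))"
      by (simp add: sum_subtractf left_diff_distrib)
    ultimately show "norm (\<Sum>j<k. (c j - ?a j) * \<zeta> ^ j) \<le> (C + (real k + 1) * M) * norm \<zeta> ^ k"
      using norm_triangle_ineq4[of "g \<zeta> - (\<Sum>j<k. ?a j * \<zeta> ^ j)" "g \<zeta> - (\<Sum>j<k. c j * \<zeta> ^ j)"]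
      by (simp add: distrib_right)
  qed (use assms in auto)
  then show ?thesis using taylor_coeff_bound[OF hol _ M, of j] by simp
qed

text \<open>A Cayley transform sends the right half plane to the disc and the value at 0 to 0, so
  the Schwarz lemma bounds the image of \<open>H \<zeta>\<close>. Adding e > 0 makes the real part
  strictly positive; e tends to 0 at the end.\<close>

lemma harnack_disc:
  fixes H :: "complex \<Rightarrow> complex"
  assumes hol: "H holomorphic_on ball 0 1"
    and pos: "\<And>\<zeta>. \<zeta> \<in> ball 0 1 \<Longrightarrow> Re (H \<zeta>) \<ge> 0"
    and z: "norm \<zeta> \<le> r" "r < 1"
  shows "Re (H 0) * (1 - r) \<le> Re (H \<zeta>) * (1 + r)" "Re (H \<zeta>) * (1 - r) \<le> Re (H 0) * (1 + r)"
proof -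
  have r0: "r \<ge> 0" using z norm_ge_zero order_trans by blast
  have strict: "(Re (H 0) + e) * (1 - r) \<le> (Re (H \<zeta>) + e) * (1 + r) \<and>
                (Re (H \<zeta>) + e) * (1 - r) \<le> (Re (H 0) + e) * (1 + r)" if e: "e > 0" for e
  proof -
    define K where "K = (\<lambda>w. H w + of_real e)"
    define a where "a = K 0"
    have Kpos: "Re (K w) > 0" if "w \<in> ball 0 1" for w
      using pos[OF that] e by (simp add: K_def)
    have a: "Re a > 0" using Kpos[of 0] by (simp add: a_def)
    define \<phi> where "\<phi> = (\<lambda>w. (K w - a) / (K w + cnj a))"
    have nz: "K w + cnj a \<noteq> 0" if "w \<in> ball 0 1" for w
    proof -
      have "Re (K w + cnj a) > 0" using Kpos[OF that] a by simp
      then show ?thesis by (metis less_irrefl zero_complex.sel(1))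
    qed
    have "norm (\<phi> \<zeta>) \<le> norm \<zeta>"
    proof (rule Schwarz_Lemma(1))
      show "\<phi> holomorphic_on ball 0 1"
        unfolding \<phi>_def K_def by (intro holomorphic_intros hol) (use nz in \<open>auto simp: K_def\<close>)
      show "\<phi> 0 = 0" by (simp add: \<phi>_def a_def)
      show "norm (\<phi> w) < 1" if "norm w < 1" for w
      proof -
        have w: "w \<in> ball 0 1" using that by simp
        have "(norm (K w + cnj a))\<^sup>2 - (norm (K w - a))\<^sup>2 = 4 * Re (K w) * Re a"
          unfolding cmod_power2 by (simp add: power2_eq_square algebra_simps)
        moreover have "4 * Re (K w) * Re a > 0" using Kpos[OF w] a by simp
        ultimately have "(norm (K w - a))\<^sup>2 < (norm (K w + cnj a))\<^sup>2" by linarith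
        then have "norm (K w - a) < norm (K w + cnj a)"
          by (rule power_less_imp_less_base) simp
        then show ?thesis using nz[OF w] by (simp add: \<phi>_def norm_divide)
      qed
    qed (use z in auto)
    then have le: "norm (\<phi> \<zeta>) \<le> r" using z by simp
    have zb: "\<zeta> \<in> ball 0 1" using z by simp
    define b where "b = K \<zeta>"
    have b: "Re b > 0" using Kpos[OF zb] by (simp add: b_def)
    have "norm (b - a) \<le> r * norm (b + cnj a)"
      using le nz[OF zb] by (simp add: \<phi>_def norm_divide b_def field_simps)
    then have "(norm (b - a))\<^sup>2 \<le> r\<^sup>2 * (norm (b + cnj a))\<^sup>2"
      by (metis norm_ge_zero power_mono power_mult_distrib)
    then have main: "(Re b - Re a)\<^sup>2 + (Im b - Im a)\<^sup>2 \<le> r\<^sup>2 * ((Re b + Re a)\<^sup>2 + (Im b - Im a)\<^sup>2)"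
      unfolding cmod_power2 by simp
    have "r\<^sup>2 * (Im b - Im a)\<^sup>2 \<le> 1 * (Im b - Im a)\<^sup>2"
      using r0 z by (intro mult_right_mono) (auto simp: power_le_one)
    with main have "(Re b - Re a)\<^sup>2 \<le> r\<^sup>2 * (Re b + Re a)\<^sup>2"
      by (simp add: algebra_simps)
    then have "(Re b - Re a)\<^sup>2 \<le> (r * (Re b + Re a))\<^sup>2" by (simp add: power_mult_distrib)
    then have "\<bar>Re b - Re a\<bar> \<le> r * (Re b + Re a)"
      using a b r0 power2_le_iff_abs_le[of "r * (Re b + Re a)" "Re b - Re a"] by simp
    then have "Re b - Re a \<le> r * (Re b + Re a)" "Re a - Re b \<le> r * (Re b + Re a)"
      by linarith+
    moreover have "Re b = Re (H \<zeta>) + e" "Re a = Re (H 0) + e"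
      by (simp_all add: a_def b_def K_def)
    ultimately show ?thesis
      by (simp add: algebra_simps)
  qed
  have "Re (H 0) * (1 - r) + e * (1 - r) \<le> Re (H \<zeta>) * (1 + r) + e * (1 + r)" if "e > 0" for e
    using strict[OF that] by (simp add: algebra_simps)
  moreover have "Re (H \<zeta>) * (1 - r) + e * (1 - r) \<le> Re (H 0) * (1 + r) + e * (1 + r)" if "e > 0" for e
    using strict[OF that] by (simp add: algebra_simps)
  ultimately have *: "Re (H 0) * (1 - r) \<le> Re (H \<zeta>) * (1 + r) + e * (2 * r)"
     "Re (H \<zeta>) * (1 - r) \<le> Re (H 0) * (1 + r) + e * (2 * r)" if "e > 0" for e
    using that by (simp_all add: algebra_simps)
  have lim: "((\<lambda>e. x + e * (2 * r)) \<longlongrightarrow> x + 0 * (2 * r)) (at_right 0)" for x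
    by (intro tendsto_intros)
  show "Re (H 0) * (1 - r) \<le> Re (H \<zeta>) * (1 + r)"
    using tendsto_lowerbound[OF lim[of "Re (H \<zeta>) * (1 + r)"], of "Re (H 0) * (1 - r)"] *(1)
    by (auto simp: eventually_at_right_less intro: eventually_mono[OF eventually_at_right_less])
  show "Re (H \<zeta>) * (1 - r) \<le> Re (H 0) * (1 + r)"
    using tendsto_lowerbound[OF lim[of "Re (H 0) * (1 + r)"], of "Re (H \<zeta>) * (1 - r)"] *(2)
    by (auto simp: eventually_at_right_less intro: eventually_mono[OF eventually_at_right_less])
qed

section \<open>Rado's theorem in one variable\<close>

text \<open>The product \<open>\<theta> w * \<phi> w ^ n\<close> vanishes on the part of the
  frontier inside the disc, so the maximum principle sees only the outer circle and gives a bound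
  \<open>B * M ^ n\<close>. For large n the fixed factor \<open>\<theta> \<zeta>\<close> loses its
  influence.\<close>

lemma rado_max_modulus:
  fixes \<phi> \<theta> :: "complex \<Rightarrow> complex"
  assumes "\<rho> > 0" and cont: "continuous_on (cball 0 \<rho>) \<phi>" "continuous_on (cball 0 \<rho>) \<theta>"
    and hol: "\<phi> holomorphic_on {\<zeta> \<in> ball 0 \<rho>. \<theta> \<zeta> \<noteq> 0}" "\<theta> holomorphic_on {\<zeta> \<in> ball 0 \<rho>. \<theta> \<zeta> \<noteq> 0}"
    and M: "\<And>\<zeta>. norm \<zeta> = \<rho> \<Longrightarrow> norm (\<phi> \<zeta>) \<le> M"
    and z: "\<zeta> \<in> ball 0 \<rho>" "\<theta> \<zeta> \<noteq> 0"
  shows "norm (\<phi> \<zeta>) \<le> M"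
proof -
  define U where "U = {\<zeta> \<in> ball 0 \<rho>. \<theta> \<zeta> \<noteq> 0}"
  have U: "U = ball 0 \<rho> \<inter> \<theta> -` (- {0})" by (auto simp: U_def)
  have "continuous_on (ball 0 \<rho>) \<theta>" by (rule continuous_on_subset[OF cont(2)]) auto
  then have oU: "open U" unfolding U by (intro continuous_open_preimage) auto
  have sub: "closure U \<subseteq> cball 0 \<rho>"
    by (rule closure_minimal) (auto simp: U_def)
  obtain B where B: "\<And>w. w \<in> cball 0 \<rho> \<Longrightarrow> norm (\<theta> w) \<le> B"
    using compact_imp_bounded[OF compact_continuous_image[OF cont(2) compact_cball]]
    unfolding bounded_iff by blast
  have M0: "M \<ge> 0"
    by (rule order_trans[OF norm_ge_zero M[of "of_real \<rho>"]]) (use \<open>\<rho> > 0\<close> in simp)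
  have B0: "B \<ge> 0"
    by (rule order_trans[OF norm_ge_zero B[of 0]]) (use \<open>\<rho> > 0\<close> in simp)
  have key: "norm (\<theta> \<zeta>) * norm (\<phi> \<zeta>) ^ n \<le> B * M ^ n" if "n > 0" for n
  proof -
    have "norm (\<theta> \<zeta> * \<phi> \<zeta> ^ n) \<le> B * M ^ n"
    proof (rule maximum_modulus_frontier[of "\<lambda>w. \<theta> w * \<phi> w ^ n" U])
      show "(\<lambda>w. \<theta> w * \<phi> w ^ n) holomorphic_on interior U"
        using oU hol by (auto simp: interior_open U_def intro!: holomorphic_intros)
      show "continuous_on (closure U) (\<lambda>w. \<theta> w * \<phi> w ^ n)"
        by (intro continuous_intros continuous_on_subset[OF _ sub] cont)
      show "bounded U" by (rule bounded_subset[OF bounded_ball[of 0 \<rho>]]) (auto simp: U_def)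
      show "\<zeta> \<in> U" using z by (simp add: U_def)
      fix w assume w: "w \<in> frontier U"
      then have wc: "w \<in> closure U" "w \<notin> U" using oU by (auto simp: frontier_def interior_open)
      then have wb: "w \<in> cball 0 \<rho>" using sub by blast
      show "norm (\<theta> w * \<phi> w ^ n) \<le> B * M ^ n"
      proof (cases "norm w = \<rho>")
        case True
        then show ?thesis unfolding norm_mult norm_power
          using B[OF wb] M[OF True] B0 by (intro mult_mono power_mono) auto
      next
        case False
        then have "\<theta> w = 0" using wb wc by (auto simp: U_def)
        then show ?thesis using M0 B0 by simp
      qed
    qed
    then show ?thesis by (simp add: norm_mult norm_power)
  qed
  show ?thesis
  proof (rule ccontr)
    assume "\<not> ?thesis"
    then have gt: "norm (\<phi> \<zeta>) > M" by simp
    define c where "c = norm (\<theta> \<zeta>)"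
    have c: "c > 0" using z by (simp add: c_def)
    show False
    proof (cases "M = 0")
      case True
      then show False using key[of 1] gt c by (simp add: c_def mult_le_0_iff)
    next
      case False
      with M0 have Mp: "M > 0" by simp
      then have "norm (\<phi> \<zeta>) / M > 1" using gt by simp
      then obtain n where n: "B / c < (norm (\<phi> \<zeta>) / M) ^ n"
        using real_arch_pow by blast
      also have "\<dots> \<le> (norm (\<phi> \<zeta>) / M) ^ Suc n"
        using gt Mp by (intro power_increasing) auto
      finally have "B * M ^ Suc n < c * norm (\<phi> \<zeta>) ^ Suc n"
        using c Mp by (simp add: power_divide divide_simps mult_ac)
      then show False using key[of "Suc n"] by (simp add: c_def)
    qed
  qed
qed

text \<open>A Taylor expansion of \<phi> at 0 is built by repeated difference quotients. Each
  quotient stays in the same class of functions while its bound grows by the factor 2/\<rho>, so the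
  series converges on the disc of radius \<rho>/2, and its remainder tends to 0 wherever \<theta> is
  nonzero.\<close>

lemma rado_local_extension:
  fixes \<phi> \<theta> :: "complex \<Rightarrow> complex"
  assumes "\<rho> > 0" and cont: "continuous_on (cball 0 \<rho>) \<phi>" "continuous_on (cball 0 \<rho>) \<theta>"
    and hol: "\<phi> holomorphic_on {\<zeta> \<in> ball 0 \<rho>. \<theta> \<zeta> \<noteq> 0}" "\<theta> holomorphic_on {\<zeta> \<in> ball 0 \<rho>. \<theta> \<zeta> \<noteq> 0}"
    and nz: "\<theta> 0 \<noteq> 0"
  shows "\<exists>S. S holomorphic_on ball 0 (\<rho>/2) \<and> (\<forall>\<zeta>\<in>ball 0 (\<rho>/2). \<theta> \<zeta> \<noteq> 0 \<longrightarrow> \<phi> \<zeta> = S \<zeta>)"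
proof -
  define U where "U = {\<zeta> \<in> ball 0 \<rho>. \<theta> \<zeta> \<noteq> 0}"
  have U: "U = ball 0 \<rho> \<inter> \<theta> -` (- {0})" by (auto simp: U_def)
  have "continuous_on (ball 0 \<rho>) \<theta>" by (rule continuous_on_subset[OF cont(2)]) auto
  then have oU: "open U" unfolding U by (intro continuous_open_preimage) auto
  have U0: "0 \<in> U" using nz \<open>\<rho> > 0\<close> by (simp add: U_def)
  obtain M where M: "\<And>w. w \<in> cball 0 \<rho> \<Longrightarrow> norm (\<phi> w) \<le> M"
    using compact_imp_bounded[OF compact_continuous_image[OF cont(1) compact_cball]]
    unfolding bounded_iff by blast
  define q where "q = (\<lambda>(g::complex\<Rightarrow>complex) \<zeta>. if \<zeta> = 0 then deriv g 0 else (g \<zeta> - g 0) / \<zeta>)"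
  \<comment> \<open>The bound is required on the outer circle only; \<open>mm\<close> transfers it
    to all of \<open>U\<close>, in particular to the value at 0, which becomes a Taylor
    coefficient.\<close>
  define R where "R = (\<lambda>g C. continuous_on (cball 0 \<rho>) g \<and> g holomorphic_on U \<and> (\<forall>\<zeta>. norm \<zeta> = \<rho> \<longrightarrow> norm (g \<zeta>) \<le> C))"
  have mm: "norm (g \<zeta>) \<le> C" if "R g C" "\<zeta> \<in> U" for g C \<zeta>
    by (rule rado_max_modulus[of \<rho> g \<theta>])
       (use that assms(1) cont(2) hol(2) in \<open>auto simp: R_def U_def\<close>)
  have step: "R (q g) (C * (2 / \<rho>))" if g: "R g C" for g C
    unfolding R_def
  proof (intro conjI allI impI)
    have "(\<lambda>z. if z = 0 then deriv g 0 else (g z - g 0) / (z - 0)) holomorphic_on U"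
      by (rule pole_lemma) (use g oU U0 in \<open>auto simp: R_def interior_open\<close>)
    then show hq: "q g holomorphic_on U" by (simp add: q_def cong: if_cong)
    have "continuous_on (U \<union> (cball 0 \<rho> - {0})) (q g)"
    proof (rule continuous_on_Un_local_open)
      have eq: "U \<union> (cball 0 \<rho> - {0}) = cball 0 \<rho>" using U0 by (auto simp: U_def)
      show "openin (top_of_set (U \<union> (cball 0 \<rho> - {0}))) U"
        using openin_open_Int[OF oU, of "U \<union> (cball 0 \<rho> - {0})"] by (simp add: Int_absorb1)
      have "openin (top_of_set (cball (0::complex) \<rho>)) (cball 0 \<rho> \<inter> (- {0}))"
        by (intro openin_open_Int) auto
      then show "openin (top_of_set (U \<union> (cball 0 \<rho> - {0}))) (cball 0 \<rho> - {0})"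
        unfolding eq by (simp add: Diff_eq)
      show "continuous_on U (q g)" using hq holomorphic_on_imp_continuous_on by blast
      have "continuous_on (cball 0 \<rho> - {0}) (\<lambda>\<zeta>. (g \<zeta> - g 0) / \<zeta>)"
      proof -
        have "continuous_on (cball 0 \<rho> - {0}) g"
          using g continuous_on_subset[of "cball 0 \<rho>" g "cball 0 \<rho> - {0}"] by (simp add: R_def)
        then show ?thesis by (intro continuous_intros) auto
      qed
      then show "continuous_on (cball 0 \<rho> - {0}) (q g)"
        by (rule continuous_on_eq) (auto simp: q_def)
    qed
    moreover have "U \<union> (cball 0 \<rho> - {0}) = cball 0 \<rho>" using U0 by (auto simp: U_def)
    ultimately show "continuous_on (cball 0 \<rho>) (q g)" by simp
    fix \<zeta> :: complex assume z: "norm \<zeta> = \<rho>"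
    have "norm (g \<zeta> - g 0) \<le> C + C"
      using g z mm[OF g U0] by (intro order_trans[OF norm_triangle_ineq4] add_mono) (auto simp: R_def)
    then show "norm (q g \<zeta>) \<le> C * (2 / \<rho>)"
      using z \<open>\<rho> > 0\<close> by (auto simp: q_def norm_divide divide_simps)
  qed
  define g where "g = (\<lambda>k. (q ^^ k) \<phi>)"
  have gR: "R (g k) (M * (2 / \<rho>) ^ k)" for k
  proof (induction k)
    case 0
    then show ?case using cont hol M by (auto simp: g_def R_def U_def)
  next
    case (Suc k)
    then show ?case using step[OF Suc] by (simp add: g_def mult_ac)
  qed
  have g_rec: "g k \<zeta> = g k 0 + \<zeta> * g (Suc k) \<zeta>" for k \<zeta>
    by (simp add: g_def q_def)
  have expand: "\<phi> \<zeta> = (\<Sum>j<k. g j 0 * \<zeta> ^ j) + \<zeta> ^ k * g k \<zeta>" for k \<zeta>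
  proof (induction k)
    case 0
    then show ?case by (simp add: g_def)
  next
    case (Suc k)
    have "\<phi> \<zeta> = (\<Sum>j<k. g j 0 * \<zeta> ^ j) + \<zeta> ^ k * (g k 0 + \<zeta> * g (Suc k) \<zeta>)"
      using Suc g_rec by metis
    then show ?case by (simp add: algebra_simps)
  qed
  have M0: "M \<ge> 0"
    by (rule order_trans[OF norm_ge_zero M[of 0]]) (use \<open>\<rho> > 0\<close> in simp)
  have coeff: "norm (g j 0) \<le> M * (2 / \<rho>) ^ j" for j using mm[OF gR U0] .
  define S where "S = (\<lambda>\<zeta>. \<Sum>j. g j 0 * \<zeta> ^ j)"
  have small: "norm (2 * \<zeta> / \<rho>) < 1" if "\<zeta> \<in> ball 0 (\<rho>/2)" for \<zeta> :: complex
    using that \<open>\<rho> > 0\<close> by (simp add: norm_mult norm_divide field_simps)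
  have summ: "(\<lambda>j. g j 0 * \<zeta> ^ j) sums S \<zeta>" if z: "\<zeta> \<in> ball 0 (\<rho>/2)" for \<zeta>
    unfolding S_def
  proof (rule summable_sums, rule summable_comparison_test'[where N = 0])
    show "summable (\<lambda>j. M * norm (2 * \<zeta> / \<rho>) ^ j)"
      using small[OF z] by (intro summable_mult summable_geometric) simp
    fix j
    have "norm (g j 0 * \<zeta> ^ j) \<le> M * (2 / \<rho>) ^ j * norm \<zeta> ^ j"
      unfolding norm_mult norm_power by (intro mult_right_mono coeff) auto
    then show "norm (g j 0 * \<zeta> ^ j) \<le> M * norm (2 * \<zeta> / \<rho>) ^ j"
      using \<open>\<rho> > 0\<close> by (simp add: norm_mult norm_divide power_mult_distrib power_divide)
  qed
  show ?thesis
  proof (intro exI conjI ballI impI)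
    show "S holomorphic_on ball 0 (\<rho>/2)"
      by (rule power_series_holomorphic[of 0 _ "\<lambda>j. g j 0"]) (use summ in auto)
    fix \<zeta> assume z: "\<zeta> \<in> ball 0 (\<rho>/2)" and nz: "\<theta> \<zeta> \<noteq> 0"
    have zU: "\<zeta> \<in> U"
      using z nz \<open>\<rho> > 0\<close> subset_ball[of "\<rho>/2" \<rho> "0::complex"] by (auto simp: U_def)
    have "(\<lambda>k. \<zeta> ^ k * g k \<zeta>) \<longlonglongrightarrow> 0"
    proof (rule Lim_null_comparison)
      show "eventually (\<lambda>k. norm (\<zeta> ^ k * g k \<zeta>) \<le> M * norm (2 * \<zeta> / \<rho>) ^ k) sequentially"
      proof (rule always_eventually, rule allI)
        fix k
        have "norm (\<zeta> ^ k * g k \<zeta>) \<le> norm \<zeta> ^ k * (M * (2 / \<rho>) ^ k)"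
          unfolding norm_mult norm_power by (intro mult_left_mono mm[OF gR zU]) auto
        then show "norm (\<zeta> ^ k * g k \<zeta>) \<le> M * norm (2 * \<zeta> / \<rho>) ^ k"
          using \<open>\<rho> > 0\<close> by (simp add: norm_mult norm_divide power_mult_distrib power_divide field_simps)
      qed
      have "(\<lambda>k. M * norm (2 * \<zeta> / \<rho>) ^ k) \<longlonglongrightarrow> M * 0"
        using small[OF z] by (intro tendsto_mult_left LIMSEQ_power_zero) simp
      then show "(\<lambda>k. M * norm (2 * \<zeta> / \<rho>) ^ k) \<longlonglongrightarrow> 0" by simp
    qed
    then have "(\<lambda>k. \<phi> \<zeta> - \<zeta> ^ k * g k \<zeta>) \<longlonglongrightarrow> \<phi> \<zeta> - 0" by (intro tendsto_intros)
    moreover have "\<phi> \<zeta> - \<zeta> ^ k * g k \<zeta> = (\<Sum>j<k. g j 0 * \<zeta> ^ j)" for k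
      using expand[of \<zeta> k] by (simp add: algebra_simps)
    ultimately have "(\<lambda>k. \<Sum>j<k. g j 0 * \<zeta> ^ j) \<longlonglongrightarrow> \<phi> \<zeta>" by simp
    then have "(\<lambda>j. g j 0 * \<zeta> ^ j) sums \<phi> \<zeta>" unfolding sums_def .
    then show "\<phi> \<zeta> = S \<zeta>" using summ[OF z] by (rule sums_unique2)
  qed
qed

text \<open>A local form of Rado's theorem; the loss of half the radius keeps the proof elementary.\<close>

lemma rado_holomorphic:
  fixes \<phi> \<theta> :: "complex \<Rightarrow> complex"
  assumes "\<rho> > 0" and cont: "continuous_on (cball 0 \<rho>) \<phi>" "continuous_on (cball 0 \<rho>) \<theta>"
    and hol: "\<phi> holomorphic_on {\<zeta> \<in> ball 0 \<rho>. \<theta> \<zeta> \<noteq> 0}" "\<theta> holomorphic_on {\<zeta> \<in> ball 0 \<rho>. \<theta> \<zeta> \<noteq> 0}"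
    and nz: "\<theta> 0 \<noteq> 0"
  shows "\<phi> holomorphic_on ball 0 (\<rho>/2)"
proof -
  define D where "D = ball (0::complex) (\<rho>/2)"
  have D0: "0 \<in> D" using \<open>\<rho> > 0\<close> by (simp add: D_def)
  obtain S where S: "S holomorphic_on D" "\<And>\<zeta>. \<zeta> \<in> D \<Longrightarrow> \<theta> \<zeta> \<noteq> 0 \<Longrightarrow> \<phi> \<zeta> = S \<zeta>"
    using rado_local_extension[OF assms] by (auto simp: D_def)
  obtain T where T: "T holomorphic_on D" "\<And>\<zeta>. \<zeta> \<in> D \<Longrightarrow> \<theta> \<zeta> \<noteq> 0 \<Longrightarrow> \<theta> \<zeta> = T \<zeta>"
    using rado_local_extension[OF assms(1) cont(2) cont(2) hol(2) hol(2) nz] by (auto simp: D_def)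
  have T0: "T 0 \<noteq> 0" using T(2)[OF D0 nz] nz by simp
  define Z where "Z = {\<zeta> \<in> D. T \<zeta> = 0}"
  have "countable Z"
  proof (cases "T constant_on D")
    case True
    then have "Z = {}" using T0 D0 by (auto simp: Z_def constant_on_def)
    then show ?thesis by simp
  next
    case False
    have "D = (\<Union>n. cball (0::complex) (\<rho>/2 - inverse (real (Suc n))))"
    proof (intro equalityI subsetI)
      fix x assume "x \<in> D"
      then have "0 < \<rho>/2 - norm x" by (simp add: D_def)
      then obtain n where "inverse (real (Suc n)) < \<rho>/2 - norm x" using reals_Archimedean by blast
      then show "x \<in> (\<Union>n. cball (0::complex) (\<rho>/2 - inverse (real (Suc n))))" by (auto intro!: exI[of _ n])
    next
      fix x assume "x \<in> (\<Union>n. cball (0::complex) (\<rho>/2 - inverse (real (Suc n))))"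
      then obtain n where "norm x \<le> \<rho>/2 - inverse (real (Suc n))" by auto
      moreover have "inverse (real (Suc n)) > 0" by simp
      ultimately have "norm x < \<rho>/2" by linarith
      then show "x \<in> D" by (simp add: D_def)
    qed
    moreover have "fsigma (\<Union>n. cball (0::complex) (\<rho>/2 - inverse (real (Suc n))))"
      by (rule fsigma.intros) auto
    ultimately have "fsigma D" by simp
    with False show ?thesis unfolding Z_def
      by (intro holomorphic_countable_zeros T) (auto simp: D_def)
  qed
  then have conn: "connected (D - Z)"
    by (intro connected_open_diff_countable) (auto simp: D_def)
  have D_sub: "D \<subseteq> cball 0 \<rho>" using \<open>\<rho> > 0\<close> by (auto simp: D_def)
  have cD: "continuous_on D \<phi>" "continuous_on D \<theta>" "continuous_on D T" "continuous_on D S"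
    using continuous_on_subset[OF cont(1) D_sub] continuous_on_subset[OF cont(2) D_sub]
      holomorphic_on_imp_continuous_on T S by auto
  \<comment> \<open>Off the zeros of \<open>T\<close>, the function \<theta> is nonzero exactly
    where it agrees with \<open>T\<close>. The first description makes \<open>V\<close> open, the
    second makes it closed, and D - Z is connected because \<open>Z\<close> is countable.\<close>
  define V where "V = {\<zeta> \<in> D - Z. \<theta> \<zeta> \<noteq> 0}"
  have "openin (top_of_set (D - Z)) ((D - Z) \<inter> \<theta> -` (- {0}))"
    by (rule continuous_openin_preimage_gen)
       (use continuous_on_subset[OF cD(2), of "D - Z"] in auto)
  then have o: "openin (top_of_set (D - Z)) V"
  proof -
    have "V = (D - Z) \<inter> \<theta> -` (- {0})" by (auto simp: V_def)
    with \<open>openin (top_of_set (D - Z)) ((D - Z) \<inter> \<theta> -` (- {0}))\<close> show ?thesis by simp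
  qed
  have "V = {\<zeta> \<in> D - Z. \<theta> \<zeta> - T \<zeta> = 0}"
    using T(2) by (auto simp: V_def Z_def)
  moreover have "closedin (top_of_set (D - Z)) {\<zeta> \<in> D - Z. \<theta> \<zeta> - T \<zeta> = 0}"
  proof (rule continuous_closedin_preimage_constant)
    have "continuous_on D (\<lambda>\<zeta>. \<theta> \<zeta> - T \<zeta>)" by (intro continuous_on_diff cD)
    then show "continuous_on (D - Z) (\<lambda>\<zeta>. \<theta> \<zeta> - T \<zeta>)" by (rule continuous_on_subset) auto
  qed
  ultimately have c: "closedin (top_of_set (D - Z)) V" by simp
  have "0 \<in> V" using D0 T0 nz by (simp add: V_def Z_def)
  then have VD: "V = D - Z" using conn o c unfolding connected_clopen by blast
  \<comment> \<open>Disagreement is an open condition, but it can occur only in the countable set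
    \<open>Z\<close>, which contains no ball.\<close>
  have "{\<zeta> \<in> D. \<phi> \<zeta> - S \<zeta> \<noteq> 0} = {}"
  proof (rule ccontr)
    let ?W = "{\<zeta> \<in> D. \<phi> \<zeta> - S \<zeta> \<noteq> 0}"
    assume "?W \<noteq> {}"
    then obtain w where w: "w \<in> ?W" by blast
    have "?W = D \<inter> (\<lambda>\<zeta>. \<phi> \<zeta> - S \<zeta>) -` (- {0})" by auto
    moreover have "open (D \<inter> (\<lambda>\<zeta>. \<phi> \<zeta> - S \<zeta>) -` (- {0}))"
      by (intro continuous_open_preimage continuous_on_diff cD) (auto simp: D_def)
    ultimately have "open ?W" by simp
    then obtain e where e: "e > 0" "ball w e \<subseteq> ?W" using w openE by blast
    have "?W \<subseteq> Z" using VD S(2) by (auto simp: V_def)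
    then have "countable (ball w e)" using e \<open>countable Z\<close> by (meson countable_subset subset_trans)
    then show False using uncountable_ball e by blast
  qed
  then have "\<phi> \<zeta> = S \<zeta>" if "\<zeta> \<in> D" for \<zeta> using that by auto
  then show ?thesis using S(1) holomorphic_transform[of S D \<phi>] by (simp add: D_def)
qed

section \<open>Holomorphy along complex lines\<close>

lemma norm_smult: "norm (c *s (z::complex^'n)) = cmod c * norm z"
  by (simp add: norm_vec_def norm_mult L2_set_right_distrib)

lemma bounded_bilinear_smult: "bounded_bilinear ((*s) :: complex \<Rightarrow> complex^'n \<Rightarrow> complex^'n)"
  by unfold_locales
     (auto simp: vec_eq_iff algebra_simps norm_smult intro!: exI[of _ 1])

lemmas continuous_on_smult [continuous_intros] = bounded_bilinear.continuous_on[OF bounded_bilinear_smult]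
lemmas tendsto_smult [tendsto_intros] = bounded_bilinear.tendsto[OF bounded_bilinear_smult]
lemmas bounded_linear_smult_left = bounded_bilinear.bounded_linear_left[OF bounded_bilinear_smult]

lemma smult_of_real: "complex_of_real r *s z = r *\<^sub>R z"
  by (simp add: vec_eq_iff scaleR_conv_of_real[where 'a = complex])

lemma has_derivative_line: "((\<lambda>\<zeta>. a + \<zeta> *s (h::complex^'n)) has_derivative (\<lambda>x. x *s h)) (at \<zeta>)"
  using has_derivative_add[OF has_derivative_const
      bounded_linear.has_derivative[OF bounded_linear_smult_left has_derivative_ident]]
  by simp

lemma has_derivative_vec_nth_iff:
  fixes f :: "'a::real_normed_vector \<Rightarrow> complex^'n"
  shows "(f has_derivative D) (at x) \<longleftrightarrow> (\<forall>i. ((\<lambda>x. f x $ i) has_derivative (\<lambda>h. D h $ i)) (at x))"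
proof
  assume "(f has_derivative D) (at x)"
  then show "\<forall>i. ((\<lambda>x. f x $ i) has_derivative (\<lambda>h. D h $ i)) (at x)"
    using bounded_linear.has_derivative[OF bounded_linear_vec_nth] by blast
next
  assume *: "\<forall>i. ((\<lambda>x. f x $ i) has_derivative (\<lambda>h. D h $ i)) (at x)"
  show "(f has_derivative D) (at x)"
  proof (subst has_derivative_componentwise_within, intro ballI)
    fix b :: "complex^'n" assume "b \<in> Basis"
    then obtain i u where b: "b = axis i u" by (auto simp: Basis_vec_def)
    show "((\<lambda>x. f x \<bullet> b) has_derivative (\<lambda>h. D h \<bullet> b)) (at x)"
      unfolding b inner_axis using * by (intro has_derivative_inner_left) auto
  qed
qed

text \<open>Multiplying \<open>z\<close> by a unimodular number makes the product real and
  nonnegative, which reduces the claim to the real Cauchy-Schwarz inequality.\<close>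

lemma norm_cinner_le: "cmod (cinner z w) \<le> norm z * norm w"
proof (cases "cinner z w = 0")
  case False
  define u where "u = cnj (cinner z w) / cmod (cinner z w)"
  have u: "cmod u = 1" using False by (simp add: u_def norm_divide)
  have "cinner (u *s z) w = u * cinner z w"
    by (simp add: cinner_def sum_distrib_left mult_ac)
  also have "\<dots> = (cinner z w * cnj (cinner z w)) / cmod (cinner z w)"
    by (simp add: u_def mult.commute)
  also have "\<dots> = cmod (cinner z w)"
    unfolding complex_norm_square[symmetric] by (simp add: power2_eq_square)
  finally have "cmod (cinner z w) = Re (cinner (u *s z) w)" by simp
  also have "\<dots> \<le> norm (u *s z) * norm w" unfolding Re_cinner by (rule norm_cauchy_schwarz)
  finally show ?thesis by (simp add: norm_smult u)
qed simp

lemma norm_cinner_self_ge: "(norm z)\<^sup>2 \<le> cmod (cinner z z)"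
  using complex_Re_le_cmod[of "cinner z z"] by (simp add: Re_cinner power2_norm_eq_inner)

text \<open>Unlike complex differentiability, this condition passes to locally uniform limits at once; the
  two are equivalent by \<open>line_hol_has_derivative\<close>.\<close>

definition line_hol :: "(complex^'n \<Rightarrow> complex) \<Rightarrow> (complex^'n) set \<Rightarrow> bool" where
  "line_hol F U \<longleftrightarrow> continuous_on U F \<and>
     (\<forall>a h. (\<lambda>\<zeta>. F (a + \<zeta> *s h)) holomorphic_on {\<zeta>. a + \<zeta> *s h \<in> U})"

lemma line_holI:
  assumes "continuous_on U F" "\<And>a h. (\<lambda>\<zeta>. F (a + \<zeta> *s h)) holomorphic_on {\<zeta>. a + \<zeta> *s h \<in> U}"
  shows "line_hol F U"
  using assms by (simp add: line_hol_def)

lemma line_hol_continuous: "line_hol F U \<Longrightarrow> continuous_on U F"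
  by (simp add: line_hol_def)

lemma line_hol_slice:
  assumes "line_hol F U" "\<And>\<zeta>. \<zeta> \<in> S \<Longrightarrow> a + \<zeta> *s h \<in> U"
  shows "(\<lambda>\<zeta>. F (a + \<zeta> *s h)) holomorphic_on S"
  using assms by (auto simp: line_hol_def intro: holomorphic_on_subset)

lemma line_hol_subset: "line_hol F U \<Longrightarrow> V \<subseteq> U \<Longrightarrow> line_hol F V"
  by (rule line_holI) (auto intro: continuous_on_subset line_hol_continuous line_hol_slice)

lemma line_hol_cong:
  assumes "\<And>z. z \<in> U \<Longrightarrow> F z = G z"
  shows "line_hol F U \<longleftrightarrow> line_hol G U"
proof -
  have "(\<lambda>\<zeta>. F (a + \<zeta> *s h)) holomorphic_on {\<zeta>. a + \<zeta> *s h \<in> U} \<longleftrightarrow>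
        (\<lambda>\<zeta>. G (a + \<zeta> *s h)) holomorphic_on {\<zeta>. a + \<zeta> *s h \<in> U}" for a h
    by (rule holomorphic_cong) (use assms in auto)
  moreover have "continuous_on U F \<longleftrightarrow> continuous_on U G"
    by (rule continuous_on_cong) (use assms in auto)
  ultimately show ?thesis by (simp add: line_hol_def)
qed

lemma line_hol_const [simp]: "line_hol (\<lambda>z. c) U"
  by (simp add: line_hol_def)

lemma line_hol_add: "line_hol F U \<Longrightarrow> line_hol G U \<Longrightarrow> line_hol (\<lambda>z. F z + G z) U"
  by (simp add: line_hol_def continuous_on_add holomorphic_on_add)

lemma line_hol_diff: "line_hol F U \<Longrightarrow> line_hol G U \<Longrightarrow> line_hol (\<lambda>z. F z - G z) U"
  by (simp add: line_hol_def continuous_on_diff holomorphic_on_diff)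

lemma line_hol_mult: "line_hol F U \<Longrightarrow> line_hol G U \<Longrightarrow> line_hol (\<lambda>z. F z * G z) U"
  by (simp add: line_hol_def continuous_on_mult holomorphic_on_mult)

lemma line_hol_sum: "(\<And>i. i \<in> I \<Longrightarrow> line_hol (F i) U) \<Longrightarrow> line_hol (\<lambda>z. \<Sum>i\<in>I. F i z) U"
  by (induction I rule: infinite_finite_induct) (auto intro!: line_hol_add)

lemma line_hol_prod: "(\<And>i. i \<in> I \<Longrightarrow> line_hol (F i) U) \<Longrightarrow> line_hol (\<lambda>z. \<Prod>i\<in>I. F i z) U"
  by (induction I rule: infinite_finite_induct) (auto intro!: line_hol_mult)

lemma line_hol_translate:
  assumes "line_hol F U" shows "line_hol (\<lambda>z. F (z + c)) ((\<lambda>z. z - c) ` U)"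
proof (rule line_holI)
  have "continuous_on ((\<lambda>z. z - c) ` U) (F \<circ> (\<lambda>z. z + c))"
    using line_hol_continuous[OF assms]
    by (intro continuous_on_compose continuous_intros) (simp add: image_image)
  then show "continuous_on ((\<lambda>z. z - c) ` U) (\<lambda>z. F (z + c))" by (simp add: o_def)
  fix a h
  have "(\<lambda>\<zeta>. F ((a + c) + \<zeta> *s h)) holomorphic_on {\<zeta>. a + \<zeta> *s h \<in> (\<lambda>z. z - c) ` U}"
    by (rule line_hol_slice[OF assms]) (auto simp: algebra_simps)
  then show "(\<lambda>\<zeta>. F (a + \<zeta> *s h + c)) holomorphic_on {\<zeta>. a + \<zeta> *s h \<in> (\<lambda>z. z - c) ` U}"
    by (simp add: add_ac)
qed

lemma open_line_vimage:
  assumes "open (U::(complex^'n) set)" shows "open {\<zeta>. a + \<zeta> *s h \<in> U}"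
proof -
  have "open ((\<lambda>\<zeta>. a + \<zeta> *s h) -` U)"
    by (intro open_vimage assms continuous_intros)
  then show ?thesis by (simp add: vimage_def)
qed

lemma line_hol_local:
  assumes "open U" "\<And>z. z \<in> U \<Longrightarrow> \<exists>r>0. line_hol F (ball z r)"
  shows "line_hol F U"
proof (rule line_holI)
  show "continuous_on U F"
  proof (intro continuous_at_imp_continuous_on ballI)
    fix z assume "z \<in> U"
    then obtain r where "r > 0" "line_hol F (ball z r)" using assms by blast
    then show "isCont F z"
      using line_hol_continuous continuous_on_eq_continuous_at[OF open_ball] centre_in_ball by blast
  qed
  fix a h
  show "(\<lambda>\<zeta>. F (a + \<zeta> *s h)) holomorphic_on {\<zeta>. a + \<zeta> *s h \<in> U}"
    unfolding holomorphic_on_def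
  proof safe
    fix \<zeta> assume "a + \<zeta> *s h \<in> U"
    then obtain r where r: "r > 0" "line_hol F (ball (a + \<zeta> *s h) r)" using assms by blast
    let ?V = "{w. a + w *s h \<in> ball (a + \<zeta> *s h) r}"
    have "(\<lambda>\<zeta>. F (a + \<zeta> *s h)) holomorphic_on ?V" by (rule line_hol_slice[OF r(2)]) simp
    moreover have "open ?V" by (rule open_line_vimage) simp
    moreover have "\<zeta> \<in> ?V" using r(1) by simp
    ultimately have "(\<lambda>\<zeta>. F (a + \<zeta> *s h)) field_differentiable at \<zeta>"
      using holomorphic_on_imp_differentiable_at by blast
    then show "(\<lambda>\<zeta>. F (a + \<zeta> *s h)) field_differentiable (at \<zeta> within {\<zeta>. a + \<zeta> *s h \<in> U})"
      by (rule field_differentiable_at_within)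
  qed
qed

lemma line_hol_uniform_limit:
  fixes F :: "nat \<Rightarrow> complex^'n \<Rightarrow> complex"
  assumes "open U"
    and lim: "\<And>z. z \<in> U \<Longrightarrow>
      \<exists>r>0. ball z r \<subseteq> U \<and> (\<forall>k. line_hol (F k) (ball z r)) \<and> uniform_limit (ball z r) F G sequentially"
  shows "line_hol G U"
proof (rule line_hol_local[OF \<open>open U\<close>])
  fix z assume "z \<in> U"
  then obtain r where r: "r > 0" "\<And>k. line_hol (F k) (ball z r)"
      "uniform_limit (ball z r) F G sequentially"
    using lim by blast
  have "line_hol G (ball z r)"
  proof (rule line_holI)
    show "continuous_on (ball z r) G"
      by (rule uniform_limit_theorem[OF always_eventually r(3)]) (use line_hol_continuous r(2) in auto)
    fix a h
    show "(\<lambda>\<zeta>. G (a + \<zeta> *s h)) holomorphic_on {\<zeta>. a + \<zeta> *s h \<in> ball z r}"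
    proof (rule holomorphic_uniform_sequence)
      show op: "open {\<zeta>. a + \<zeta> *s h \<in> ball z r}" by (rule open_line_vimage) simp
      show "(\<lambda>\<zeta>. F k (a + \<zeta> *s h)) holomorphic_on {\<zeta>. a + \<zeta> *s h \<in> ball z r}" for k
        by (rule line_hol_slice[OF r(2)]) simp
      fix \<zeta> assume z: "\<zeta> \<in> {\<zeta>. a + \<zeta> *s h \<in> ball z r}"
      then obtain d where d: "d > 0" "cball \<zeta> d \<subseteq> {\<zeta>. a + \<zeta> *s h \<in> ball z r}"
        using op open_contains_cball by blast
      have "uniform_limit (cball \<zeta> d) (\<lambda>k \<zeta>. F k (a + \<zeta> *s h)) (\<lambda>\<zeta>. G (a + \<zeta> *s h)) sequentially"
      proof (rule uniform_limitI)
        fix e :: real assume "e > 0"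
        then have "eventually (\<lambda>k. \<forall>x\<in>ball z r. dist (F k x) (G x) < e) sequentially"
          using r(3) by (simp add: uniform_limit_iff)
        then show "eventually (\<lambda>k. \<forall>\<zeta>\<in>cball \<zeta> d. dist (F k (a + \<zeta> *s h)) (G (a + \<zeta> *s h)) < e) sequentially"
          by (rule eventually_mono) (use d(2) in blast)
      qed
      with d show "\<exists>d>0. cball \<zeta> d \<subseteq> {\<zeta>. a + \<zeta> *s h \<in> ball z r} \<and>
          uniform_limit (cball \<zeta> d) (\<lambda>k \<zeta>. F k (a + \<zeta> *s h)) (\<lambda>\<zeta>. G (a + \<zeta> *s h)) sequentially"
        by blast
    qed
  qed
  with r(1) show "\<exists>r>0. line_hol G (ball z r)" by blast
qed

section \<open>Directional derivatives and the total derivative\<close>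

definition dir_deriv :: "(complex^'n \<Rightarrow> complex) \<Rightarrow> complex^'n \<Rightarrow> complex^'n \<Rightarrow> complex" where
  "dir_deriv F z w = deriv (\<lambda>\<zeta>. F (z + \<zeta> *s w)) 0"

lemma dir_deriv_0 [simp]: "dir_deriv F z 0 = 0"
  by (simp add: dir_deriv_def)

lemma line_hol_slice_ball:
  assumes "line_hol F (ball z r)" "w \<noteq> 0"
  shows "(\<lambda>\<zeta>. F (z + \<zeta> *s w)) holomorphic_on ball 0 (r / norm w)"
  by (rule line_hol_slice[OF assms(1)]) (use assms(2) in \<open>auto simp: dist_norm norm_smult field_simps\<close>)

lemma dir_deriv_bound:
  assumes hol: "line_hol F (ball z r)" and "r > 0" and M: "\<And>x. x \<in> ball z r \<Longrightarrow> cmod (F x) \<le> M"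
  shows "cmod (dir_deriv F z w) \<le> M * norm w / r"
proof (cases "w = 0")
  case True
  then show ?thesis by simp
next
  case False
  have "cmod ((deriv ^^ 1) (\<lambda>\<zeta>. F (z + \<zeta> *s w)) 0 / fact 1) \<le> M / (r / norm w) ^ 1"
  proof (rule taylor_coeff_bound[OF line_hol_slice_ball[OF hol False]])
    show "cmod (F (z + \<zeta> *s w)) \<le> M" if "\<zeta> \<in> ball 0 (r / norm w)" for \<zeta>
      by (rule M) (use that False in \<open>auto simp: dist_norm norm_smult field_simps\<close>)
  qed (use \<open>r > 0\<close> False in auto)
  then show ?thesis by (simp add: dir_deriv_def)
qed

text \<open>This is the Taylor remainder of order 2 on the slice in direction \<open>w\<close>,
  evaluated at parameter 1; the slice disc has radius r / norm w, and 3 = 2 + 1.\<close>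

lemma dir_deriv_remainder:
  assumes hol: "line_hol F (ball z r)" and "r > 0" and M: "\<And>x. x \<in> ball z r \<Longrightarrow> cmod (F x) \<le> M"
    and w: "norm w < r"
  shows "cmod (F (z + w) - F z - dir_deriv F z w) \<le> 3 * M * (norm w / r)\<^sup>2"
proof (cases "w = 0")
  case True
  then show ?thesis by simp
next
  case False
  let ?g = "\<lambda>\<zeta>. F (z + \<zeta> *s w)"
  have "cmod (?g 1 - (\<Sum>j<2. (deriv ^^ j) ?g 0 / fact j * 1 ^ j))
      \<le> (real 2 + 1) * M * (norm (1::complex) / (r / norm w)) ^ 2"
  proof (rule taylor_remainder_bound[OF line_hol_slice_ball[OF hol False]])
    show "cmod (F (z + \<zeta> *s w)) \<le> M" if "\<zeta> \<in> ball 0 (r / norm w)" for \<zeta>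
      by (rule M) (use that False in \<open>auto simp: dist_norm norm_smult field_simps\<close>)
  qed (use \<open>r > 0\<close> False w in auto)
  then show ?thesis by (simp add: dir_deriv_def numeral_2_eq_2 algebra_simps)
qed

lemma line_hol_has_deriv:
  assumes "line_hol F U" "open U" "z \<in> U"
  shows "((\<lambda>\<zeta>. F (z + \<zeta> *s w)) has_field_derivative dir_deriv F z w) (at 0)"
  unfolding dir_deriv_def
  by (rule holomorphic_derivI[OF line_hol_slice[OF assms(1)] open_line_vimage[OF assms(2)]])
     (use assms(3) in auto)

lemma dir_deriv_smult:
  assumes "line_hol F U" "open U" "z \<in> U"
  shows "dir_deriv F z (c *s w) = c * dir_deriv F z w"
proof -
  have "((\<lambda>\<zeta>. F (z + (c * \<zeta>) *s w)) has_field_derivative dir_deriv F z w * c) (at 0)"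
    by (rule DERIV_chain2[where f = "\<lambda>\<zeta>. F (z + \<zeta> *s w)" and g = "\<lambda>\<zeta>. c * \<zeta>"])
       (use line_hol_has_deriv[OF assms, of w] in \<open>auto intro!: derivative_eq_intros\<close>)
  then show ?thesis
    unfolding dir_deriv_def[of F z "c *s w"]
    by (intro DERIV_imp_deriv) (simp add: vector_smult_assoc mult_ac)
qed

lemma line_hol_bounded_nhd:
  assumes "line_hol F U" "open U" "z \<in> U"
  obtains r M where "r > 0" "cball z r \<subseteq> U" "\<And>x. x \<in> cball z r \<Longrightarrow> cmod (F x) \<le> M"
proof -
  obtain r where r: "r > 0" "cball z r \<subseteq> U" using assms open_contains_cball by blast
  have "compact (F ` cball z r)"
    by (intro compact_continuous_image continuous_on_subset[OF line_hol_continuous[OF assms(1)]] r) auto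
  then have "\<exists>M. \<forall>x\<in>cball z r. cmod (F x) \<le> M"
    by (auto dest!: compact_imp_bounded simp: bounded_iff)
  with r that show ?thesis by blast
qed

text \<open>Difference quotients with steps \<open>s k\<close> are built from translates of
  \<open>F\<close>, hence holomorphic along lines. By \<open>dir_deriv_remainder\<close> they
  converge at a rate that is uniform near each point.\<close>

lemma line_hol_dir_deriv:
  assumes hol: "line_hol F U" and "open U"
  shows "line_hol (\<lambda>z. dir_deriv F z w) U"
proof (rule line_hol_local[OF \<open>open U\<close>])
  fix z assume z: "z \<in> U"
  obtain r M where r: "r > 0" "cball z r \<subseteq> U" "\<And>x. x \<in> cball z r \<Longrightarrow> cmod (F x) \<le> M"
    using line_hol_bounded_nhd[OF hol \<open>open U\<close> z] by metis
  \<comment> \<open>Dividing by norm w + 1 keeps all shifts by \<open>s k\<close> times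
    \<open>w\<close> shorter than r/4 and also covers w = 0.\<close>
  define s where "s = (\<lambda>k::nat. r / 4 / (norm w + 1) / (real k + 1))"
  have sp: "s k > 0" for k
    unfolding s_def using r(1) by (intro divide_pos_pos) (auto intro: add_nonneg_pos)
  have sw: "norm w * s k < r / 4" for k
  proof -
    have "norm w * s k = (r/4) * ((norm w / (norm w + 1)) * (1 / (real k + 1)))"
    proof -
      have "norm w * (r / 4 / p / q) = (r/4) * ((norm w / p) * (1 / q))" for p q by (simp add: mult_ac)
      then show ?thesis unfolding s_def .
    qed
    also have "\<dots> < (r/4) * 1"
    proof (rule mult_strict_left_mono)
      have "(norm w / (norm w + 1)) * (1 / (real k + 1)) \<le> (norm w / (norm w + 1)) * 1"
        by (intro mult_left_mono) auto
      also have "\<dots> < 1"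
      proof -
        have "norm w + 1 > 0" using norm_ge_zero[of w] by linarith
        then show ?thesis by (simp add: divide_less_eq)
      qed
      finally show "(norm w / (norm w + 1)) * (1 / (real k + 1)) < 1" .
    qed (use r in auto)
    finally show ?thesis by simp
  qed
  have s0: "s \<longlonglongrightarrow> 0"
  proof -
    have "(\<lambda>k. (r / 4 / (norm w + 1)) * inverse (real (Suc k))) \<longlonglongrightarrow> (r / 4 / (norm w + 1)) * 0"
      by (intro tendsto_intros LIMSEQ_inverse_real_of_nat)
    then show ?thesis by (simp add: s_def inverse_eq_divide add_ac)
  qed
  define G where "G = (\<lambda>k x. (F (x + of_real (s k) *s w) - F x) / of_real (s k))"
  have nsw: "norm (of_real (s k) *s w) < r / 4" for k
    using sw[of k] sp[of k] by (simp add: norm_smult mult.commute)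
  have "line_hol (\<lambda>z. dir_deriv F z w) (ball z (r/2))"
  proof (rule line_hol_uniform_limit)
    fix y assume y: "y \<in> ball z (r/2)"
    define d where "d = min (r/4) (r/2 - dist z y)"
    have d: "d > 0" "d \<le> r/4" "d \<le> r/2 - dist z y"
      using y r(1) by (auto simp: d_def min_def)
    have dsub: "ball y d \<subseteq> ball z (r/2)"
    proof
      fix x assume "x \<in> ball y d"
      then show "x \<in> ball z (r/2)" using d(3) dist_triangle[of z x y] by simp
    qed
    have G: "line_hol (G k) (ball y d)" for k
    proof -
      have "line_hol (\<lambda>x. F (x + of_real (s k) *s w)) (ball y d)"
      proof (rule line_hol_subset[OF line_hol_translate[OF hol]])
        show "ball y d \<subseteq> (\<lambda>z. z - of_real (s k) *s w) ` U"
        proof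
          fix x assume x: "x \<in> ball y d"
          have "dist z (x + of_real (s k) *s w) \<le> dist z y + dist y x + norm (of_real (s k) *s w)"
            using dist_triangle[of z "x + of_real (s k) *s w" x] dist_triangle[of z x y]
            by (simp add: dist_norm)
          also have "\<dots> \<le> r" using y x d(2) nsw[of k] by simp
          finally have "x + of_real (s k) *s w \<in> U" using r(2) by auto
          then show "x \<in> (\<lambda>z. z - of_real (s k) *s w) ` U"
            by (intro image_eqI[of _ _ "x + of_real (s k) *s w"]) auto
        qed
      qed
      moreover have "line_hol F (ball y d)"
        by (rule line_hol_subset[OF hol]) (use dsub r in \<open>auto simp: subset_iff\<close>)
      ultimately have "line_hol (\<lambda>x. inverse (of_real (s k)) * (F (x + of_real (s k) *s w) - F x)) (ball y d)"
        by (intro line_hol_mult line_hol_diff line_hol_const)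
      then show ?thesis by (simp add: G_def field_simps)
    qed
    have err: "cmod (G k x - dir_deriv F x w) \<le> 3 * M * (norm w / (r/4))\<^sup>2 * s k" if x: "x \<in> ball y d" for k x
    proof -
      have sub: "ball x (r/4) \<subseteq> cball z r"
      proof
        fix u assume "u \<in> ball x (r/4)"
        then have "dist z u \<le> dist z y + dist y x + r/4"
          using dist_triangle[of z u x] dist_triangle[of z x y] by simp
        then show "u \<in> cball z r" using x y d(2) by simp
      qed
      have hx: "line_hol F (ball x (r/4))" by (rule line_hol_subset[OF hol]) (use sub r(2) in auto)
      have xU: "x \<in> U" using sub r by (meson centre_in_ball divide_pos_pos subset_iff zero_less_numeral)
      have "cmod (F (x + of_real (s k) *s w) - F x - dir_deriv F x (of_real (s k) *s w))
          \<le> 3 * M * (norm (of_real (s k) *s w) / (r/4))\<^sup>2"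
        by (rule dir_deriv_remainder[OF hx _ r(3)]) (use sub r(1) nsw in auto)
      also have "\<dots> = 3 * M * (norm w / (r/4))\<^sup>2 * s k * s k"
        using sp[of k] by (simp add: norm_smult power_mult_distrib power_divide power2_eq_square)
      finally have "cmod (F (x + of_real (s k) *s w) - F x - of_real (s k) * dir_deriv F x w)
         \<le> 3 * M * (norm w / (r/4))\<^sup>2 * s k * s k"
        by (simp add: dir_deriv_smult[OF hol \<open>open U\<close> xU])
      moreover have "G k x - dir_deriv F x w =
          (F (x + of_real (s k) *s w) - F x - of_real (s k) * dir_deriv F x w) / of_real (s k)"
        using sp[of k] by (simp add: G_def field_simps)
      ultimately show ?thesis
        using sp[of k] by (simp add: norm_divide divide_le_eq)
    qed
    have "uniform_limit (ball y d) G (\<lambda>x. dir_deriv F x w) sequentially"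
    proof (rule uniform_limitI)
      fix e :: real assume "e > 0"
      have "(\<lambda>k. 3 * M * (norm w / (r/4))\<^sup>2 * s k) \<longlonglongrightarrow> 3 * M * (norm w / (r/4))\<^sup>2 * 0"
        by (intro tendsto_intros s0)
      then have "eventually (\<lambda>k. 3 * M * (norm w / (r/4))\<^sup>2 * s k < e) sequentially"
        by (rule order_tendstoD(2)) (use \<open>e > 0\<close> in simp)
      then show "eventually (\<lambda>k. \<forall>x\<in>ball y d. dist (G k x) (dir_deriv F x w) < e) sequentially"
      proof eventually_elim
        case (elim k)
        show ?case
        proof
          fix x assume "x \<in> ball y d"
          from le_less_trans[OF err[OF this] elim]
          show "dist (G k x) (dir_deriv F x w) < e" by (simp only: dist_norm)
        qed
      qed
    qed
    with d(1) dsub G show "\<exists>d>0. ball y d \<subseteq> ball z (r/2) \<and> (\<forall>k. line_hol (G k) (ball y d)) \<and>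
        uniform_limit (ball y d) G (\<lambda>x. dir_deriv F x w) sequentially"
      by blast
  qed simp
  with r(1) show "\<exists>r>0. line_hol (\<lambda>z. dir_deriv F z w) (ball z r)"
    by (intro exI[of _ "r/2"]) auto
qed

text \<open>The increment along v + w is split into a leg along \<open>v\<close> and a leg along
  \<open>w\<close> from the moved base point z + \<zeta> v. The second leg relies on continuity of
  the directional derivative in its base point, which \<open>line_hol_dir_deriv\<close>
  provides.\<close>

lemma dir_deriv_add:
  assumes hol: "line_hol F U" and "open U" and z: "z \<in> U"
  shows "dir_deriv F z (v + w) = dir_deriv F z v + dir_deriv F z w"
proof -
  obtain r M where r: "r > 0" "cball z r \<subseteq> U" "\<And>x. x \<in> cball z r \<Longrightarrow> cmod (F x) \<le> M"
    using line_hol_bounded_nhd[OF hol \<open>open U\<close> z] by metis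
  have quot: "((\<lambda>\<zeta>. (F (z + \<zeta> *s u) - F z) / \<zeta>) \<longlongrightarrow> dir_deriv F z u) (at 0)" for u
    using line_hol_has_deriv[OF hol \<open>open U\<close> z, of u] by (simp add: has_field_derivative_iff)
  have cont: "isCont (\<lambda>x. dir_deriv F x w) z"
    using line_hol_continuous[OF line_hol_dir_deriv[OF hol \<open>open U\<close>]] z \<open>open U\<close>
      continuous_on_eq_continuous_at by blast
  have line: "((\<lambda>\<zeta>. z + \<zeta> *s v) \<longlongrightarrow> z) (at 0)"
  proof -
    have "((\<lambda>\<zeta>. z + \<zeta> *s v) \<longlongrightarrow> z + 0 *s v) (at 0)" by (intro tendsto_intros)
    then show ?thesis by simp
  qed
  have dd: "((\<lambda>\<zeta>. dir_deriv F (z + \<zeta> *s v) w) \<longlongrightarrow> dir_deriv F z w) (at 0)"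
    by (rule isCont_tendsto_compose[OF cont line])
  have err: "((\<lambda>\<zeta>. (F (z + \<zeta> *s v + \<zeta> *s w) - F (z + \<zeta> *s v)) / \<zeta> - dir_deriv F (z + \<zeta> *s v) w) \<longlongrightarrow> 0) (at 0)"
  proof (rule Lim_null_comparison)
    show "((\<lambda>\<zeta>::complex. 3 * M * (norm w / (r/2))\<^sup>2 * norm \<zeta>) \<longlongrightarrow> 0) (at 0)"
      by (intro tendsto_mult_right_zero tendsto_norm_zero tendsto_ident_at)
    show "eventually (\<lambda>\<zeta>. norm ((F (z + \<zeta> *s v + \<zeta> *s w) - F (z + \<zeta> *s v)) / \<zeta> - dir_deriv F (z + \<zeta> *s v) w)
        \<le> 3 * M * (norm w / (r/2))\<^sup>2 * norm \<zeta>) (at 0)"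
    proof -
      have "((\<lambda>\<zeta>::complex. norm \<zeta> * norm w) \<longlongrightarrow> 0) (at 0)"
        by (intro tendsto_mult_left_zero tendsto_norm_zero tendsto_ident_at)
      then have "eventually (\<lambda>\<zeta>::complex. norm \<zeta> * norm w < r/2) (at 0)"
        by (rule order_tendstoD(2)) (use r in simp)
      moreover have "eventually (\<lambda>\<zeta>. dist (z + \<zeta> *s v) z < r/2) (at 0)"
        by (rule tendstoD[OF line]) (use r in simp)
      moreover have "eventually (\<lambda>\<zeta>::complex. \<zeta> \<noteq> 0) (at 0)" by (simp add: eventually_at_filter)
      ultimately show ?thesis
      proof eventually_elim
        case (elim \<zeta>)
        let ?x = "z + \<zeta> *s v"
        have sub: "ball ?x (r/2) \<subseteq> cball z r"
        proof
          fix u assume "u \<in> ball ?x (r/2)"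
          then show "u \<in> cball z r" using elim(2) dist_triangle[of z u ?x] by (simp add: dist_commute)
        qed
        have hx: "line_hol F (ball ?x (r/2))" by (rule line_hol_subset[OF hol]) (use sub r(2) in auto)
        have xU: "?x \<in> U" using sub r by (meson centre_in_ball half_gt_zero subset_iff)
        have "cmod (F (?x + \<zeta> *s w) - F ?x - dir_deriv F ?x (\<zeta> *s w)) \<le> 3 * M * (norm (\<zeta> *s w) / (r/2))\<^sup>2"
          by (rule dir_deriv_remainder[OF hx _ r(3)]) (use sub r(1) elim in \<open>auto simp: norm_smult\<close>)
        also have "\<dots> = 3 * M * (norm w / (r/2))\<^sup>2 * norm \<zeta> * norm \<zeta>"
          by (simp add: norm_smult power_mult_distrib power_divide power2_eq_square)
        finally have "cmod (F (?x + \<zeta> *s w) - F ?x - \<zeta> * dir_deriv F ?x w)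
            \<le> 3 * M * (norm w / (r/2))\<^sup>2 * norm \<zeta> * norm \<zeta>"
          by (simp add: dir_deriv_smult[OF hol \<open>open U\<close> xU])
        moreover have "(F (?x + \<zeta> *s w) - F ?x) / \<zeta> - dir_deriv F ?x w =
            (F (?x + \<zeta> *s w) - F ?x - \<zeta> * dir_deriv F ?x w) / \<zeta>"
          using elim(3) by (simp add: field_simps)
        ultimately show ?case using elim(3) by (simp add: norm_divide divide_le_eq)
      qed
    qed
  qed
  have "((\<lambda>\<zeta>. ((F (z + \<zeta> *s v + \<zeta> *s w) - F (z + \<zeta> *s v)) / \<zeta> - dir_deriv F (z + \<zeta> *s v) w)
      + dir_deriv F (z + \<zeta> *s v) w + (F (z + \<zeta> *s v) - F z) / \<zeta>) \<longlongrightarrow> 0 + dir_deriv F z w + dir_deriv F z v) (at 0)"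
    by (intro tendsto_add err dd quot)
  moreover have "((F (z + \<zeta> *s v + \<zeta> *s w) - F (z + \<zeta> *s v)) / \<zeta> - dir_deriv F (z + \<zeta> *s v) w)
      + dir_deriv F (z + \<zeta> *s v) w + (F (z + \<zeta> *s v) - F z) / \<zeta> = (F (z + \<zeta> *s (v + w)) - F z) / \<zeta>" for \<zeta>
    by (simp add: vector_add_ldistrib add_ac diff_divide_distrib)
  ultimately have "((\<lambda>\<zeta>. (F (z + \<zeta> *s (v + w)) - F z) / \<zeta>) \<longlongrightarrow> dir_deriv F z v + dir_deriv F z w) (at 0)"
    by (simp add: add_ac)
  with quot[of "v + w"] show ?thesis
    using tendsto_unique[OF trivial_limit_at] by blast
qed

lemma dir_deriv_scaleR:
  assumes "line_hol F U" "open U" "z \<in> U"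
  shows "dir_deriv F z (c *\<^sub>R w) = c *\<^sub>R dir_deriv F z w"
  using dir_deriv_smult[OF assms, of "of_real c" w]
  by (simp add: smult_of_real scaleR_conv_of_real[where 'a = complex])

text \<open>The directional derivative is linear in the direction, and its quadratic remainder has a
  constant independent of the direction.\<close>

theorem line_hol_has_derivative:
  assumes hol: "line_hol F U" and "open U" and z: "z \<in> U"
  shows "(F has_derivative dir_deriv F z) (at z)"
proof -
  obtain r M where r: "r > 0" "cball z r \<subseteq> U" "\<And>x. x \<in> cball z r \<Longrightarrow> cmod (F x) \<le> M"
    using line_hol_bounded_nhd[OF hol \<open>open U\<close> z] by metis
  have hr: "line_hol F (ball z r)" by (rule line_hol_subset[OF hol]) (use r in auto)
  show ?thesis unfolding has_derivative_at
  proof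
    have "linear (dir_deriv F z)"
      by (intro linearI dir_deriv_add[OF assms] dir_deriv_scaleR[OF assms])
    then show "bounded_linear (dir_deriv F z)" by (simp add: linear_conv_bounded_linear)
    show "((\<lambda>h. norm (F (z + h) - F z - dir_deriv F z h) / norm h) \<longlongrightarrow> 0) (at 0)"
    proof (rule Lim_null_comparison)
      show "((\<lambda>h. 3 * M / r\<^sup>2 * norm h) \<longlongrightarrow> 0) (at (0::complex^'a))"
        by (intro tendsto_mult_right_zero tendsto_norm_zero tendsto_ident_at)
      have "eventually (\<lambda>h::complex^'a. h \<in> ball 0 r - {0}) (at 0)"
        using r(1) eventually_at_in_open[of "ball 0 r" "0::complex^'a"] by simp
      then show "eventually (\<lambda>h. norm (norm (F (z + h) - F z - dir_deriv F z h) / norm h) \<le> 3 * M / r\<^sup>2 * norm h) (at 0)"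
      proof eventually_elim
        case (elim h)
        have "norm (F (z + h) - F z - dir_deriv F z h) \<le> 3 * M * (norm h / r)\<^sup>2"
          by (rule dir_deriv_remainder[OF hr r(1) r(3)]) (use elim in auto)
        then show ?case using elim
          by (simp add: divide_le_eq power_divide power2_eq_square mult_ac)
      qed
    qed
  qed
qed

lemma has_derivative_imp_dir_deriv:
  assumes "(F has_derivative D) (at z)" "\<And>c h. D (c *s h) = c * D h"
  shows "((\<lambda>\<zeta>. F (z + \<zeta> *s w)) has_field_derivative D w) (at 0)" "dir_deriv F z w = D w"
proof -
  have "((F \<circ> (\<lambda>\<zeta>. z + \<zeta> *s w)) has_derivative (D \<circ> (\<lambda>x. x *s w))) (at 0)"
    by (rule diff_chain_at[OF has_derivative_line]) (use assms in simp)
  moreover have "D \<circ> (\<lambda>x. x *s w) = (*) (D w)" by (auto simp: assms(2) fun_eq_iff)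
  ultimately show *: "((\<lambda>\<zeta>. F (z + \<zeta> *s w)) has_field_derivative D w) (at 0)"
    by (simp add: has_field_derivative_def o_def)
  show "dir_deriv F z w = D w" unfolding dir_deriv_def by (rule DERIV_imp_deriv[OF *])
qed

lemma line_holI_has_derivative:
  assumes "open U" "\<And>z. z \<in> U \<Longrightarrow> \<exists>D. (F has_derivative D) (at z) \<and> (\<forall>c h. D (c *s h) = c * D h)"
  shows "line_hol F U"
proof (rule line_holI)
  show "continuous_on U F"
    by (intro continuous_at_imp_continuous_on ballI) (use assms(2) has_derivative_continuous in blast)
  fix a h
  show "(\<lambda>\<zeta>. F (a + \<zeta> *s h)) holomorphic_on {\<zeta>. a + \<zeta> *s h \<in> U}"
    unfolding holomorphic_on_def
  proof safe
    fix \<zeta> assume "a + \<zeta> *s h \<in> U"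
    then obtain D where D: "(F has_derivative D) (at (a + \<zeta> *s h))" "\<And>c h. D (c *s h) = c * D h"
      using assms(2) by blast
    have "((F \<circ> (\<lambda>\<zeta>. a + \<zeta> *s h)) has_derivative (D \<circ> (\<lambda>x. x *s h))) (at \<zeta>)"
      by (rule diff_chain_at[OF has_derivative_line D(1)])
    moreover have "D \<circ> (\<lambda>x. x *s h) = (*) (D h)" by (auto simp: D(2) fun_eq_iff)
    ultimately have "((\<lambda>\<zeta>. F (a + \<zeta> *s h)) has_field_derivative D h) (at \<zeta>)"
      by (simp add: has_field_derivative_def o_def)
    then show "(\<lambda>\<zeta>. F (a + \<zeta> *s h)) field_differentiable (at \<zeta> within {\<zeta>. a + \<zeta> *s h \<in> U})"
      unfolding field_differentiable_def using has_field_derivative_at_within by blast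
  qed
qed

lemma dir_deriv_expand:
  assumes "line_hol F U" "open U" "z \<in> U"
  shows "dir_deriv F z h = (\<Sum>j\<in>UNIV. dir_deriv F z (axis j 1) * h $ j)"
proof -
  have lin: "linear (dir_deriv F z)"
    by (intro linearI dir_deriv_add[OF assms] dir_deriv_scaleR[OF assms])
  have "dir_deriv F z h = dir_deriv F z (\<Sum>j\<in>UNIV. (h $ j) *s axis j 1)"
    by (simp add: basis_expansion)
  also have "\<dots> = (\<Sum>j\<in>UNIV. h $ j * dir_deriv F z (axis j 1))"
    by (simp add: linear_sum[OF lin] dir_deriv_smult[OF assms])
  finally show ?thesis by (simp add: mult.commute)
qed

section \<open>Jacobian matrices and composition\<close>

definition jac :: "(complex^'n \<Rightarrow> complex^'n) \<Rightarrow> complex^'n \<Rightarrow> complex^'n^'n" where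
  "jac f z = (\<chi> i j. dir_deriv (\<lambda>x. f x $ i) z (axis j 1))"

lemma holomorphic_map_on_iff_line_hol:
  fixes f :: "complex^'n \<Rightarrow> complex^'n"
  assumes "open U"
  shows "holomorphic_map_on f U \<longleftrightarrow> (\<forall>i. line_hol (\<lambda>z. f z $ i) U)"
proof
  assume f: "holomorphic_map_on f U"
  show "\<forall>i. line_hol (\<lambda>z. f z $ i) U"
  proof
    fix i
    show "line_hol (\<lambda>z. f z $ i) U"
    proof (rule line_holI_has_derivative[OF assms])
      fix z assume "z \<in> U"
      then obtain J :: "complex^'n^'n" where J: "(f has_derivative (\<lambda>h. J *v h)) (at z)"
        using f unfolding holomorphic_map_on_def by blast
      show "\<exists>D. ((\<lambda>z. f z $ i) has_derivative D) (at z) \<and> (\<forall>c h. D (c *s h) = c * D h)"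
        using J unfolding has_derivative_vec_nth_iff
        by (intro exI[of _ "\<lambda>h. (J *v h) $ i"]) (auto simp: vector_scalar_commute)
    qed
  qed
next
  assume f: "\<forall>i. line_hol (\<lambda>z. f z $ i) U"
  show "holomorphic_map_on f U" unfolding holomorphic_map_on_def
  proof
    fix z assume z: "z \<in> U"
    have "(f has_derivative (\<lambda>h. jac f z *v h)) (at z)"
      unfolding has_derivative_vec_nth_iff
    proof
      fix i
      have "((\<lambda>z. f z $ i) has_derivative dir_deriv (\<lambda>x. f x $ i) z) (at z)"
        by (rule line_hol_has_derivative[OF _ assms z]) (use f in blast)
      moreover have "dir_deriv (\<lambda>x. f x $ i) z = (\<lambda>h. (jac f z *v h) $ i)"
      proof
        fix h
        show "dir_deriv (\<lambda>x. f x $ i) z h = (jac f z *v h) $ i"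
          using dir_deriv_expand[OF spec[OF f, of i] assms z, of h]
          by (simp add: jac_def matrix_vector_mult_def)
      qed
      ultimately show "((\<lambda>x. f x $ i) has_derivative (\<lambda>h. (jac f z *v h) $ i)) (at z)" by simp
    qed
    then show "\<exists>J. (f has_derivative (*v) J) (at z)" by blast
  qed
qed

lemma has_derivative_jac:
  fixes f :: "complex^'n \<Rightarrow> complex^'n"
  assumes "holomorphic_map_on f U" "z \<in> U"
  shows "(f has_derivative (\<lambda>h. jac f z *v h)) (at z)"
proof -
  obtain J :: "complex^'n^'n" where J: "(f has_derivative (\<lambda>h. J *v h)) (at z)"
    using assms unfolding holomorphic_map_on_def by blast
  have "dir_deriv (\<lambda>x. f x $ i) z h = (J *v h) $ i" for i h
    by (rule has_derivative_imp_dir_deriv)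
       (use J has_derivative_vec_nth_iff in \<open>auto simp: vector_scalar_commute\<close>)
  then have "jac f z = J"
    by (simp add: jac_def vec_eq_iff matrix_vector_mult_def axis_def if_distrib cong: if_cong)
  with J show ?thesis by simp
qed

lemma holomorphic_map_on_continuous: "holomorphic_map_on f U \<Longrightarrow> continuous_on U f"
  unfolding holomorphic_map_on_def
  by (intro continuous_at_imp_continuous_on) (use has_derivative_continuous in blast)

text \<open>A holomorphic map does not carry lines to lines, so the argument passes through total
  derivatives and the chain rule.\<close>

lemma line_hol_compose:
  assumes F: "line_hol F V" "open V" and g: "holomorphic_map_on g U" "open U" and "g ` U \<subseteq> V"
  shows "line_hol (\<lambda>z. F (g z)) U"
proof (rule line_holI_has_derivative[OF \<open>open U\<close>])
  fix z assume z: "z \<in> U"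
  then have gz: "g z \<in> V" using assms by blast
  have "((F \<circ> g) has_derivative (dir_deriv F (g z) \<circ> (\<lambda>h. jac g z *v h))) (at z)"
    by (rule diff_chain_at[OF has_derivative_jac[OF g(1) z] line_hol_has_derivative[OF F gz]])
  then show "\<exists>D. ((\<lambda>z. F (g z)) has_derivative D) (at z) \<and> (\<forall>c h. D (c *s h) = c * D h)"
    by (intro exI[of _ "dir_deriv F (g z) \<circ> (\<lambda>h. jac g z *v h)"])
       (simp add: o_def vector_scalar_commute dir_deriv_smult[OF F gz])
qed

lemma holomorphic_map_compose:
  fixes f g :: "complex^'n \<Rightarrow> complex^'n"
  assumes "holomorphic_map_on f V" "holomorphic_map_on g U" "g ` U \<subseteq> V"
  shows "holomorphic_map_on (\<lambda>z. f (g z)) U"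
  unfolding holomorphic_map_on_def
proof
  fix z assume z: "z \<in> U"
  then have "((f \<circ> g) has_derivative ((\<lambda>h. jac f (g z) *v h) \<circ> (\<lambda>h. jac g z *v h))) (at z)"
    by (intro diff_chain_at has_derivative_jac[OF assms(2)] has_derivative_jac[OF assms(1)]) (use assms in auto)
  then show "\<exists>J. ((\<lambda>z. f (g z)) has_derivative (*v) J) (at z)"
    by (intro exI[of _ "jac f (g z) ** jac g z"]) (simp add: o_def matrix_vector_mul_assoc)
qed

lemma line_hol_cinner:
  assumes "holomorphic_map_on f U" "open U"
  shows "line_hol (\<lambda>z. cinner (f z) e) U"
  unfolding cinner_def using assms
  by (intro line_hol_sum line_hol_mult line_hol_const) (simp add: holomorphic_map_on_iff_line_hol)

section \<open>Holomorphic maps and their inverses\<close>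

lemma bounded_linear_cinner: "bounded_linear (\<lambda>x. cinner x e)"
proof (rule bounded_linear_intro)
  show "cinner (x + y) e = cinner x e + cinner y e" for x y
    by (simp add: cinner_def distrib_right sum.distrib)
  show "cinner (r *\<^sub>R x) e = r *\<^sub>R cinner x e" for r x
    by (simp add: cinner_def scaleR_sum_right)
  show "norm (cinner x e) \<le> norm x * norm e" for x by (rule norm_cinner_le)
qed

lemma cinner_smult: "cinner (c *s x) e = c * cinner x e"
  by (simp add: cinner_def sum_distrib_left mult_ac)

lemma has_derivative_cinner:
  assumes "(f has_derivative (\<lambda>h. J *v h)) (at z)"
  shows "((\<lambda>x. cinner (f x) e) has_derivative (\<lambda>h. cinner (J *v h) e)) (at z)"
  using bounded_linear.has_derivative[OF bounded_linear_cinner assms] .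

lemma holomorphic_map_on_subset:
  "holomorphic_map_on f U \<Longrightarrow> V \<subseteq> U \<Longrightarrow> holomorphic_map_on f V"
  by (auto simp: holomorphic_map_on_def)

text \<open>Estimates for vectors are reduced to scalar ones by pairing a value e with itself: a
  bound of the form c |e| for <e, e> becomes |e| \<le> c, without a dimension factor.\<close>

lemma norm_le_from_square:
  fixes x c :: real
  assumes "x\<^sup>2 \<le> c * x" "x \<ge> 0" "c \<ge> 0"
  shows "x \<le> c"
proof (cases "x = 0")
  case False
  then show ?thesis using assms by (simp add: power2_eq_square)
qed (use assms in simp)

lemma jac_bound:
  fixes f :: "complex^'n \<Rightarrow> complex^'n"
  assumes hol: "holomorphic_map_on f (ball z r)" and "r > 0"
    and M: "\<And>x. x \<in> ball z r \<Longrightarrow> norm (f x) \<le> M"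
  shows "norm (jac f z *v w) \<le> M * norm w / r"
proof -
  have M0: "M \<ge> 0" by (rule order_trans[OF norm_ge_zero M[of z]]) (use \<open>r > 0\<close> in simp)
  define e where "e = jac f z *v w"
  let ?F = "\<lambda>x. cinner (f x) e"
  have "dir_deriv ?F z w = cinner (jac f z *v w) e"
    by (rule has_derivative_imp_dir_deriv(2)[OF has_derivative_cinner[OF has_derivative_jac[OF hol]]])
       (use \<open>r > 0\<close> in \<open>auto simp: vector_scalar_commute cinner_smult\<close>)
  moreover have "cmod (dir_deriv ?F z w) \<le> (M * norm e) * norm w / r"
  proof (rule dir_deriv_bound[OF line_hol_cinner[OF hol] \<open>r > 0\<close>])
    show "cmod (cinner (f x) e) \<le> M * norm e" if "x \<in> ball z r" for x
      by (rule order_trans[OF norm_cinner_le mult_right_mono[OF M[OF that]]]) simp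
  qed simp
  ultimately have "(norm e)\<^sup>2 \<le> (M * norm w / r) * norm e"
    using norm_cinner_self_ge[of e] by (simp add: e_def mult_ac)
  then show ?thesis unfolding e_def[symmetric]
    by (rule norm_le_from_square) (use M0 \<open>r > 0\<close> in auto)
qed

text \<open>Each point of the smaller ball is the centre of a ball of radius \<rho> - r inside the
  larger one, where \<open>jac_bound\<close> applies; the mean value inequality on the convex ball
  does the rest.\<close>

lemma holomorphic_map_lipschitz:
  fixes f :: "complex^'n \<Rightarrow> complex^'n"
  assumes hol: "holomorphic_map_on f (ball 0 \<rho>)" and "r < \<rho>"
    and M: "\<And>x. x \<in> ball 0 \<rho> \<Longrightarrow> norm (f x) \<le> M"
    and xy: "x \<in> cball 0 r" "y \<in> cball 0 r"
  shows "norm (f x - f y) \<le> M / (\<rho> - r) * norm (x - y)"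
proof (rule differentiable_bound[of "cball 0 r" f "\<lambda>x h. jac f x *v h"])
  have sub: "cball 0 r \<subseteq> ball (0::complex^'n) \<rho>" using \<open>r < \<rho>\<close> by auto
  show "(f has_derivative (*v) (jac f x)) (at x within cball 0 r)" if "x \<in> cball 0 r" for x
    by (rule has_derivative_at_withinI[OF has_derivative_jac[OF hol]]) (use that sub in auto)
  show "onorm ((*v) (jac f x)) \<le> M / (\<rho> - r)" if x: "x \<in> cball 0 r" for x
  proof (rule onorm_le)
    fix w
    have sb: "ball x (\<rho> - r) \<subseteq> ball 0 \<rho>"
    proof
      fix u assume "u \<in> ball x (\<rho> - r)"
      then show "u \<in> ball 0 \<rho>" using x dist_triangle[of 0 u x] by simp
    qed
    have "norm (jac f x *v w) \<le> M * norm w / (\<rho> - r)"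
      by (rule jac_bound[OF holomorphic_map_on_subset[OF hol sb]]) (use M sb \<open>r < \<rho>\<close> in auto)
    then show "norm (jac f x *v w) \<le> M / (\<rho> - r) * norm w" by simp
  qed
qed (use xy in auto)

text \<open>The one-variable version is applied on the complex line through \<open>z\<close>, with
  \<open>f\<close> paired with the fixed vector \<open>f z\<close>.\<close>

lemma holomorphic_map_schwarz_order:
  fixes f :: "complex^'n \<Rightarrow> complex^'n"
  assumes hol: "holomorphic_map_on f (ball 0 \<rho>)" and "\<rho> > 0"
    and M: "\<And>x. x \<in> ball 0 \<rho> \<Longrightarrow> norm (f x) \<le> M"
    and "\<delta> > 0" and C: "\<And>x. norm x < \<delta> \<Longrightarrow> norm (f x) \<le> C * norm x ^ k"
    and z: "z \<in> ball 0 \<rho>"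
  shows "norm (f z) \<le> M * (norm z / \<rho>) ^ k"
proof (cases "z = 0")
  case True
  show ?thesis
  proof (cases "k = 0")
    case True
    then show ?thesis using M[OF z] by simp
  next
    case False
    then show ?thesis using C[of 0] \<open>\<delta> > 0\<close> \<open>z = 0\<close> by (simp add: zero_power)
  qed
next
  case False
  have M0: "M \<ge> 0" by (rule order_trans[OF norm_ge_zero M[of 0]]) (use \<open>\<rho> > 0\<close> in simp)
  define u where "u = of_real (inverse (norm z)) *s z"
  have nu: "norm u = 1" using False by (simp add: u_def norm_smult norm_inverse)
  define e where "e = f z"
  define G where "G = (\<lambda>\<zeta>. cinner (f (0 + \<zeta> *s u)) e)"
  have "cmod (G (of_real (norm z))) \<le> (M * norm e) * (norm (complex_of_real (norm z)) / \<rho>) ^ k"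
  proof (rule schwarz_order[where C = "C * norm e" and \<delta> = \<delta>])
    show "G holomorphic_on ball 0 \<rho>" unfolding G_def
      by (rule line_hol_slice[OF line_hol_cinner[OF hol]]) (auto simp: norm_smult nu)
    show "cmod (G \<zeta>) \<le> M * norm e" if "\<zeta> \<in> ball 0 \<rho>" for \<zeta>
      unfolding G_def
      by (rule order_trans[OF norm_cinner_le mult_right_mono[OF M]]) (use that in \<open>auto simp: norm_smult nu\<close>)
    show "cmod (G \<zeta>) \<le> C * norm e * norm \<zeta> ^ k" if "norm \<zeta> < \<delta>" for \<zeta>
    proof -
      have "cmod (G \<zeta>) \<le> norm (f (\<zeta> *s u)) * norm e" unfolding G_def by (simp add: norm_cinner_le)
      also have "\<dots> \<le> (C * norm (\<zeta> *s u) ^ k) * norm e"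
        by (intro mult_right_mono C) (use that in \<open>auto simp: norm_smult nu\<close>)
      finally show ?thesis by (simp add: norm_smult nu mult_ac)
    qed
  qed (use assms in auto)
  moreover have "of_real (norm z) *s u = z"
    using False by (simp add: u_def vector_smult_assoc flip: of_real_mult)
  ultimately have "cmod (cinner e e) \<le> (M * (norm z / \<rho>) ^ k) * norm e"
    by (simp add: G_def e_def mult_ac)
  then have "(norm e)\<^sup>2 \<le> (M * (norm z / \<rho>) ^ k) * norm e"
    using norm_cinner_self_ge[of e] by linarith
  then show ?thesis unfolding e_def[symmetric]
    by (rule norm_le_from_square) (use M0 \<open>\<rho> > 0\<close> in auto)
qed

text \<open>The one-variable result requires \<theta> to be nonzero at the centre, which may fail at
  the given point p. By density p is a limit of points \<open>q n\<close> where it holds. The slices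
  through \<open>q n\<close> are holomorphic on a disc of one fixed radius, and uniform continuity
  carries this to the slice through p.\<close>

theorem rado_line_hol:
  fixes F \<theta> :: "complex^'n \<Rightarrow> complex"
  assumes "open U" and cont: "continuous_on U F" "continuous_on U \<theta>"
    and hol: "line_hol F {z \<in> U. \<theta> z \<noteq> 0}" "line_hol \<theta> {z \<in> U. \<theta> z \<noteq> 0}"
    and dense: "\<And>z e. z \<in> U \<Longrightarrow> e > 0 \<Longrightarrow> \<exists>w \<in> ball z e. \<theta> w \<noteq> 0"
  shows "line_hol F U"
proof (rule line_holI)
  show "continuous_on U F" by fact
  fix a h
  show "(\<lambda>\<zeta>. F (a + \<zeta> *s h)) holomorphic_on {\<zeta>. a + \<zeta> *s h \<in> U}"
  proof (cases "h = 0")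
    case True
    then show ?thesis by simp
  next
    case h: False
    show ?thesis unfolding holomorphic_on_def
    proof safe
      fix \<zeta>0 assume "a + \<zeta>0 *s h \<in> U"
      define p where "p = a + \<zeta>0 *s h"
      have "p \<in> U" using \<open>a + \<zeta>0 *s h \<in> U\<close> by (simp add: p_def)
      then obtain r0 where r0: "r0 > 0" "cball p r0 \<subseteq> U" using \<open>open U\<close> open_contains_cball by blast
      define r where "r = r0 / 3"
      have r: "r > 0" "cball p (3 * r) \<subseteq> U" using r0 by (auto simp: r_def)
      have "\<exists>w \<in> ball p (r / (real n + 1)). \<theta> w \<noteq> 0" for n
        by (rule dense[OF \<open>p \<in> U\<close>]) (use r in auto)
      then obtain q where q: "\<And>n. q n \<in> ball p (r / (real n + 1))" "\<And>n. \<theta> (q n) \<noteq> 0"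
        by metis
      have "(\<lambda>n. (r * inverse (real (Suc n)))) \<longlonglongrightarrow> r * 0"
        by (intro tendsto_intros LIMSEQ_inverse_real_of_nat)
      then have rn: "(\<lambda>n. r / (real n + 1)) \<longlonglongrightarrow> 0" by (simp add: inverse_eq_divide add_ac)
      have qr: "dist p (q n) < r" for n
      proof -
        have "r / (real n + 1) \<le> r / 1" by (intro divide_left_mono) (use r in auto)
        then show ?thesis using q(1)[of n] by simp
      qed
      have inU: "q n + \<zeta> *s h \<in> cball p (3 * r)" if "norm \<zeta> \<le> 2 * (r / norm h)" for n \<zeta>
      proof -
        have "norm (\<zeta> *s h) \<le> 2 * r" using that h by (simp add: norm_smult field_simps)
        then show ?thesis using qr[of n] dist_triangle[of p "q n + \<zeta> *s h" "q n"]
          by (simp add: dist_norm)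
      qed
      have cU: "continuous_on (cball 0 (2 * (r / norm h))) (\<lambda>\<zeta>. G (q n + \<zeta> *s h))"
        if "continuous_on U G" for G :: "complex^'n \<Rightarrow> complex" and n
      proof -
        have "continuous_on (cball 0 (2 * (r / norm h))) (G \<circ> (\<lambda>\<zeta>. q n + \<zeta> *s h))"
          by (intro continuous_on_compose continuous_intros continuous_on_subset[OF that])
             (use inU r in auto)
        then show ?thesis by (simp add: o_def)
      qed
      have "(\<lambda>\<zeta>. F (q n + \<zeta> *s h)) holomorphic_on ball 0 (2 * (r / norm h) / 2)" for n
      proof (rule rado_holomorphic[where \<theta> = "\<lambda>\<zeta>. \<theta> (q n + \<zeta> *s h)"])
        show "(\<lambda>\<zeta>. F (q n + \<zeta> *s h)) holomorphic_on
            {\<zeta> \<in> ball 0 (2 * (r / norm h)). \<theta> (q n + \<zeta> *s h) \<noteq> 0}"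
          by (rule line_hol_slice[OF hol(1)]) (use inU r in \<open>auto simp: subset_iff\<close>)
        show "(\<lambda>\<zeta>. \<theta> (q n + \<zeta> *s h)) holomorphic_on
            {\<zeta> \<in> ball 0 (2 * (r / norm h)). \<theta> (q n + \<zeta> *s h) \<noteq> 0}"
          by (rule line_hol_slice[OF hol(2)]) (use inU r in \<open>auto simp: subset_iff\<close>)
      qed (use r h q cU cont in auto)
      then have Fn: "(\<lambda>\<zeta>. F (q n + \<zeta> *s h)) holomorphic_on ball 0 (r / norm h)" for n by simp
      have uc: "uniformly_continuous_on (cball p (3 * r)) F"
        by (intro compact_uniformly_continuous continuous_on_subset[OF cont(1)]) (use r in auto)
      have lim: "uniform_limit (ball 0 (r / norm h)) (\<lambda>n \<zeta>. F (q n + \<zeta> *s h)) (\<lambda>\<zeta>. F (p + \<zeta> *s h)) sequentially"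
      proof (rule uniform_limitI)
        fix e :: real assume "e > 0"
        then obtain d where d: "d > 0"
          "\<And>x y. x \<in> cball p (3 * r) \<Longrightarrow> y \<in> cball p (3 * r) \<Longrightarrow> dist y x < d \<Longrightarrow> dist (F y) (F x) < e"
          using uc unfolding uniformly_continuous_on_def by metis
        have "eventually (\<lambda>n. r / (real n + 1) < d) sequentially"
          using order_tendstoD(2)[OF rn d(1)] .
        then show "eventually (\<lambda>n. \<forall>\<zeta>\<in>ball 0 (r / norm h). dist (F (q n + \<zeta> *s h)) (F (p + \<zeta> *s h)) < e) sequentially"
        proof eventually_elim
          case (elim n)
          show ?case
          proof
            fix \<zeta> :: complex assume z: "\<zeta> \<in> ball 0 (r / norm h)"
            have n1: "norm \<zeta> * norm h < r" using z h by (simp add: field_simps)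
            show "dist (F (q n + \<zeta> *s h)) (F (p + \<zeta> *s h)) < e"
            proof (rule d(2))
              show "q n + \<zeta> *s h \<in> cball p (3 * r)"
              proof (rule inU)
                have "r / norm h > 0" using r h by simp
                then show "norm \<zeta> \<le> 2 * (r / norm h)" using z by simp
              qed
              show "p + \<zeta> *s h \<in> cball p (3 * r)" using n1 r by (simp add: dist_norm norm_smult)
              show "dist (q n + \<zeta> *s h) (p + \<zeta> *s h) < d"
                using q(1)[of n] elim by (simp add: dist_commute)
            qed
          qed
        qed
      qed
      have "(\<lambda>\<zeta>. F (p + \<zeta> *s h)) holomorphic_on ball 0 (r / norm h)"
      proof (rule holomorphic_uniform_sequence[OF open_ball Fn])
        fix x :: complex assume "x \<in> ball 0 (r / norm h)"
        then obtain d where "d > 0" "cball x d \<subseteq> ball 0 (r / norm h)"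
          using open_contains_cball[of "ball 0 (r / norm h)"] by blast
        then show "\<exists>d>0. cball x d \<subseteq> ball 0 (r / norm h) \<and>
            uniform_limit (cball x d) (\<lambda>n \<zeta>. F (q n + \<zeta> *s h)) (\<lambda>\<zeta>. F (p + \<zeta> *s h)) sequentially"
          using uniform_limit_on_subset[OF lim] by blast
      qed
      then have "(\<lambda>\<zeta>. F (p + \<zeta> *s h)) field_differentiable at 0"
        by (rule holomorphic_on_imp_differentiable_at) (use r h in auto)
      then obtain D where "((\<lambda>\<zeta>. F (p + \<zeta> *s h)) has_field_derivative D) (at (\<zeta>0 - \<zeta>0))"
        by (auto simp: field_differentiable_def)
      then have "((\<lambda>\<zeta>. F (p + (\<zeta> - \<zeta>0) *s h)) has_field_derivative D * 1) (at \<zeta>0)"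
        by (rule DERIV_chain2) (auto intro!: derivative_eq_intros)
      moreover have "(\<lambda>\<zeta>. F (p + (\<zeta> - \<zeta>0) *s h)) = (\<lambda>\<zeta>. F (a + \<zeta> *s h))"
        by (simp add: p_def vector_sub_rdistrib)
      ultimately have "(\<lambda>\<zeta>. F (a + \<zeta> *s h)) field_differentiable at \<zeta>0"
        unfolding field_differentiable_def by metis
      then show "(\<lambda>\<zeta>. F (a + \<zeta> *s h)) field_differentiable (at \<zeta>0 within {\<zeta>. a + \<zeta> *s h \<in> U})"
        by (rule field_differentiable_at_within)
    qed
  qed
qed

section \<open>Inverses of injective holomorphic maps\<close>

lemma line_hol_det_jac:
  assumes "holomorphic_map_on f U" "open U"
  shows "line_hol (\<lambda>z. det (jac f z)) U"
proof -
  have "line_hol (\<lambda>z. jac f z $ i $ j) U" for i j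
    unfolding jac_def using assms holomorphic_map_on_iff_line_hol[OF assms(2)]
    by (simp add: line_hol_dir_deriv)
  then show ?thesis unfolding det_def
    by (intro line_hol_sum line_hol_mult line_hol_prod line_hol_const) auto
qed

text \<open>On the complex line through 0 and \<open>z\<close>, vanishing near parameter 1 would
  propagate to parameter 0 by the identity theorem.\<close>

lemma line_hol_nonzero_dense:
  assumes hol: "line_hol F (ball 0 1)" and "F 0 \<noteq> 0" and z: "z \<in> ball 0 1" and "e > 0"
  shows "\<exists>w \<in> ball z e \<inter> ball 0 1. F w \<noteq> 0"
proof (rule ccontr)
  assume "\<not> ?thesis"
  then have zero: "\<And>w. w \<in> ball z e \<Longrightarrow> w \<in> ball 0 1 \<Longrightarrow> F w = 0" by blast
  have z0: "z \<noteq> 0" using zero[of 0] assms by auto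
  let ?S = "ball (0::complex) (1 / norm z)"
  let ?T = "{\<zeta>. 0 + \<zeta> *s z \<in> ball z e} \<inter> ?S"
  have inS: "0 + \<zeta> *s z \<in> ball 0 1" if "\<zeta> \<in> ?S" for \<zeta>
    using that z0 by (simp add: norm_smult field_simps)
  have "F (0 + 0 *s z) = 0"
  proof (rule analytic_continuation_open[of ?T ?S "\<lambda>\<zeta>. F (0 + \<zeta> *s z)" "\<lambda>\<zeta>. 0" 0])
    show "open ?T" by (intro open_Int open_line_vimage) auto
    have "1 \<in> ?T" using z z0 \<open>e > 0\<close> by (simp add: field_simps)
    then show "?T \<noteq> {}" by blast
    show "(\<lambda>\<zeta>. F (0 + \<zeta> *s z)) holomorphic_on ?S" by (rule line_hol_slice[OF hol inS])
    show "F (0 + \<zeta> *s z) = 0" if "\<zeta> \<in> ?T" for \<zeta>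
      by (rule zero) (use that inS in auto)
  qed (use z0 in auto)
  then show False using \<open>F 0 \<noteq> 0\<close> by simp
qed

text \<open>Osgood's theorem: the inverse is continuous by invariance of domain and holomorphic off the
  critical values; the latter are the zeros of a continuous function which is itself holomorphic
  where it does not vanish, so they are removable by Rado's theorem.\<close>

theorem holomorphic_inverse:
  fixes f :: "complex^'n \<Rightarrow> complex^'n"
  assumes hol: "holomorphic_map_on f (ball 0 1)" and inj: "inj_on f (ball 0 1)"
    and J0: "det (jac f 0) \<noteq> 0"
  defines "V \<equiv> f ` ball 0 1" and "g \<equiv> inv_into (ball 0 1) f"
  shows "open V" "holomorphic_map_on g V"
    and "\<And>z B. z \<in> ball 0 1 \<Longrightarrow> jac f z ** B = mat 1 \<Longrightarrow> (g has_derivative (\<lambda>h. B *v h)) (at (f z))"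
proof -
  have contf: "continuous_on (ball 0 1) f" by (rule holomorphic_map_on_continuous[OF hol])
  show oV: "open V" unfolding V_def by (rule invariance_of_domain[OF contf open_ball inj])
  have gf: "g (f z) = z" if "z \<in> ball 0 1" for z unfolding g_def by (rule inv_into_f_f[OF inj that])
  have gV: "g w \<in> ball 0 1" "f (g w) = w" if "w \<in> V" for w
    using that gf by (auto simp: V_def)
  have contg: "continuous_on V g"
  proof (rule continuous_on_open_gen[THEN iffD2, rule_format])
    show "g \<in> V \<rightarrow> ball 0 1" using gV by auto
    fix T assume "openin (top_of_set (ball (0::complex^'n) 1)) T"
    then have T: "open T" "T \<subseteq> ball 0 1" by (simp_all add: openin_open_eq)
    have "V \<inter> g -` T = f ` T" using T(2) gf gV by (force simp: V_def)
    moreover have "open (f ` T)"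
      using T by (intro invariance_of_domain continuous_on_subset[OF contf] inj_on_subset[OF inj])
    ultimately show "openin (top_of_set V) (V \<inter> g -` T)"
      using oV by (simp add: openin_open_eq V_def image_mono T)
  qed
  show deriv_g: "(g has_derivative (\<lambda>h. B *v h)) (at (f z))"
    if "z \<in> ball 0 1" "jac f z ** B = mat 1" for z B
  proof (rule has_derivative_inverse_strong[OF open_ball that(1) contf gf has_derivative_jac[OF hol that(1)]])
    show "(*v) (jac f z) \<circ> (*v) B = id"
      using that(2) by (simp add: fun_eq_iff matrix_vector_mul_assoc)
  qed
  define \<theta> where "\<theta> = (\<lambda>w. det (jac f (g w)))"
  have ld: "line_hol (\<lambda>z. det (jac f z)) (ball 0 1)" by (rule line_hol_det_jac[OF hol open_ball])
  have cont\<theta>: "continuous_on V \<theta>"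
  proof -
    have "continuous_on V ((\<lambda>z. det (jac f z)) \<circ> g)"
      by (intro continuous_on_compose contg continuous_on_subset[OF line_hol_continuous[OF ld]])
         (use gV in auto)
    then show ?thesis by (simp add: \<theta>_def o_def)
  qed
  define W where "W = {w \<in> V. \<theta> w \<noteq> 0}"
  have "W = V \<inter> \<theta> -` (- {0})" by (auto simp: W_def)
  then have oW: "open W" using continuous_open_preimage[OF cont\<theta> oV, of "- {0}"] by (simp add: open_Compl)
  have hg: "holomorphic_map_on g W" unfolding holomorphic_map_on_def
  proof
    fix w assume w: "w \<in> W"
    then have "invertible (jac f (g w))" by (simp add: W_def \<theta>_def invertible_det_nz)
    then obtain B where "jac f (g w) ** B = mat 1" by (auto simp: invertible_def)
    then show "\<exists>J. (g has_derivative (*v) J) (at w)"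
      using deriv_g[of "g w" B] gV[of w] w by (auto simp: W_def)
  qed
  have l\<theta>: "line_hol \<theta> W" unfolding \<theta>_def
    by (rule line_hol_compose[OF ld open_ball hg oW]) (use gV in \<open>auto simp: W_def\<close>)
  \<comment> \<open>Points with nonzero Jacobian determinant are dense in the ball, as the
    determinant does not vanish at 0; continuity of \<open>f\<close> carries the density to the
    image.\<close>
  have dense: "\<exists>w' \<in> ball w e. \<theta> w' \<noteq> 0" if w: "w \<in> V" and "e > 0" for w e
  proof -
    have "isCont f (g w)" using contf gV(1)[OF w] continuous_on_eq_continuous_at[OF open_ball] by blast
    then obtain d where d: "d > 0" "\<And>x. dist x (g w) < d \<Longrightarrow> dist (f x) (f (g w)) < e"
      using \<open>e > 0\<close> unfolding continuous_at_eps_delta by blast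
    obtain z' where z': "z' \<in> ball (g w) d \<inter> ball 0 1" "det (jac f z') \<noteq> 0"
      using line_hol_nonzero_dense[OF ld J0 gV(1)[OF w] d(1)] by blast
    show ?thesis
    proof
      show "\<theta> (f z') \<noteq> 0" using z' gf by (simp add: \<theta>_def)
      show "f z' \<in> ball w e" using d(2)[of z'] z' gV(2)[OF w] by (simp add: dist_commute)
    qed
  qed
  show "holomorphic_map_on g V" unfolding holomorphic_map_on_iff_line_hol[OF oV]
  proof
    fix i
    show "line_hol (\<lambda>w. g w $ i) V"
      by (rule rado_line_hol[OF oV _ cont\<theta> _ _ dense])
         (use contg hg l\<theta> holomorphic_map_on_iff_line_hol[OF oW] in \<open>auto simp: W_def intro!: continuous_intros\<close>)
  qed
qed

text \<open>On a singleton, \<open>holomorphic_map_on\<close> asks only for differentiability at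
  that point, so \<open>has_derivative_jac\<close> can be compared with the given
  derivative.\<close>

lemma jac_eqI:
  fixes f :: "complex^'n \<Rightarrow> complex^'n"
  assumes "(f has_derivative (\<lambda>h. J *v h)) (at z)"
  shows "jac f z = J"
proof -
  have "holomorphic_map_on f {z}" using assms by (auto simp: holomorphic_map_on_def)
  then have "(f has_derivative (\<lambda>h. jac f z *v h)) (at z)" by (rule has_derivative_jac) simp
  then have "(\<lambda>h. jac f z *v h) = (\<lambda>h. J *v h)" using assms has_derivative_unique by blast
  then show ?thesis by (metis matrix_of_matrix_vector_mul)
qed

section \<open>The linear flow and eigenvectors modulo invariant subspaces\<close>

abbreviation mpow :: "complex^'n^'n \<Rightarrow> nat \<Rightarrow> complex^'n \<Rightarrow> complex^'n" where
  "mpow A k \<equiv> ((*v) A) ^^ k"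

text \<open>This is e^{-tA}, the flow of x' = - A x; the sign makes it contract the norm when m(A) >
  0.\<close>

definition flow :: "complex^'n^'n \<Rightarrow> real \<Rightarrow> complex^'n^'n" where
  "flow A t = matrix_exp (- (t *\<^sub>R A))"

lemma scaleR_matrix_vector: "(r *\<^sub>R (M::complex^'n^'n)) *v z = r *\<^sub>R (M *v z)"
  by (simp add: vec_eq_iff matrix_vector_mult_def scaleR_sum_right)

lemma matrix_scaleR_mult: "(r *\<^sub>R (M::complex^'n^'n)) ** N = r *\<^sub>R (M ** N)"
  by (simp add: vec_eq_iff matrix_matrix_mult_def scaleR_sum_right)

lemma matrix_mult_scaleR: "(M::complex^'n^'n) ** (r *\<^sub>R N) = r *\<^sub>R (M ** N)"
  by (simp add: vec_eq_iff matrix_matrix_mult_def scaleR_sum_right)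

lemma matrix_vector_scaleR: "(M::complex^'n^'n) *v (r *\<^sub>R z) = r *\<^sub>R (M *v z)"
  by (simp add: vec_eq_iff matrix_vector_mult_def scaleR_sum_right)

lemma matrix_power_vector: "matrix_power A k *v z = mpow A k z"
  by (induction k) (simp_all add: matrix_power_def flip: matrix_vector_mul_assoc)

lemma matrix_power_scaleR: "matrix_power (r *\<^sub>R A) k = r ^ k *\<^sub>R matrix_power A k"
  by (induction k) (simp_all add: matrix_power_def matrix_scaleR_mult matrix_mult_scaleR)

lemma bounded_linear_mult_vector: "bounded_linear (\<lambda>M::complex^'n^'n. M *v z)"
  unfolding linear_conv_bounded_linear[symmetric]
  by (intro linearI) (simp_all add: scaleR_matrix_vector matrix_vector_mult_add_rdistrib)

lemma flow_sums: "(\<lambda>k. ((-t) ^ k / fact k) *\<^sub>R mpow A k z) sums (flow A t *v z)"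
proof -
  have "(\<lambda>k. matrix_power (- (t *\<^sub>R A)) k /\<^sub>R fact k) sums flow A t"
    unfolding flow_def matrix_exp_def by (rule summable_sums[OF summable_matrix_exp])
  then have "(\<lambda>k. (matrix_power (- (t *\<^sub>R A)) k /\<^sub>R fact k) *v z) sums (flow A t *v z)"
    by (rule bounded_linear.sums[OF bounded_linear_mult_vector])
  moreover have "(matrix_power (- (t *\<^sub>R A)) k /\<^sub>R fact k) *v z = ((-t) ^ k / fact k) *\<^sub>R mpow A k z" for k
    using matrix_power_scaleR[of "-t" A k]
    by (simp add: scaleR_matrix_vector matrix_power_vector divide_inverse mult.commute)
  ultimately show ?thesis by simp
qed

lemma flow_0 [simp]: "flow A 0 *v z = z"
proof -
  have "(\<lambda>k. ((-0) ^ k / fact k) *\<^sub>R mpow A k z) sums (\<Sum>k\<in>{0}. ((-0) ^ k / fact k) *\<^sub>R mpow A k z)"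
    by (rule sums_finite) auto
  then show ?thesis using sums_unique2[OF flow_sums[of 0 A z]] by simp
qed

text \<open>Each coordinate of the orbit is a power series in t that converges for all complex
  arguments, hence can be differentiated term by term.\<close>

lemma flow_vector_derivative:
  "((\<lambda>t. flow A t *v z) has_vector_derivative - (A *v (flow A t *v z))) (at t)"
  unfolding has_vector_derivative_def has_derivative_vec_nth_iff
proof
  fix i
  define c where "c = (\<lambda>k. of_real ((-1) ^ k / fact k) * (mpow A k z $ i))"
  have ser: "(\<lambda>k. c k * of_real s ^ k) sums ((flow A s *v z) $ i)" for s
  proof -
    have "(\<lambda>k. (((-s) ^ k / fact k) *\<^sub>R mpow A k z) $ i) sums ((flow A s *v z) $ i)"
      by (rule bounded_linear.sums[OF bounded_linear_vec_nth flow_sums])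
    moreover have "(((-s) ^ k / fact k) *\<^sub>R mpow A k z) $ i = c k * of_real s ^ k" for k
      by (simp add: c_def scaleR_conv_of_real[where 'a = complex] power_minus[of s] power_minus[of "complex_of_real s"])
    ultimately show ?thesis by simp
  qed
  have summ: "summable (\<lambda>k. c k * y ^ k)" for y :: complex
  proof (rule powser_inside)
    show "summable (\<lambda>k. c k * of_real (norm y + 1) ^ k)" using ser sums_summable by blast
  qed simp
  have "((\<lambda>x. \<Sum>n. c n * x^n) has_field_derivative (\<Sum>n. diffs c n * (of_real t)^n)) (at (of_real t))"
    by (rule termdiffs_strong_converges_everywhere[OF summ])
  moreover have "(\<Sum>n. diffs c n * (of_real t)^n) = - (A *v (flow A t *v z)) $ i"
  proof (rule sums_unique[symmetric])
    have "(\<lambda>k. (A *v (((-t) ^ k / fact k) *\<^sub>R mpow A k z)) $ i) sums ((A *v (flow A t *v z)) $ i)"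
      by (intro bounded_linear.sums[OF bounded_linear_vec_nth]
          bounded_linear.sums[OF matrix_vector_mul_bounded_linear] flow_sums)
    then have "(\<lambda>k. - (A *v (((-t) ^ k / fact k) *\<^sub>R mpow A k z)) $ i) sums (- (A *v (flow A t *v z)) $ i)"
      by (rule sums_minus)
    moreover have "- (A *v (((-t) ^ k / fact k) *\<^sub>R mpow A k z)) $ i = diffs c k * of_real t ^ k" for k
    proof -
      have "diffs c k = of_real (real (Suc k) * ((-1) ^ Suc k / fact (Suc k))) * (mpow A (Suc k) z $ i)"
        by (simp only: diffs_def c_def of_real_mult of_real_of_nat_eq mult.assoc)
      also have "real (Suc k) * ((-1) ^ Suc k / fact (Suc k)) = - ((-1) ^ k / fact k)"
        by (simp add: divide_simps del: of_nat_Suc)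
      finally show ?thesis
        by (simp add: matrix_vector_scaleR scaleR_conv_of_real[where 'a = complex] power_minus[of t] power_minus[of "complex_of_real t"])
    qed
    ultimately show "(\<lambda>n. diffs c n * of_real t ^ n) sums (- (A *v (flow A t *v z)) $ i)" by simp
  qed
  ultimately have "((\<lambda>s. \<Sum>n. c n * (of_real s)^n) has_vector_derivative - (A *v (flow A t *v z)) $ i) (at t)"
    using has_vector_derivative_real_field by fastforce
  moreover have "(\<Sum>n. c n * (of_real s)^n) = (flow A s *v z) $ i" for s
    using ser sums_unique by metis
  ultimately show "((\<lambda>x. (flow A x *v z) $ i) has_derivative (\<lambda>h. (h *\<^sub>R - (A *v (flow A t *v z))) $ i)) (at t)"
    by (simp add: has_vector_derivative_def)
qed

lemma m_op_le: "m_op A * (norm z)\<^sup>2 \<le> (A *v z) \<bullet> z"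
proof (cases "z = 0")
  case False
  define u where "u = inverse (norm z) *\<^sub>R z"
  have u: "norm u = 1" using False by (simp add: u_def)
  have z: "z = norm z *\<^sub>R u" using False by (simp add: u_def)
  have "m_op A \<le> (A *v u) \<bullet> u" using m_op_attained[of A] u by (auto simp: Re_cinner)
  then have "m_op A * (norm z)\<^sup>2 \<le> (A *v u) \<bullet> u * (norm z)\<^sup>2" by (rule mult_right_mono) simp
  also have "\<dots> = (A *v (norm z *\<^sub>R u)) \<bullet> (norm z *\<^sub>R u)"
    by (simp add: matrix_vector_scaleR power2_eq_square)
  finally show ?thesis using z by simp
qed simp

text \<open>The weight serves two energy estimates: for c = 2 m(A) the weighted square of the norm
  does not increase, and for c twice an operator bound of A it does not decrease.\<close>

lemma flow_norm_derivative:
  "((\<lambda>t. exp (c * t) * (norm (flow A t *v z))\<^sup>2) has_real_derivative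
     exp (c * t) * (c * (norm (flow A t *v z))\<^sup>2 - 2 * ((A *v (flow A t *v z)) \<bullet> (flow A t *v z)))) (at t)"
proof -
  let ?y = "flow A t *v z"
  have "((\<lambda>t. (flow A t *v z) \<bullet> (flow A t *v z)) has_derivative
      (\<lambda>h. ?y \<bullet> (h *\<^sub>R - (A *v ?y)) + (h *\<^sub>R - (A *v ?y)) \<bullet> ?y)) (at t)"
    using flow_vector_derivative[of A z t] unfolding has_vector_derivative_def
    by (intro has_derivative_inner)
  moreover have "(\<lambda>h. ?y \<bullet> (h *\<^sub>R - (A *v ?y)) + (h *\<^sub>R - (A *v ?y)) \<bullet> ?y) = (*) (- 2 * ((A *v ?y) \<bullet> ?y))"
    by (auto simp: fun_eq_iff inner_commute algebra_simps)
  ultimately have "((\<lambda>t. (norm (flow A t *v z))\<^sup>2) has_real_derivative (- 2 * ((A *v ?y) \<bullet> ?y))) (at t)"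
    by (simp add: has_field_derivative_def power2_norm_eq_inner)
  moreover have "((\<lambda>t. exp (c * t)) has_real_derivative exp (c * t) * c) (at t)"
    by (auto intro!: derivative_eq_intros)
  ultimately have "((\<lambda>t. exp (c * t) * (norm (flow A t *v z))\<^sup>2) has_real_derivative
      exp (c * t) * c * (norm ?y)\<^sup>2 + (- 2 * ((A *v ?y) \<bullet> ?y)) * exp (c * t)) (at t)"
    by (intro DERIV_mult)
  then show ?thesis by (simp add: algebra_simps)
qed

lemma flow_norm_le:
  assumes "t \<ge> 0" shows "norm (flow A t *v z) \<le> exp (- m_op A * t) * norm z"
proof -
  let ?c = "2 * m_op A"
  have "exp (?c * t) * (norm (flow A t *v z))\<^sup>2 \<le> exp (?c * 0) * (norm (flow A 0 *v z))\<^sup>2"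
  proof (rule DERIV_nonpos_imp_nonincreasing[OF assms])
    fix x
    have "?c * (norm (flow A x *v z))\<^sup>2 - 2 * ((A *v (flow A x *v z)) \<bullet> (flow A x *v z)) \<le> 0"
      using m_op_le[of A "flow A x *v z"] by simp
    then show "\<exists>y. ((\<lambda>t. exp (?c * t) * (norm (flow A t *v z))\<^sup>2) has_real_derivative y) (at x) \<and> y \<le> 0"
      by (intro exI conjI) (rule flow_norm_derivative, intro mult_nonneg_nonpos exp_ge_zero)
  qed
  then have "(exp (m_op A * t) * norm (flow A t *v z))\<^sup>2 \<le> (norm z)\<^sup>2"
    by (simp add: power_mult_distrib exp_double[symmetric] mult.assoc)
  then have "exp (m_op A * t) * norm (flow A t *v z) \<le> norm z"
    by (rule power2_le_imp_le) simp
  then show ?thesis by (simp add: exp_minus field_simps)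
qed

lemma flow_norm_ge:
  assumes a: "\<And>x. norm (A *v x) \<le> a * norm x" and "t \<ge> 0"
  shows "norm z \<le> exp (a * t) * norm (flow A t *v z)"
proof -
  let ?c = "2 * a"
  have "exp (?c * 0) * (norm (flow A 0 *v z))\<^sup>2 \<le> exp (?c * t) * (norm (flow A t *v z))\<^sup>2"
  proof (rule DERIV_nonneg_imp_nondecreasing[OF \<open>t \<ge> 0\<close>])
    fix x
    let ?y = "flow A x *v z"
    have "(A *v ?y) \<bullet> ?y \<le> norm (A *v ?y) * norm ?y" by (rule norm_cauchy_schwarz)
    also have "\<dots> \<le> (a * norm ?y) * norm ?y" by (intro mult_right_mono a) simp
    finally have "0 \<le> ?c * (norm ?y)\<^sup>2 - 2 * ((A *v ?y) \<bullet> ?y)" by (simp add: power2_eq_square)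
    then show "\<exists>y. ((\<lambda>t. exp (?c * t) * (norm (flow A t *v z))\<^sup>2) has_real_derivative y) (at x) \<and> 0 \<le> y"
      by (intro exI conjI) (rule flow_norm_derivative, intro mult_nonneg_nonneg exp_ge_zero)
  qed
  then have "(norm z)\<^sup>2 \<le> (exp (a * t) * norm (flow A t *v z))\<^sup>2"
    by (simp add: power_mult_distrib exp_double[symmetric] mult.assoc)
  then show ?thesis by (rule power2_le_imp_le) simp
qed

lemma matrix_bound:
  obtains a where "a > 0" "\<And>x::complex^'n. norm (A *v x) \<le> a * norm x"
proof -
  obtain K where "K > 0" "\<And>x. norm (A *v x) \<le> norm x * K"
    using bounded_linear.pos_bounded[OF matrix_vector_mul_bounded_linear[of A]] by blast
  with that[of K] show ?thesis by (simp add: mult.commute)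
qed

text \<open>The norm decreases along the orbit, so the velocity stays at most a |z|, and the mean
  value inequality applies on the time interval.\<close>

lemma flow_near_id:
  assumes a: "\<And>x. norm (A *v x) \<le> a * norm x" and "a > 0" and "m_op A > 0" and "t \<ge> 0"
  shows "norm (flow A t *v z - z) \<le> a * t * norm z"
proof -
  have "norm (flow A t *v z - flow A 0 *v z) \<le> (a * norm z) * norm (t - 0)"
  proof (rule differentiable_bound[of "{0..t}"])
    show "((\<lambda>t. flow A t *v z) has_derivative (\<lambda>h. h *\<^sub>R - (A *v (flow A x *v z)))) (at x within {0..t})"
      if "x \<in> {0..t}" for x
      using flow_vector_derivative[of A z x] unfolding has_vector_derivative_def
      by (rule has_derivative_at_withinI)
    show "onorm (\<lambda>h. h *\<^sub>R - (A *v (flow A x *v z))) \<le> a * norm z" if "x \<in> {0..t}" for x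
    proof (rule onorm_le)
      fix h
      have "norm (flow A x *v z) \<le> exp (- m_op A * x) * norm z" by (rule flow_norm_le) (use that in simp)
      also have "\<dots> \<le> 1 * norm z"
        by (intro mult_right_mono) (use that assms(3) in \<open>auto simp: mult_nonneg_nonneg\<close>)
      finally have "norm (flow A x *v z) \<le> norm z" by simp
      then have "norm (A *v (flow A x *v z)) \<le> a * norm z"
        by (intro order_trans[OF a] mult_left_mono) (use \<open>a > 0\<close> in auto)
      then show "norm (h *\<^sub>R - (A *v (flow A x *v z))) \<le> a * norm z * norm h"
        by (simp add: mult.commute[of "\<bar>h\<bar>"] mult_right_mono)
    qed
  qed (use \<open>t \<ge> 0\<close> in auto)
  then show ?thesis using \<open>t \<ge> 0\<close> by (simp add: mult_ac)
qed

lemma flow_surj: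
  fixes A :: "complex^'n^'n"
  assumes "t \<ge> 0" shows "\<exists>x. flow A t *v x = y"
proof -
  obtain a where "\<And>x::complex^'n. norm (A *v x) \<le> a * norm x" using matrix_bound by blast
  from flow_norm_ge[OF this assms] have "flow A t *v x = 0 \<Longrightarrow> x = 0" for x
    by (metis mult_zero_right norm_le_zero_iff norm_zero)
  then obtain B where "B ** flow A t = mat 1" using matrix_left_invertible_ker by blast
  then have "flow A t ** B = mat 1" by (simp add: matrix_left_right_inverse)
  then have "flow A t *v (B *v y) = y" by (simp add: matrix_vector_mul_assoc)
  then show ?thesis by blast
qed

section \<open>Invariant subspaces and eigenvectors of quotients\<close>

lemma closed_complex_subspace:
  assumes "vec.subspace (N::(complex^'n) set)" shows "closed N" "subspace N"
proof -
  show "subspace N"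
    using assms unfolding subspace_def vec.subspace_def by (metis smult_of_real)
  then show "closed N" by (rule closed_subspace)
qed

text \<open>Modulo \<open>N\<close> the vector \<open>w\<close> is an eigenvector, so the two
  exponential series agree term by term modulo \<open>N\<close>; their difference stays in
  \<open>N\<close> because a subspace of finite dimension is closed.\<close>

lemma flow_eigenvector_mod:
  assumes N: "vec.subspace N" and inv: "\<And>x. x \<in> N \<Longrightarrow> A *v x \<in> N" and w: "A *v w - \<mu> *s w \<in> N"
  shows "flow A t *v w - exp (- (t * \<mu>)) *s w \<in> N"
proof -
  have pow: "mpow A k w - \<mu> ^ k *s w \<in> N" for k
  proof (induction k)
    case 0
    then show ?case using N by (simp add: vec.subspace_0)
  next
    case (Suc k)
    have "mpow A (Suc k) w - \<mu> ^ Suc k *s w = A *v (mpow A k w - \<mu> ^ k *s w) + \<mu> ^ k *s (A *v w - \<mu> *s w)"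
      by (simp add: matrix_vector_mult_diff_distrib vector_scalar_commute vector_smult_assoc
          vector_ssub_ldistrib mult.commute)
    then show ?case
      by (simp only:) (intro vec.subspace_add[OF N] vec.subspace_scale[OF N] inv Suc w)
  qed
  define T where "T = (\<lambda>k. ((-t) ^ k / fact k) *\<^sub>R (mpow A k w - \<mu> ^ k *s w))"
  have TN: "(\<Sum>k<n. T k) \<in> N" for n
    by (intro subspace_sum closed_complex_subspace N) (simp add: T_def subspace_scale closed_complex_subspace N pow)
  have "(\<lambda>k. (- (t * \<mu>)) ^ k /\<^sub>R fact k) sums exp (- (t * \<mu>))"
    by (rule exp_converges)
  then have "(\<lambda>k. ((- (t * \<mu>)) ^ k /\<^sub>R fact k) *s w) sums (exp (- (t * \<mu>)) *s w)"
    by (rule bounded_linear.sums[OF bounded_linear_smult_left])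
  moreover have "((- (t * \<mu>)) ^ k /\<^sub>R fact k) *s w = ((-t) ^ k / fact k) *\<^sub>R (\<mu> ^ k *s w)" for k
    by (simp add: vec_eq_iff scaleR_conv_of_real[where 'a = complex] divide_inverse power_mult_distrib
        power_minus[of "\<mu> * complex_of_real t"] power_minus[of t] mult_ac)
  ultimately have "T sums (flow A t *v w - exp (- (t * \<mu>)) *s w)"
    using sums_diff[OF flow_sums[of t A w]] by (simp add: T_def scaleR_diff_right)
  then have "(\<lambda>n. \<Sum>k<n. T k) \<longlonglongrightarrow> flow A t *v w - exp (- (t * \<mu>)) *s w" by (simp add: sums_def)
  with closed_complex_subspace(1)[OF N] TN show ?thesis
    by (rule closed_sequentially)
qed

lemma flow_eigenvector:
  assumes "A *v w = \<mu> *s w" shows "flow A t *v w = exp (- (t * \<mu>)) *s w"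
  using flow_eigenvector_mod[of "{0}" A w \<mu> t] assms by (simp add: vec.subspace_single_0)

text \<open>The one-sided difference quotients at time 0 lie in the closed subspace \<open>N\<close>
  and converge to - A x.\<close>

lemma flow_invariant_imp:
  assumes N: "vec.subspace N" and x: "\<And>t. t \<ge> 0 \<Longrightarrow> flow A t *v x \<in> N"
  shows "A *v x \<in> N"
proof -
  let ?q = "\<lambda>t. (1 / t) *\<^sub>R (flow A t *v x - x)"
  have "((\<lambda>h. norm (flow A (0 + h) *v x - flow A 0 *v x - h *\<^sub>R - (A *v x)) / norm h) \<longlongrightarrow> 0) (at 0)"
    using flow_vector_derivative[of A x 0] unfolding has_vector_derivative_def has_derivative_at by simp
  then have lim: "((\<lambda>h. norm (flow A h *v x - x + h *\<^sub>R (A *v x)) / norm h) \<longlongrightarrow> 0) (at_right 0)"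
    by (simp add: filterlim_at_split)
  have key: "norm (flow A h *v x - x + h *\<^sub>R (A *v x)) / norm h = norm (?q h - - (A *v x))" if "h > 0" for h
  proof -
    have "?q h - - (A *v x) = (1 / h) *\<^sub>R (flow A h *v x - x + h *\<^sub>R (A *v x))"
      using that by (simp add: scaleR_add_right)
    then show ?thesis using that by simp
  qed
  have "((\<lambda>h. norm (?q h - - (A *v x))) \<longlongrightarrow> 0) (at_right 0)"
    by (rule Lim_transform_eventually[OF lim eventually_mono[OF eventually_at_right_less key]])
  then have "(?q \<longlongrightarrow> - (A *v x)) (at_right 0)"
    by (rule Lim_null[THEN iffD2, OF tendsto_norm_zero_cancel])
  moreover have "eventually (\<lambda>t. ?q t \<in> N) (at_right 0)"
  proof (rule eventually_mono[OF eventually_at_right_less])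
    fix t :: real assume "0 < t"
    moreover have "x \<in> N" using x[of 0] by simp
    ultimately show "?q t \<in> N"
      by (intro subspace_scale subspace_diff closed_complex_subspace N x) auto
  qed
  ultimately have "- (A *v x) \<in> N"
    by (intro Lim_in_closed_set[OF closed_complex_subspace(1)[OF N], of ?q "at_right 0"]) auto
  then show ?thesis using vec.subspace_neg[OF N] by fastforce
qed

text \<open>This is p(A) x in Horner form.\<close>

definition poly_act :: "complex^'n^'n \<Rightarrow> complex poly \<Rightarrow> complex^'n \<Rightarrow> complex^'n" where
  "poly_act A p x = fold_coeffs (\<lambda>a y. a *s x + A *v y) p 0"

lemma poly_act_0 [simp]: "poly_act A 0 x = 0"
  by (simp add: poly_act_def)

lemma poly_act_pCons [simp]: "poly_act A (pCons a p) x = a *s x + A *v poly_act A p x"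
  by (cases "a = 0 \<and> p = 0") (auto simp: poly_act_def fold_coeffs_pCons_eq)

lemma poly_act_add: "poly_act A (p + q) x = poly_act A p x + poly_act A q x"
proof (induction p arbitrary: q)
  case (pCons a p)
  then show ?case
    by (cases q) (simp add: matrix_vector_right_distrib vector_sadd_rdistrib)
qed simp

lemma poly_act_smult: "poly_act A (smult c p) x = c *s poly_act A p x"
  by (induction p) (simp_all add: vector_add_ldistrib vector_smult_assoc vector_scalar_commute)

lemma poly_act_sum: "poly_act A (\<Sum>i\<in>I. f i) x = (\<Sum>i\<in>I. poly_act A (f i) x)"
  by (induction I rule: infinite_finite_induct) (simp_all add: poly_act_add)

lemma poly_act_monom: "poly_act A (monom c k) x = c *s mpow A k x"
  by (induction k) (simp_all add: monom_Suc monom_0 vector_scalar_commute)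

lemma poly_act_linear_factor:
  "poly_act A ([:- \<mu>, 1:] * p) x = A *v poly_act A p x - \<mu> *s poly_act A p x"
proof -
  have "[:- \<mu>, 1:] * p = smult (- \<mu>) p + pCons 0 p" by (simp add: mult_pCons_left)
  then show ?thesis by (simp only: poly_act_add poly_act_smult poly_act_pCons) (simp add: vec_eq_iff)
qed

lemma mat_diff_vector: "(A - mat \<mu>) *v y = A *v y - \<mu> *s (y::complex^'n)"
proof -
  have "mat \<mu> *v y = \<mu> *s y"
    by (simp add: vec_eq_iff matrix_vector_mult_def mat_def if_distrib if_distribR cong: if_cong)
  then show ?thesis by (simp add: matrix_vector_mult_diff_rdistrib)
qed

text \<open>The n + 1 iterates x, A x, ..., A^n x are linearly dependent. If two of them coincide,
  the set of iterates is too small for the dimension count, but their difference already yields a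
  polynomial.\<close>

lemma annihilating_poly_exists:
  fixes A :: "complex^'n^'n"
  shows "\<exists>p. p \<noteq> 0 \<and> poly_act A p x = 0"
proof (cases "inj_on (\<lambda>k. mpow A k x) {..CARD('n)}")
  case True
  let ?S = "(\<lambda>k. mpow A k x) ` {..CARD('n)}"
  have "card ?S = Suc (CARD('n))" using card_image[OF True] by simp
  moreover have "vec.dim ?S \<le> CARD('n)"
    using vec.dim_subset_UNIV[of ?S] vec_dim_card by (metis vec.dim_subset top_greatest)
  ultimately have "vec.dependent ?S" by (intro vec.dependent_biggerset_general) simp
  then obtain u v where u: "v \<in> ?S" "u v \<noteq> 0" "(\<Sum>v\<in>?S. u v *s v) = 0"
    using vec.dependent_finite[of ?S] by auto
  obtain k where k: "k \<le> CARD('n)" "v = mpow A k x" using u(1) by auto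
  define p where "p = (\<Sum>k\<le>CARD('n). monom (u (mpow A k x)) k)"
  have "coeff p k = (\<Sum>j\<le>CARD('n). if j = k then u (mpow A j x) else 0)"
    unfolding p_def coeff_sum by (rule sum.cong) auto
  then have "coeff p k = u v" using k by simp
  then have "p \<noteq> 0" using u(2) by auto
  moreover have "poly_act A p x = 0"
    using u(3) by (simp add: p_def poly_act_sum poly_act_monom sum.reindex[OF True])
  ultimately show ?thesis by blast
next
  case False
  then obtain i j where ij: "i \<noteq> j" "mpow A i x = mpow A j x" by (auto simp: inj_on_def)
  define p where "p = monom 1 i + monom (-1::complex) j"
  have "coeff p i = 1" using ij by (simp add: p_def)
  then have "p \<noteq> 0" by auto
  moreover have "poly_act A p x = 0" using ij by (simp add: p_def poly_act_add poly_act_monom vec_eq_iff)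
  ultimately show ?thesis by blast
qed

text \<open>By injectivity and dimension, \<open>B\<close> maps \<open>N\<close> onto itself, so the
  unique preimage of a vector of \<open>N\<close> lies in \<open>N\<close>.\<close>

lemma det_nonzero_surj_on_invariant:
  fixes B :: "complex^'n^'n"
  assumes N: "vec.subspace N" and inv: "\<And>x. x \<in> N \<Longrightarrow> B *v x \<in> N" and "det B \<noteq> 0"
    and w: "B *v w \<in> N"
  shows "w \<in> N"
proof -
  have inj: "inj ((*v) B)"
    using \<open>det B \<noteq> 0\<close> by (metis invertible_det_nz invertible_def matrix_left_invertible_injective)
  let ?M = "(*v) B ` N"
  have sub: "vec.subspace ?M"
    by (rule vec.subspace_image[OF N])
  have "vec.dim ?M = vec.dim N"
    by (rule vec.dim_image_eq[OF _ inj_on_subset[OF inj subset_UNIV]])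
       (rule matrix_vector_mul_linear_gen)
  then have "?M = N"
    using vec.subspace_dim_equal[OF sub N] inv by auto
  then obtain y where "y \<in> N" "B *v w = B *v y" using w by auto
  then show ?thesis using inj by (auto simp: inj_def)
qed

text \<open>Linear factors are split off an annihilating polynomial of \<open>x\<close> until the
  result leaves \<open>N\<close>; that vector is killed modulo \<open>N\<close> by the last factor.
  The number \<mu> is an eigenvalue of A itself, since otherwise A - \<mu> would be bijective on
  \<open>N\<close> and \<open>w\<close> would lie in \<open>N\<close>.\<close>

lemma quotient_eigenvector:
  fixes A :: "complex^'n^'n"
  assumes N: "vec.subspace N" and inv: "\<And>x. x \<in> N \<Longrightarrow> A *v x \<in> N" and "x \<notin> N"
  obtains w \<mu> where "w \<notin> N" "A *v w - \<mu> *s w \<in> N" "det (A - mat \<mu>) = 0"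
proof -
  have "\<exists>w \<mu>. w \<notin> N \<and> A *v w - \<mu> *s w \<in> N" if "p \<noteq> 0" "poly_act A p x \<in> N" for p
    using that
  proof (induction "degree p" arbitrary: p)
    case 0
    then obtain c where "p = [:c:]" by (auto elim: degree_eq_zeroE)
    then have c: "c \<noteq> 0" "c *s x \<in> N" using 0 by auto
    then have "inverse c *s (c *s x) \<in> N" using N vec.subspace_scale by blast
    then show ?case using c \<open>x \<notin> N\<close> by (simp add: vector_smult_assoc)
  next
    case (Suc d)
    then have nc: "\<not> constant (poly p)" by (simp add: constant_degree)
    obtain \<mu> where "poly p \<mu> = 0" using Fundamental_Theorem_Algebra.fundamental_theorem_of_algebra[OF nc] by auto
    then obtain r where r: "p = [:- \<mu>, 1:] * r" by (auto simp: poly_eq_0_iff_dvd)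
    then have r0: "r \<noteq> 0" using Suc.prems by auto
    have "degree p = Suc (degree r)" unfolding r by (subst degree_mult_eq) (use r0 in auto)
    then have dr: "d = degree r" using Suc.hyps by simp
    show ?case
    proof (cases "poly_act A r x \<in> N")
      case True
      then show ?thesis using Suc.hyps(1)[OF dr r0] by blast
    next
      case False
      then show ?thesis using Suc.prems(2) unfolding r poly_act_linear_factor by blast
    qed
  qed
  then obtain w \<mu> where w: "w \<notin> N" "A *v w - \<mu> *s w \<in> N"
    using annihilating_poly_exists[of A x] N by (metis vec.subspace_0)
  have "det (A - mat \<mu>) = 0"
  proof (rule ccontr)
    assume "det (A - mat \<mu>) \<noteq> 0"
    then have "w \<in> N"
      by (rule det_nonzero_surj_on_invariant[OF N, rotated])
         (use w inv N in \<open>auto simp: mat_diff_vector vec.subspace_diff vec.subspace_scale\<close>)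
    with w show False by simp
  qed
  with w that show ?thesis by blast
qed

section \<open>Eigenvalues, the transpose and the bilinear pairing\<close>

lemma poly_charpoly: "poly (charpoly A) \<mu> = det (mat \<mu> - A)"
proof -
  have "poly ((mat [:0, 1:] - (\<chi> i j. [:A $ i $ j:])) $ i $ j) \<mu> = (mat \<mu> - A) $ i $ j" for i j
    by (simp add: mat_def)
  then show ?thesis
    unfolding charpoly_def det_def by (simp add: poly_sum poly_prod)
qed

lemma det_uminus_eq_0: "det (- A :: complex^'n^'n) = 0 \<longleftrightarrow> det A = 0"
proof -
  have "- A = mat (-1) ** A"
    by (simp add: vec_eq_iff matrix_matrix_mult_def mat_def if_distrib if_distribR cong: if_cong)
  moreover have "det (mat (-1) :: complex^'n^'n) \<noteq> 0"
    by (subst det_diagonal) (auto simp: mat_def)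
  ultimately show ?thesis by (simp add: det_mul)
qed

lemma eigenvalue_family_iff:
  assumes "is_eigenvalue_family A ev"
  shows "det (A - mat \<mu>) = 0 \<longleftrightarrow> (\<exists>i. ev i = \<mu>)"
proof -
  have "det (A - mat \<mu>) = 0 \<longleftrightarrow> det (mat \<mu> - A) = 0"
    using det_uminus_eq_0[of "A - mat \<mu>"] by simp
  also have "\<dots> \<longleftrightarrow> (\<Prod>i\<in>UNIV. \<mu> - ev i) = 0"
    using assms unfolding poly_charpoly[symmetric] is_eigenvalue_family_def by (simp add: poly_prod)
  also have "\<dots> \<longleftrightarrow> (\<exists>i. ev i = \<mu>)" by auto
  finally show ?thesis .
qed

lemma det_transpose_diff_mat: "det (transpose A - mat \<mu>) = det (A - mat \<mu> :: complex^'n^'n)"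
proof -
  have "transpose A - mat \<mu> = transpose (A - mat \<mu>)"
    by (auto simp: vec_eq_iff transpose_def mat_def)
  then show ?thesis by (simp add: det_transpose)
qed

text \<open>The pairing is bilinear, unlike \<open>cinner\<close>: it is holomorphic in both
  arguments, and moving A across it produces the transpose, which has the same eigenvalues as
  A.\<close>

definition dotp :: "complex^'n \<Rightarrow> complex^'n \<Rightarrow> complex" where
  "dotp l x = (\<Sum>i\<in>UNIV. l $ i * x $ i)"

lemma dotp_simps:
  "dotp (l + l') x = dotp l x + dotp l' x" "dotp (c *s l) x = c * dotp l x" "dotp 0 x = 0"
  "dotp l (x + y) = dotp l x + dotp l y" "dotp l (c *s x) = c * dotp l x" "dotp l 0 = 0"
  "dotp (l - l') x = dotp l x - dotp l' x" "dotp l (x - y) = dotp l x - dotp l y"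
  "dotp (r *\<^sub>R l) x = r *\<^sub>R dotp l x" "dotp l (r *\<^sub>R x) = r *\<^sub>R dotp l x"
  by (simp_all add: dotp_def algebra_simps sum.distrib sum_subtractf sum_distrib_left scaleR_sum_right)

lemma bounded_linear_dotp: "bounded_linear (dotp l)" "bounded_linear (\<lambda>l. dotp l x)"
  unfolding linear_conv_bounded_linear[symmetric] by (auto intro!: linearI simp: dotp_simps)

lemma dotp_axis: "dotp (axis i 1) x = x $ i"
  by (simp add: dotp_def axis_def if_distrib if_distribR cong: if_cong)

lemma dotp_transpose: "dotp l (A *v x) = dotp (transpose A *v l) x"
  by (simp add: dotp_def matrix_vector_mult_def transpose_def sum_distrib_left sum_distrib_right mult_ac)
     (rule sum.swap)

lemma dotp_flow: "dotp l (flow A t *v x) = dotp (flow (transpose A) t *v l) x"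
proof -
  have pw: "dotp l (mpow A k x) = dotp (mpow (transpose A) k l) x" for k
    by (induction k arbitrary: x) (simp_all add: dotp_transpose funpow_swap1[of "(*v) A"])
  have "(\<lambda>k. dotp l (((-t) ^ k / fact k) *\<^sub>R mpow A k x)) sums dotp l (flow A t *v x)"
    by (rule bounded_linear.sums[OF bounded_linear_dotp(1) flow_sums])
  moreover have "(\<lambda>k. dotp (((-t) ^ k / fact k) *\<^sub>R mpow (transpose A) k l) x) sums dotp (flow (transpose A) t *v l) x"
    by (rule bounded_linear.sums[OF bounded_linear_dotp(2) flow_sums])
  ultimately show ?thesis using sums_unique2 by (simp add: dotp_simps pw)
qed

lemma eigenvector_exists:
  fixes A :: "complex^'n^'n"
  assumes "det (A - mat \<mu>) = 0"
  obtains u where "u \<noteq> 0" "A *v u = \<mu> *s u"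
proof -
  have "\<not> invertible (A - mat \<mu>)" using assms by (simp add: invertible_det_nz)
  then have "\<not> (\<exists>B. B ** (A - mat \<mu>) = mat 1)"
    using matrix_left_right_inverse by (auto simp: invertible_def)
  then obtain u where "u \<noteq> 0" "(A - mat \<mu>) *v u = 0" using matrix_left_invertible_ker by blast
  then show ?thesis using that by (simp add: mat_diff_vector)
qed

section \<open>Homogeneous maps commuting with the flow; homogeneous parts\<close>

lemma flow_dir_deriv:
  assumes "line_hol q UNIV" and q: "\<And>x. q (flow A t *v x) = c * q x"
  shows "dir_deriv q (flow A t *v z) (flow A t *v w) = c * dir_deriv q z w"
proof -
  have "(\<lambda>\<zeta>. q (flow A t *v z + \<zeta> *s (flow A t *v w))) = (\<lambda>\<zeta>. c * q (z + \<zeta> *s w))"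
    by (simp add: q[symmetric] matrix_vector_right_distrib vector_scalar_commute)
  then have "dir_deriv q (flow A t *v z) (flow A t *v w) = deriv (\<lambda>\<zeta>. c * q (z + \<zeta> *s w)) 0"
    by (simp add: dir_deriv_def)
  also have "\<dots> = c * dir_deriv q z w"
    by (rule DERIV_imp_deriv, rule DERIV_cmult, rule line_hol_has_deriv[OF assms(1)]) auto
  finally show ?thesis .
qed

text \<open>Differentiating the homogeneity relation along a line allows division by c only if c is
  nonzero; c = 0 follows by continuity.\<close>

lemma dir_deriv_homogeneous:
  assumes hol: "line_hol q UNIV" and hom: "\<And>c z. q (c *s z) = c ^ Suc k * q z"
  shows "dir_deriv q (c *s z) w = c ^ k * dir_deriv q z w"
proof -
  have nz: "dir_deriv q (c *s z) w = c ^ k * dir_deriv q z w" if "c \<noteq> 0" for c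
  proof -
    have "dir_deriv q (c *s z) (c *s w) = deriv (\<lambda>\<zeta>. c ^ Suc k * q (z + \<zeta> *s w)) 0"
      unfolding dir_deriv_def
      by (rule arg_cong[where f = "\<lambda>g. deriv g 0"])
         (simp only: hom[symmetric] vector_add_ldistrib vector_smult_assoc mult.commute[of c])
    also have "\<dots> = c ^ Suc k * dir_deriv q z w"
      by (rule DERIV_imp_deriv, rule DERIV_cmult, rule line_hol_has_deriv[OF hol]) auto
    finally show ?thesis using that by (simp add: dir_deriv_smult[OF hol])
  qed
  show ?thesis
  proof (cases "c = 0")
    case True
    have cont: "isCont (\<lambda>x. dir_deriv q x w) y" for y
      using line_hol_continuous[OF line_hol_dir_deriv[OF hol open_UNIV]]
      by (simp add: continuous_on_eq_continuous_at)
    have "((\<lambda>c. c *s z) \<longlongrightarrow> 0 *s z) (at 0)" by (intro tendsto_intros)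
    then have lim: "((\<lambda>c. dir_deriv q (c *s z) w) \<longlongrightarrow> dir_deriv q (0 *s z) w) (at 0)"
      by (rule isCont_tendsto_compose[OF cont])
    have lim': "((\<lambda>c. c ^ k * dir_deriv q z w) \<longlongrightarrow> 0 ^ k * dir_deriv q z w) (at 0)"
      by (intro tendsto_intros)
    have ev: "eventually (\<lambda>c. c ^ k * dir_deriv q z w = dir_deriv q (c *s z) w) (at 0)"
      using nz by (auto simp: eventually_at_filter)
    have "dir_deriv q (0 *s z) w = 0 ^ k * dir_deriv q z w"
      by (rule tendsto_unique[OF trivial_limit_at lim Lim_transform_eventually[OF lim' ev]])
    then show ?thesis using True by simp
  qed (rule nz)
qed

text \<open>Time 1 forces the real part to vanish. At time 1/|Im \<nu>| the imaginary part of the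
  exponent has modulus 1, which is not a multiple of 2 \<pi>.\<close>

lemma exp_const_imp_zero:
  fixes \<nu> :: complex
  assumes "\<And>t::real. t \<ge> 0 \<Longrightarrow> exp (- (complex_of_real t * \<nu>)) = 1"
  shows "\<nu> = 0"
proof -
  have "exp (- (complex_of_real 1 * \<nu>)) = 1" by (rule assms[OF zero_le_one])
  then have "Re \<nu> = 0" by (auto simp: exp_eq_1)
  moreover have "Im \<nu> = 0"
  proof (rule ccontr)
    assume ne: "Im \<nu> \<noteq> 0"
    have "exp (- (complex_of_real (1 / \<bar>Im \<nu>\<bar>) * \<nu>)) = 1" by (rule assms) simp
    then obtain n :: int where "- (Im \<nu> / \<bar>Im \<nu>\<bar>) = of_int (2 * n) * pi"
      by (auto simp: exp_eq_1)
    then have "\<bar>of_int (2 * n) * pi\<bar> = 1" using ne by (metis abs_divide abs_idempotent abs_minus_cancel right_inverse_eq abs_eq_0)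
    then have a: "\<bar>of_int n\<bar> * (2 * pi) = 1" by (simp add: abs_mult)
    then have "n \<noteq> 0" by auto
    then have "1 \<le> \<bar>real_of_int n\<bar>" by linarith
    then have "1 * (2 * pi) \<le> \<bar>of_int n\<bar> * (2 * pi)" by (intro mult_right_mono) auto
    with a show False using pi_gt3 by simp
  qed
  ultimately show ?thesis by (simp add: complex_eq_iff)
qed

text \<open>Differentiating \<open>q\<close> along a direction that is an eigenvector modulo the annihilator of all
  derivatives of \<open>q\<close> lowers the degree by one and splits off one eigenvalue of \<open>A\<close>.\<close>

lemma homogeneous_eigenfunction:
  fixes A :: "complex^'n^'n" and \<nu> :: complex
  assumes ev: "is_eigenvalue_family A ev"
    and "line_hol q UNIV" "\<And>c z. q (c *s z) = c ^ k * q z" "q z0 \<noteq> 0"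
    and "\<And>t z. t \<ge> 0 \<Longrightarrow> q (flow A t *v z) = exp (- (t * \<nu>)) * q z"
  shows "\<exists>m :: 'n \<Rightarrow> nat. (\<Sum>i\<in>UNIV. m i) = k \<and> \<nu> = (\<Sum>i\<in>UNIV. of_nat (m i) * ev i)"
  using assms(2-)
proof (induction k arbitrary: q \<nu> z0)
  case 0
  have const: "q z = q 0" for z using 0(2)[of 0 z] by simp
  have "q 0 \<noteq> 0" using 0(3) const[of z0] by simp
  moreover have "q 0 = exp (- (t * \<nu>)) * q 0" if "t \<ge> 0" for t :: real
    using 0(4)[OF that, of 0] by simp
  ultimately have "exp (- (t * \<nu>)) = 1" if "t \<ge> 0" for t :: real
    using that by (metis mult_cancel_right1)
  then have "\<nu> = 0" by (rule exp_const_imp_zero)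
  then show ?case by (intro exI[of _ "\<lambda>_. 0"]) simp
next
  case (Suc k)
  note hol = Suc.prems(1) and hom = Suc.prems(2)
  define N where "N = {w. \<forall>z. dir_deriv q z w = 0}"
  have N: "vec.subspace N"
    unfolding vec.subspace_def N_def
    by (auto simp: dir_deriv_add[OF hol] dir_deriv_smult[OF hol])
  have flowN: "flow A t *v w \<in> N" if "w \<in> N" "t \<ge> 0" for w t
    unfolding N_def
  proof safe
    fix z
    obtain x where x: "flow A t *v x = z" using flow_surj[OF \<open>t \<ge> 0\<close>] by blast
    have "dir_deriv q (flow A t *v x) (flow A t *v w) = exp (- (t * \<nu>)) * dir_deriv q x w"
      by (rule flow_dir_deriv[OF hol]) (rule Suc.prems(4)[OF \<open>t \<ge> 0\<close>])
    then show "dir_deriv q z (flow A t *v w) = 0" using that x by (simp add: N_def)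
  qed
  have inv: "A *v w \<in> N" if "w \<in> N" for w
    by (rule flow_invariant_imp[OF N]) (rule flowN[OF that])
  have "\<exists>x. x \<notin> N"
  proof (rule ccontr)
    assume "\<not> (\<exists>x. x \<notin> N)"
    then have "dir_deriv q z = (\<lambda>w. 0)" for z by (auto simp: N_def)
    then have "(q has_derivative (\<lambda>w. 0)) (at z)" for z
      using line_hol_has_derivative[OF hol open_UNIV, of z] by simp
    then obtain c where "\<And>z. q z = c"
      using has_derivative_zero_constant[of UNIV q] by auto
    then show False using hom[of 0 z0] Suc.prems(3) by simp
  qed
  then obtain x where "x \<notin> N" by blast
  from quotient_eigenvector[OF N inv this] obtain w \<mu> where
    w: "w \<notin> N" "A *v w - \<mu> *s w \<in> N" "det (A - mat \<mu>) = 0" by blast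
  obtain s where s: "ev s = \<mu>" using eigenvalue_family_iff[OF ev] w(3) by blast
  obtain z1 where z1: "dir_deriv q z1 w \<noteq> 0" using w(1) by (auto simp: N_def)
  have "\<exists>m :: 'n \<Rightarrow> nat. (\<Sum>i\<in>UNIV. m i) = k \<and> \<nu> - \<mu> = (\<Sum>i\<in>UNIV. of_nat (m i) * ev i)"
  proof (rule Suc.IH[where q = "\<lambda>z. dir_deriv q z w" and ?z0.0 = z1])
    show "line_hol (\<lambda>z. dir_deriv q z w) UNIV" by (rule line_hol_dir_deriv[OF hol open_UNIV])
    show "dir_deriv q (c *s z) w = c ^ k * dir_deriv q z w" for c z
      by (rule dir_deriv_homogeneous[OF hol hom])
    show "dir_deriv q z1 w \<noteq> 0" by fact
    fix t :: real and z assume t: "t \<ge> 0"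
    \<comment> \<open>Derivatives of \<open>q\<close> vanish along \<open>N\<close>, so the error
      \<open>n\<close> is invisible to them and \<open>w\<close> acts like a genuine
      eigenvector.\<close>
    define n where "n = flow A t *v w - exp (- (t * \<mu>)) *s w"
    have "n \<in> N" unfolding n_def by (rule flow_eigenvector_mod[OF N inv w(2)])
    have "exp (- (t * \<nu>)) * dir_deriv q z w = dir_deriv q (flow A t *v z) (flow A t *v w)"
      by (rule flow_dir_deriv[OF hol, symmetric]) (rule Suc.prems(4)[OF t])
    also have "flow A t *v w = n + exp (- (t * \<mu>)) *s w" by (simp add: n_def)
    also have "dir_deriv q (flow A t *v z) (n + exp (- (t * \<mu>)) *s w) =
        exp (- (t * \<mu>)) * dir_deriv q (flow A t *v z) w"
      using \<open>n \<in> N\<close> by (simp add: dir_deriv_add[OF hol] dir_deriv_smult[OF hol] N_def)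
    finally have "exp (- (t * \<nu>)) * dir_deriv q z w = exp (- (t * \<mu>)) * dir_deriv q (flow A t *v z) w" .
    then have "exp (t * \<mu>) * (exp (- (t * \<nu>)) * dir_deriv q z w) = dir_deriv q (flow A t *v z) w"
      by (simp add: mult.assoc[symmetric] flip: exp_add)
    moreover have "exp (t * \<mu>) * exp (- (t * \<nu>)) = exp (- (t * (\<nu> - \<mu>)))"
      by (simp add: algebra_simps flip: exp_add)
    ultimately show "dir_deriv q (flow A t *v z) w = exp (- (t * (\<nu> - \<mu>))) * dir_deriv q z w"
      by (metis mult.assoc)
  qed
  then obtain m :: "'n \<Rightarrow> nat" where m: "(\<Sum>i\<in>UNIV. m i) = k" "\<nu> - \<mu> = (\<Sum>i\<in>UNIV. of_nat (m i) * ev i)"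
    by blast
  define m' where "m' = (\<lambda>i. m i + (if i = s then 1 else 0))"
  have "(\<Sum>i\<in>UNIV. m' i) = Suc k" by (simp add: m'_def sum.distrib m(1))
  moreover have "(\<Sum>i\<in>UNIV. of_nat (m' i) * ev i) = (\<Sum>i\<in>UNIV. of_nat (m i) * ev i) + (\<Sum>i\<in>UNIV. if i = s then ev i else 0)"
    unfolding sum.distrib[symmetric] by (rule sum.cong) (auto simp: m'_def algebra_simps)
  ultimately show ?case using m(2) s by (intro exI[of _ m']) (simp add: algebra_simps)
qed

text \<open>Let \<open>W\<close> be the space of functionals vanishing on the range of
  \<open>Q\<close>. A functional l that is an eigenvector of the transpose modulo \<open>W\<close>
  turns \<open>Q\<close> into a nonzero scalar eigenfunction for an eigenvalue of A. By
  \<open>homogeneous_eigenfunction\<close> this eigenvalue is a sum of k eigenvalues, that is, a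
  resonance.\<close>

lemma nonresonant_equivariant_eq_0:
  fixes A :: "complex^'n^'n" and Q :: "complex^'n \<Rightarrow> complex^'n"
  assumes "nonresonant A" and hol: "\<And>i. line_hol (\<lambda>z. Q z $ i) UNIV"
    and hom: "\<And>c z. Q (c *s z) = c ^ k *s Q z" and "k \<ge> 2"
    and eq: "\<And>t z. t \<ge> 0 \<Longrightarrow> Q (flow A t *v z) = flow A t *v Q z"
  shows "Q z = 0"
proof (rule ccontr)
  assume "Q z \<noteq> 0"
  obtain ev where ev: "is_eigenvalue_family A ev" using eigenvalue_family_exists by blast
  define W where "W = {l. \<forall>z. dotp l (Q z) = 0}"
  have W: "vec.subspace W" unfolding vec.subspace_def W_def by (auto simp: dotp_simps)
  have inv: "transpose A *v l \<in> W" if l: "l \<in> W" for l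
  proof (rule flow_invariant_imp[OF W])
    fix t :: real assume "t \<ge> 0"
    show "flow (transpose A) t *v l \<in> W"
      using l eq[OF \<open>t \<ge> 0\<close>] by (simp add: W_def flip: dotp_flow) metis
  qed
  obtain i where "Q z $ i \<noteq> 0" using \<open>Q z \<noteq> 0\<close> by (auto simp: vec_eq_iff)
  then have "axis i 1 \<notin> W" by (auto simp: W_def dotp_axis)
  from quotient_eigenvector[OF W inv this] obtain l \<mu> where
    l: "l \<notin> W" "transpose A *v l - \<mu> *s l \<in> W" "det (transpose A - mat \<mu>) = 0" by blast
  obtain s where s: "ev s = \<mu>"
    using eigenvalue_family_iff[OF ev] l(3) by (auto simp: det_transpose_diff_mat)
  obtain z0 where z0: "dotp l (Q z0) \<noteq> 0" using l(1) by (auto simp: W_def)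
  have "\<exists>m :: 'n \<Rightarrow> nat. (\<Sum>i\<in>UNIV. m i) = k \<and> \<mu> = (\<Sum>i\<in>UNIV. of_nat (m i) * ev i)"
  proof (rule homogeneous_eigenfunction[OF ev, where q = "\<lambda>z. dotp l (Q z)" and \<nu> = \<mu> and k = k])
    show "line_hol (\<lambda>z. dotp l (Q z)) UNIV"
      unfolding dotp_def by (intro line_hol_sum line_hol_mult line_hol_const hol)
    show "dotp l (Q (c *s z)) = c ^ k * dotp l (Q z)" for c z by (simp add: hom dotp_simps)
    show "dotp l (Q z0) \<noteq> 0" by fact
    fix t :: real and z assume t: "t \<ge> 0"
    have "flow (transpose A) t *v l - exp (- (t * \<mu>)) *s l \<in> W"
      by (rule flow_eigenvector_mod[OF W inv l(2)])
    then have "dotp (flow (transpose A) t *v l) (Q z) = exp (- (t * \<mu>)) * dotp l (Q z)"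
      by (simp add: W_def dotp_simps)
    then show "dotp l (Q (flow A t *v z)) = exp (- (t * \<mu>)) * dotp l (Q z)"
      by (simp add: eq[OF t] dotp_flow)
  qed
  then obtain m :: "'n \<Rightarrow> nat" where m: "(\<Sum>i\<in>UNIV. m i) = k" "\<mu> = (\<Sum>i\<in>UNIV. of_nat (m i) * ev i)"
    by blast
  have "(\<Sum>i\<in>UNIV. of_nat (m i) * ev i) - ev s \<noteq> 0"
    using \<open>nonresonant A\<close> ev m(1) \<open>k \<ge> 2\<close> unfolding nonresonant_def by blast
  then show False using m(2) s by simp
qed

section \<open>Homogeneous parts of the Taylor expansion\<close>

definition tcoeff :: "nat \<Rightarrow> (complex^'n \<Rightarrow> complex) \<Rightarrow> complex^'n \<Rightarrow> complex" where
  "tcoeff k F z = (deriv ^^ k) (\<lambda>\<zeta>. F (\<zeta> *s z)) 0 / fact k"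

lemma tcoeff_zero_vec: "tcoeff k F 0 = (if k = 0 then F 0 else 0)"
  by (simp add: tcoeff_def higher_deriv_const)

lemma slice_hol_0:
  assumes "line_hol F (ball 0 r)" "z \<noteq> 0"
  shows "(\<lambda>\<zeta>. F (\<zeta> *s z)) holomorphic_on ball 0 (r / norm z)"
  using line_hol_slice_ball[OF assms] by simp

lemma tcoeff_homogeneous:
  assumes hol: "line_hol F (ball 0 r)" and "r > 0"
  shows "tcoeff k F (c *s z) = c ^ k * tcoeff k F z"
proof (cases "z = 0 \<or> c = 0")
  case True
  then show ?thesis by (auto simp: tcoeff_zero_vec power_0_left) (simp add: tcoeff_def)
next
  case False
  have "(deriv ^^ k) (\<lambda>\<zeta>. (\<lambda>\<zeta>. F (\<zeta> *s z)) (c * \<zeta>)) 0 = c ^ k * (deriv ^^ k) (\<lambda>\<zeta>. F (\<zeta> *s z)) (c * 0)"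
    by (rule higher_deriv_compose_linear[OF slice_hol_0[OF hol], where S = "ball 0 (r / norm z / norm c)"])
       (use False \<open>r > 0\<close> in \<open>auto simp: norm_mult field_simps\<close>)
  then show ?thesis by (simp add: tcoeff_def vector_smult_assoc mult.commute)
qed

lemma tcoeff_bound:
  assumes hol: "line_hol F (ball 0 r)" and "r > 0"
    and M: "\<And>z. z \<in> ball 0 r \<Longrightarrow> cmod (F z) \<le> M"
  shows "cmod (tcoeff k F z) \<le> M * (norm z / r) ^ k"
proof (cases "z = 0")
  case True
  then show ?thesis using M[of 0] \<open>r > 0\<close> by (auto simp: tcoeff_zero_vec power_0_left)
next
  case False
  have "cmod ((deriv ^^ k) (\<lambda>\<zeta>. F (\<zeta> *s z)) 0 / fact k) \<le> M / (r / norm z) ^ k"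
    by (rule taylor_coeff_bound[OF slice_hol_0[OF hol False]])
       (use M False \<open>r > 0\<close> in \<open>auto simp: norm_smult field_simps\<close>)
  then show ?thesis by (simp add: tcoeff_def power_divide)
qed

lemma tcoeff_remainder:
  assumes hol: "line_hol F (ball 0 r)" and "r > 0"
    and M: "\<And>z. z \<in> ball 0 r \<Longrightarrow> cmod (F z) \<le> M" and z: "z \<in> ball 0 r"
  shows "cmod (F z - (\<Sum>j<k. tcoeff j F z)) \<le> (real k + 1) * M * (norm z / r) ^ k"
proof (cases "z = 0")
  case True
  have "(\<Sum>j<k. tcoeff j F 0) = (if k = 0 then 0 else F 0)"
    by (simp add: tcoeff_zero_vec)
  then show ?thesis using M[OF z] True by (simp add: power_0_left)
next
  case False
  have "cmod (F (1 *s z) - (\<Sum>j<k. (deriv ^^ j) (\<lambda>\<zeta>. F (\<zeta> *s z)) 0 / fact j * 1 ^ j))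
      \<le> (real k + 1) * M * (norm (1::complex) / (r / norm z)) ^ k"
    by (rule taylor_remainder_bound[OF slice_hol_0[OF hol False]])
       (use M False \<open>r > 0\<close> z in \<open>auto simp: norm_smult field_simps\<close>)
  then show ?thesis by (simp add: tcoeff_def)
qed

lemma line_hol_scale:
  assumes "line_hol F (ball 0 r)" "cmod c * R \<le> r" "c \<noteq> 0"
  shows "line_hol (\<lambda>z. F (c *s z)) (ball 0 R)"
proof (rule line_holI)
  have sub: "c *s z \<in> ball 0 r" if "z \<in> ball 0 R" for z
  proof -
    have "cmod c * norm z < cmod c * R" using that \<open>c \<noteq> 0\<close> by simp
    then show ?thesis using assms(2) by (simp add: norm_smult)
  qed
  have "continuous_on (ball 0 R) (F \<circ> (\<lambda>z. c *s z))"
    by (intro continuous_on_compose continuous_intros continuous_on_subset[OF line_hol_continuous[OF assms(1)]])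
       (use sub in auto)
  then show "continuous_on (ball 0 R) (\<lambda>z. F (c *s z))" by (simp add: o_def)
  fix a h
  have "(\<lambda>\<zeta>. F (c *s a + \<zeta> *s (c *s h))) holomorphic_on {\<zeta>. a + \<zeta> *s h \<in> ball 0 R}"
  proof (rule line_hol_slice[OF assms(1)])
    fix \<zeta> assume "\<zeta> \<in> {\<zeta>. a + \<zeta> *s h \<in> ball 0 R}"
    then have "c *s (a + \<zeta> *s h) \<in> ball 0 r" using sub by blast
    then show "c *s a + \<zeta> *s (c *s h) \<in> ball 0 r"
      by (simp add: vector_add_ldistrib vector_smult_assoc mult.commute)
  qed
  then show "(\<lambda>\<zeta>. F (c *s (a + \<zeta> *s h))) holomorphic_on {\<zeta>. a + \<zeta> *s h \<in> ball 0 R}"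
    by (simp add: vector_add_ldistrib vector_smult_assoc mult.commute)
qed

text \<open>By strong induction, the part of order \<open>k\<close> is the limit, as s \<rightarrow>
  0, of F(s z) minus its lower parts, divided by s^k. The factor s brings any bounded set of z into
  the ball where \<open>F\<close> is given, so the limit is holomorphic on the whole space.\<close>

lemma line_hol_tcoeff:
  fixes F :: "complex^'n \<Rightarrow> complex"
  assumes hol: "line_hol F (ball 0 r)" and "r > 0"
    and M: "\<And>z. z \<in> ball 0 r \<Longrightarrow> cmod (F z) \<le> M"
  shows "line_hol (tcoeff k F) UNIV"
proof (induction k rule: less_induct)
  case (less k)
  have M0: "M \<ge> 0" by (rule order_trans[OF norm_ge_zero M[of 0]]) (use \<open>r > 0\<close> in simp)
  show ?case
  proof (rule line_hol_local[OF open_UNIV])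
    fix z0 :: "complex^'n"
    define R where "R = norm z0 + 1"
    have R: "R > 0" "ball z0 1 \<subseteq> ball 0 R"
    proof -
      show "R > 0" unfolding R_def using norm_ge_zero[of z0] by linarith
      show "ball z0 1 \<subseteq> ball 0 R"
      proof
        fix x assume "x \<in> ball z0 1"
        then show "x \<in> ball 0 R" using dist_triangle[of 0 x z0] by (simp add: R_def)
      qed
    qed
    define s where "s = (\<lambda>n. r / R * inverse (real (Suc n)))"
    have s: "s n > 0" "s n * R \<le> r" for n
    proof -
      show "s n > 0" using R \<open>r > 0\<close> by (simp add: s_def)
      have "r * inverse (real (Suc n)) \<le> r * 1"
        by (intro mult_left_mono inverse_le_1_iff[THEN iffD2]) (use \<open>r > 0\<close> in auto)
      then show "s n * R \<le> r" using R by (simp add: s_def)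
    qed
    have "(\<lambda>n. r / R * inverse (real (Suc n))) \<longlonglongrightarrow> r / R * 0"
      by (intro tendsto_intros LIMSEQ_inverse_real_of_nat)
    then have s0: "s \<longlonglongrightarrow> 0" by (simp add: s_def)
    define G where "G = (\<lambda>n z. inverse (of_real (s n) ^ k) *
        (F (of_real (s n) *s z) - (\<Sum>j<k. of_real (s n) ^ j * tcoeff j F z)))"
    have lG: "line_hol (G n) (ball z0 1)" for n
    proof -
      have "line_hol (\<lambda>z. F (of_real (s n) *s z)) (ball z0 1)"
        by (rule line_hol_subset[OF line_hol_scale[OF hol, of _ R] R(2)]) (use s[of n] in auto)
      moreover have "line_hol (tcoeff j F) (ball z0 1)" if "j < k" for j
        by (rule line_hol_subset[OF less[OF that]]) simp
      ultimately show ?thesis unfolding G_def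
        by (intro line_hol_mult line_hol_diff line_hol_sum line_hol_const) auto
    qed
    define K where "K = (real (Suc k) + 1) * M * (R / r) ^ Suc k"
    have K0: "K \<ge> 0" using M0 R \<open>r > 0\<close> by (simp add: K_def)
    have err: "cmod (G n z - tcoeff k F z) \<le> K * s n" if "z \<in> ball z0 1" for n z
    proof -
      let ?s = "complex_of_real (s n)"
      have zR: "norm z < R" using that R by auto
      have "norm (?s *s z) < r"
      proof -
        have "s n * norm z < s n * R" by (rule mult_strict_left_mono[OF zR s(1)])
        moreover have "norm (?s *s z) = s n * norm z" using s(1)[of n] by (simp add: norm_smult)
        ultimately show ?thesis using s(2)[of n] by linarith
      qed
      then have "cmod (F (?s *s z) - (\<Sum>j<Suc k. tcoeff j F (?s *s z)))
          \<le> (real (Suc k) + 1) * M * (norm (?s *s z) / r) ^ Suc k"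
        by (intro tcoeff_remainder[OF hol \<open>r > 0\<close> M]) auto
      also have "\<dots> \<le> (real (Suc k) + 1) * M * (s n * R / r) ^ Suc k"
        using zR s(1)[of n] M0 \<open>r > 0\<close>
        by (intro mult_left_mono power_mono divide_right_mono) (auto simp: norm_smult)
      also have "\<dots> = s n ^ k * (K * s n)"
        by (simp add: K_def power_mult_distrib power_divide)
      finally have b: "cmod (F (?s *s z) - (\<Sum>j<Suc k. ?s ^ j * tcoeff j F z)) \<le> s n ^ k * (K * s n)"
        by (simp add: tcoeff_homogeneous[OF hol \<open>r > 0\<close>])
      have "?s ^ k * (G n z - tcoeff k F z) = F (?s *s z) - (\<Sum>j<Suc k. ?s ^ j * tcoeff j F z)"
        using s(1)[of n] by (simp add: G_def right_diff_distrib flip: mult.assoc)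
      then have "s n ^ k * cmod (G n z - tcoeff k F z) \<le> s n ^ k * (K * s n)"
        using b s(1)[of n] by (metis norm_mult norm_power norm_of_real abs_of_pos)
      then show ?thesis using s(1)[of n] by simp
    qed
    have ul: "uniform_limit (ball z0 1) G (tcoeff k F) sequentially"
    proof (rule uniform_limitI)
      fix e :: real assume "e > 0"
      have "(\<lambda>n. K * s n) \<longlonglongrightarrow> K * 0" by (intro tendsto_intros s0)
      then have "eventually (\<lambda>n. K * s n < e) sequentially"
        by (rule order_tendstoD(2)) (use \<open>e > 0\<close> in simp)
      then show "eventually (\<lambda>n. \<forall>z\<in>ball z0 1. dist (G n z) (tcoeff k F z) < e) sequentially"
      proof eventually_elim
        case (elim n)
        show ?case
        proof
          fix z assume "z \<in> ball z0 1"
          from le_less_trans[OF err[OF this] elim] show "dist (G n z) (tcoeff k F z) < e"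
            by (simp only: dist_norm)
        qed
      qed
    qed
    have "line_hol (tcoeff k F) (ball z0 1)"
    proof (rule line_hol_uniform_limit[OF open_ball, where F = G])
      fix y assume "y \<in> ball z0 1"
      then obtain d where "d > 0" "ball y d \<subseteq> ball z0 1" using openE[OF open_ball] by blast
      then show "\<exists>r>0. ball y r \<subseteq> ball z0 1 \<and> (\<forall>n. line_hol (G n) (ball y r)) \<and>
          uniform_limit (ball y r) G (tcoeff k F) sequentially"
        using line_hol_subset[OF lG] uniform_limit_on_subset[OF ul] by blast
    qed
    then show "\<exists>r>0. line_hol (tcoeff k F) (ball z0 r)" by (intro exI[of _ 1]) simp
  qed
qed

definition hpart :: "nat \<Rightarrow> (complex^'n \<Rightarrow> complex^'n) \<Rightarrow> complex^'n \<Rightarrow> complex^'n" where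
  "hpart k f z = (\<chi> i. tcoeff k (\<lambda>x. f x $ i) z)"

text \<open>A crude passage from coordinates to the norm; the dimension factor enters only constants
  whose size is immaterial.\<close>

lemma norm_vec_le_card:
  assumes "\<And>i. cmod ((x::complex^'n) $ i) \<le> c" shows "norm x \<le> real CARD('n) * c"
proof -
  have "norm x \<le> (\<Sum>i\<in>UNIV. cmod (x $ i))" unfolding norm_vec_def by (rule L2_set_le_sum) simp
  also have "\<dots> \<le> (\<Sum>i\<in>(UNIV::'n set). c)" by (intro sum_mono assms)
  finally show ?thesis by simp
qed

context
  fixes f :: "complex^'n \<Rightarrow> complex^'n" and r M :: real
  assumes hol: "holomorphic_map_on f (ball 0 r)" and r: "r > 0"
    and M: "\<And>z. z \<in> ball 0 r \<Longrightarrow> norm (f z) \<le> M"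
begin

lemma hpart_components:
  "line_hol (\<lambda>z. f z $ i) (ball 0 r)" "z \<in> ball 0 r \<Longrightarrow> cmod (f z $ i) \<le> M"
  using hol M component_le_norm_cart by (auto simp: holomorphic_map_on_iff_line_hol intro: order_trans[OF Finite_Cartesian_Product.norm_nth_le])

lemma hpart_homogeneous: "hpart k f (c *s z) = c ^ k *s hpart k f z"
  by (simp add: hpart_def vec_eq_iff tcoeff_homogeneous[OF hpart_components(1) r])

lemma hpart_bound: "norm (hpart k f z) \<le> real CARD('n) * (M * (norm z / r) ^ k)"
  by (rule norm_vec_le_card, unfold hpart_def vec_lambda_beta,
      rule tcoeff_bound[OF hpart_components(1) r hpart_components(2)])

lemma hpart_remainder:
  assumes "z \<in> ball 0 r"
  shows "norm (f z - (\<Sum>j<k. hpart j f z)) \<le> real CARD('n) * ((real k + 1) * M * (norm z / r) ^ k)"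
  by (rule norm_vec_le_card)
     (use tcoeff_remainder[OF hpart_components(1) r hpart_components(2) assms] in \<open>simp add: hpart_def\<close>)

lemma line_hol_hpart: "line_hol (\<lambda>z. hpart k f z $ i) UNIV"
  using line_hol_tcoeff[OF hpart_components(1) r hpart_components(2)] by (simp add: hpart_def)

lemma holomorphic_hpart: "holomorphic_map_on (hpart k f) UNIV"
  by (simp add: holomorphic_map_on_iff_line_hol line_hol_hpart)

lemma hpart_0: "hpart 0 f z = f 0"
  by (simp add: hpart_def tcoeff_def vec_eq_iff)

lemma hpart_1: "hpart (Suc 0) f z = jac f 0 *v z"
proof -
  have "tcoeff (Suc 0) (\<lambda>x. f x $ i) z = (jac f 0 *v z) $ i" for i
  proof -
    have "tcoeff (Suc 0) (\<lambda>x. f x $ i) z = dir_deriv (\<lambda>x. f x $ i) 0 z"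
      by (simp add: tcoeff_def dir_deriv_def)
    also have "\<dots> = (jac f 0 *v z) $ i"
      using dir_deriv_expand[OF hpart_components(1) open_ball, of 0 i z] r
      by (simp only: jac_def matrix_vector_mult_def vec_lambda_beta centre_in_ball)
    finally show ?thesis .
  qed
  then show ?thesis by (simp add: hpart_def vec_eq_iff)
qed

end

section \<open>Transition maps\<close>

definition transition :: "complex^'n^'n \<Rightarrow> real \<Rightarrow> (complex^'n \<Rightarrow> complex^'n) \<Rightarrow> complex^'n \<Rightarrow> complex^'n" where
  "transition A t f z = inv_into (ball 0 1) f (flow A t *v f z)"

lemma holomorphic_map_on_matrix:
  assumes "holomorphic_map_on f U" shows "holomorphic_map_on (\<lambda>z. B *v f z) U"
  unfolding holomorphic_map_on_def
proof
  fix z assume "z \<in> U"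
  have "((\<lambda>z. B *v f z) has_derivative (\<lambda>h. B *v (jac f z *v h))) (at z)"
    by (rule bounded_linear.has_derivative[OF matrix_vector_mul_bounded_linear has_derivative_jac[OF assms \<open>z \<in> U\<close>]])
  then show "\<exists>J. ((\<lambda>z. B *v f z) has_derivative (*v) J) (at z)"
    by (intro exI[of _ "B ** jac f z"]) (simp add: matrix_vector_mul_assoc)
qed

lemma holomorphic_map_on_id: "holomorphic_map_on (\<lambda>z::complex^'n. z) U"
proof -
  have "(*v) (mat 1) = (\<lambda>h::complex^'n. h)" by (auto simp: fun_eq_iff matrix_vector_mul_lid)
  then show ?thesis unfolding holomorphic_map_on_def by (intro ballI exI[of _ "mat 1"]) simp
qed

lemma holomorphic_map_on_diff:
  assumes "holomorphic_map_on f U" "holomorphic_map_on g U" "open U"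
  shows "holomorphic_map_on (\<lambda>z. f z - g z) U"
  using assms by (simp add: holomorphic_map_on_iff_line_hol line_hol_diff)

lemma holomorphic_map_on_sum:
  assumes "\<And>j. j \<in> I \<Longrightarrow> holomorphic_map_on (f j) U" "open U"
  shows "holomorphic_map_on (\<lambda>z. \<Sum>j\<in>I. f j z) U"
  using assms by (simp add: holomorphic_map_on_iff_line_hol line_hol_sum)

lemma holomorphic_map_bounded:
  assumes "holomorphic_map_on f (ball 0 1)" "r < 1"
  obtains M where "\<And>z. z \<in> cball 0 r \<Longrightarrow> norm (f z) \<le> M"
proof -
  have "compact (f ` cball 0 r)"
    by (intro compact_continuous_image continuous_on_subset[OF holomorphic_map_on_continuous[OF assms(1)]])
       (use assms(2) in auto)
  then have "bounded (f ` cball 0 r)" by (rule compact_imp_bounded)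
  then obtain M where "\<forall>x\<in>f ` cball 0 r. norm x \<le> M" unfolding bounded_iff by auto
  then show ?thesis by (intro that[of M]) auto
qed

lemma flow_contraction:
  assumes "m_op A > 0" "t \<ge> 0" shows "norm (flow A t *v z) \<le> norm z"
proof -
  have "exp (- m_op A * t) * norm z \<le> 1 * norm z"
    by (intro mult_right_mono) (use assms in auto)
  then show ?thesis using flow_norm_le[OF assms(2), of A z] by simp
qed

lemma S_hatD:
  assumes "f \<in> S_hat A"
  shows "holomorphic_map_on f (ball 0 1)" "inj_on f (ball 0 1)" "f 0 = 0" "jac f 0 = mat 1"
    "\<And>z t. z \<in> ball 0 1 \<Longrightarrow> t \<ge> 0 \<Longrightarrow> flow A t *v f z \<in> f ` ball 0 1"
proof -
  show "holomorphic_map_on f (ball 0 1)" "inj_on f (ball 0 1)" "f 0 = 0"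
    using assms by (auto simp: S_hat_def S_ball_def holo_ball_def)
  have "(f has_derivative (\<lambda>h. mat 1 *v h)) (at 0)"
    using assms by (simp add: S_hat_def S_ball_def matrix_vector_mul_lid)
  then show "jac f 0 = mat 1" by (rule jac_eqI)
  show "\<And>z t. z \<in> ball 0 1 \<Longrightarrow> t \<ge> 0 \<Longrightarrow> flow A t *v f z \<in> f ` ball 0 1"
    using assms by (auto simp: S_hat_def spirallike_def flow_def)
qed

section \<open>Schwarz and Harnack estimates for transition maps\<close>

locale pos_generator =
  fixes A :: "complex^'n^'n"
  assumes A: "m_op A > 0"
begin

text \<open>Spirallikeness returns the flowed point to the image of \<open>f\<close>, where the
  inverse is defined. Since \<open>f\<close> has the identity as derivative at 0, conjugation by
  \<open>f\<close> leaves the derivative of the flow at the origin unchanged.\<close>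

lemma transition:
  assumes f: "f \<in> S_hat A" and t: "t \<ge> 0"
  shows "z \<in> ball 0 1 \<Longrightarrow> transition A t f z \<in> ball 0 1"
    and "z \<in> ball 0 1 \<Longrightarrow> f (transition A t f z) = flow A t *v f z"
    and "transition A t f 0 = 0"
    and "holomorphic_map_on (transition A t f) (ball 0 1)"
    and "jac (transition A t f) 0 = flow A t"
proof -
  note F = S_hatD[OF f]
  let ?g = "inv_into (ball 0 1) f"
  show in_ball: "transition A t f z \<in> ball 0 1" if "z \<in> ball 0 1" for z
    unfolding transition_def by (rule inv_into_into[OF F(5)[OF that t]])
  show "f (transition A t f z) = flow A t *v f z" if "z \<in> ball 0 1" for z
    unfolding transition_def by (rule f_inv_into_f[OF F(5)[OF that t]])
  have g0: "?g 0 = 0" using inv_into_f_f[OF F(2), of 0] F(3) by simp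
  then show "transition A t f 0 = 0" by (simp add: transition_def F(3))
  have J0: "det (jac f 0) \<noteq> 0" by (simp add: F(4) det_I)
  note I = holomorphic_inverse[OF F(1,2) J0]
  have "holomorphic_map_on (\<lambda>z. ?g (flow A t *v f z)) (ball 0 1)"
    by (rule holomorphic_map_compose[OF I(2) holomorphic_map_on_matrix[OF F(1)]]) (use F(5) t in auto)
  then show "holomorphic_map_on (transition A t f) (ball 0 1)"
    by (simp add: transition_def[abs_def])
  have "(?g has_derivative (\<lambda>h. mat 1 *v h)) (at (f 0))"
    by (rule I(3)) (simp_all add: F(4))
  then have dg: "(?g has_derivative (\<lambda>h. h)) (at (flow A t *v f 0))" by (simp add: F(3) matrix_vector_mul_lid)
  have df: "(f has_derivative (\<lambda>h. h)) (at 0)"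
    using has_derivative_jac[OF F(1), of 0] by (simp add: F(4) matrix_vector_mul_lid)
  have "((\<lambda>z. flow A t *v f z) has_derivative (\<lambda>h. flow A t *v h)) (at 0)"
    by (rule bounded_linear.has_derivative[OF matrix_vector_mul_bounded_linear df])
  from diff_chain_at[OF this dg]
  have "(transition A t f has_derivative (\<lambda>h. flow A t *v h)) (at 0)"
    by (simp add: o_def transition_def[abs_def])
  then show "jac (transition A t f) 0 = flow A t" by (rule jac_eqI)
qed

lemma transition_norm_le:
  assumes f: "f \<in> S_hat A" and t: "t \<ge> 0" and z: "z \<in> ball 0 1"
  shows "norm (transition A t f z) \<le> norm z"
proof -
  note T = transition[OF f t]
  \<comment> \<open>The constant 2 is the Lipschitz bound 1 / (1 - 1/2) on the half ball; it only
    certifies vanishing of order 1.\<close>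
  have "norm (transition A t f z) \<le> 1 * (norm z / 1) ^ 1"
  proof (rule holomorphic_map_schwarz_order[OF T(4), where \<delta> = "1/2" and C = 2])
    show "norm (transition A t f x) \<le> 1" if "x \<in> ball 0 1" for x using T(1)[OF that] by simp
    show "norm (transition A t f x) \<le> 2 * norm x ^ 1" if "norm x < 1/2" for x
    proof -
      have "norm (transition A t f x - transition A t f 0) \<le> 1 / (1 - 1/2) * norm (x - 0)"
        by (rule holomorphic_map_lipschitz[OF T(4)]) (use T(1) that in \<open>auto intro: less_imp_le\<close>)
      then show ?thesis by (simp add: T(3))
    qed
  qed (use z in auto)
  then show ?thesis by simp
qed

text \<open>Along the line through \<open>z\<close>, the function \<zeta> \<mapsto> <v(\<zeta> u),
  w> / \<zeta> is bounded by 1 and has the value <e^{-tA} u, w> at 0. Harnack's inequality for 1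
  minus this function compares the nonlinear map with its linear part. The vector \<open>w\<close>
  is left free: the direction of v(z) gives the contraction, the direction of z the closeness to the
  identity.\<close>

lemma transition_harnack:
  assumes f: "f \<in> S_hat A" and t: "t \<ge> 0" and z: "z \<noteq> 0" "norm z \<le> r" "r < 1" and w: "norm w \<le> 1"
  defines "u \<equiv> inverse (norm z) *\<^sub>R z"
  shows "(1 - (flow A t *v u) \<bullet> w) * (1 - r) \<le> (1 - (transition A t f z \<bullet> w) / norm z) * (1 + r)"
    and "(1 - (transition A t f z \<bullet> w) / norm z) * (1 - r) \<le> (1 - (flow A t *v u) \<bullet> w) * (1 + r)"
proof -
  note T = transition[OF f t]
  let ?v = "transition A t f"
  have u: "norm u = 1" using z by (simp add: u_def)
  define G where "G = (\<lambda>\<zeta>. cinner (?v (0 + \<zeta> *s u)) w)"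
  have inb: "0 + \<zeta> *s u \<in> ball 0 1" if "\<zeta> \<in> ball 0 1" for \<zeta>
    using that by (simp add: norm_smult u)
  have Ghol: "G holomorphic_on ball 0 1"
    unfolding G_def by (rule line_hol_slice[OF line_hol_cinner[OF T(4) open_ball]]) (rule inb)
  have Gle: "cmod (G \<zeta>) \<le> 1" if "\<zeta> \<in> ball 0 1" for \<zeta>
  proof -
    have "cmod (G \<zeta>) \<le> norm (?v (0 + \<zeta> *s u)) * norm w" unfolding G_def by (rule norm_cinner_le)
    also have "\<dots> \<le> 1 * 1" using T(1)[OF inb[OF that]] w by (intro mult_mono) auto
    finally show ?thesis by simp
  qed
  have G0: "G 0 = 0" by (simp add: G_def T(3) cinner_def)
  define H where "H = (\<lambda>\<zeta>. if \<zeta> = 0 then deriv G 0 else G \<zeta> / \<zeta>)"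
  note Q = schwarz_quotient[OF Ghol _ Gle G0, folded H_def]
  have "deriv G 0 = dir_deriv (\<lambda>x. cinner (?v x) w) 0 u" by (simp add: dir_deriv_def G_def)
  also have "\<dots> = cinner (flow A t *v u) w"
    by (rule has_derivative_imp_dir_deriv(2)[OF has_derivative_cinner])
       (use has_derivative_jac[OF T(4), of 0] T(5) in \<open>auto simp: vector_scalar_commute cinner_smult\<close>)
  finally have H0: "Re (1 - H 0) = 1 - (flow A t *v u) \<bullet> w" by (simp add: H_def Re_cinner)
  have zu: "of_real (norm z) *s u = z" using z by (simp add: smult_of_real u_def)
  have Hz: "Re (1 - H (of_real (norm z))) = 1 - (?v z \<bullet> w) / norm z"
    using z by (simp add: H_def G_def zu Re_cinner)
  have hol1: "(\<lambda>\<zeta>. 1 - H \<zeta>) holomorphic_on ball 0 1" using Q(1) by (intro holomorphic_intros) auto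
  have pos: "Re (1 - H \<zeta>) \<ge> 0" if "\<zeta> \<in> ball 0 1" for \<zeta>
  proof -
    have "cmod (H \<zeta>) \<le> 1" using Q(2)[OF _ _ that] Gle by (simp add: H_def)
    then show ?thesis using complex_Re_le_cmod[of "H \<zeta>"] by simp
  qed
  have nz: "norm (complex_of_real (norm z)) \<le> r" using z by simp
  show "(1 - (flow A t *v u) \<bullet> w) * (1 - r) \<le> (1 - (?v z \<bullet> w) / norm z) * (1 + r)"
    "(1 - (?v z \<bullet> w) / norm z) * (1 - r) \<le> (1 - (flow A t *v u) \<bullet> w) * (1 + r)"
    using harnack_disc[OF hol1 pos nz \<open>r < 1\<close>] H0 Hz by simp_all
qed

lemma transition_contraction:
  assumes "r < 1" "r \<ge> 0" "t > 0"
  obtains q where "0 < q" "q < 1"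
    "\<And>f z. f \<in> S_hat A \<Longrightarrow> z \<in> cball 0 r \<Longrightarrow> norm (transition A t f z) \<le> q * norm z"
proof -
  define e where "e = exp (- m_op A * t)"
  have e: "0 < e" "e < 1" using A \<open>t > 0\<close> by (auto simp: e_def)
  \<comment> \<open>The linear part loses at least 1 - e in every direction, and Harnack's
    inequality preserves the fraction (1 - r) / (1 + r) of this loss for every
    \<open>f\<close>.\<close>
  define d where "d = (1 - e) * (1 - r) / (1 + r)"
  have d0: "d > 0" using e assms by (simp add: d_def)
  have "(1 - e) * (1 - r) \<le> (1 - e) * (1 + r)" using e assms by (intro mult_left_mono) auto
  then have "d \<le> 1 - e" using assms by (simp add: d_def divide_le_eq)
  then have d1: "d < 1" using e by simp
  show ?thesis
  proof (rule that[of "1 - d"])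
    fix f z assume f: "f \<in> S_hat A" and z: "z \<in> cball (0::complex^'n) r"
    let ?v = "transition A t f z"
    show "norm ?v \<le> (1 - d) * norm z"
    proof (cases "z = 0")
      case True
      then show ?thesis using transition(3)[OF f] \<open>t > 0\<close> by simp
    next
      case False
      define w where "w = inverse (norm ?v) *\<^sub>R ?v"
      have w: "norm w \<le> 1" by (cases "?v = 0") (simp_all add: w_def)
      define u where "u = inverse (norm z) *\<^sub>R z"
      have "norm u = 1" using False by (simp add: u_def)
      have "(flow A t *v u) \<bullet> w \<le> norm (flow A t *v u) * norm w" by (rule norm_cauchy_schwarz)
      also have "\<dots> \<le> e * 1"
        using flow_norm_le[of t A u] w \<open>norm u = 1\<close> \<open>t > 0\<close> e by (intro mult_mono) (auto simp: e_def)
      finally have "(1 - e) * (1 - r) \<le> (1 - (flow A t *v u) \<bullet> w) * (1 - r)"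
        using assms by (intro mult_right_mono) auto
      also have "\<dots> \<le> (1 - (?v \<bullet> w) / norm z) * (1 + r)"
        unfolding u_def by (rule transition_harnack(1)[OF f _ False _ _ w]) (use z assms in auto)
      also have "?v \<bullet> w = norm ?v"
        by (cases "?v = 0") (simp_all add: w_def power2_norm_eq_inner[symmetric] power2_eq_square)
      finally have "d \<le> 1 - norm ?v / norm z"
        using assms by (simp add: d_def divide_le_eq)
      then have "norm ?v / norm z \<le> 1 - d" by simp
      then show ?thesis using False by (simp add: divide_le_eq)
    qed
  qed (use d0 d1 in auto)
qed

text \<open>By Harnack's inequality the component of v(z) along z falls short of z by O(t) only.
  Since the norm does not increase, expanding the square of the distance controls the transversal
  component as well; hence the estimate is for the square.\<close>

lemma transition_near_id:
  assumes f: "f \<in> S_hat A" and t: "t \<ge> 0" and z: "z \<in> cball 0 r" and "r < 1"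
    and a: "\<And>x. norm (A *v x) \<le> a * norm x" "a > 0"
  shows "(norm (transition A t f z - z))\<^sup>2 \<le> 4 * a * t / (1 - r)"
proof (cases "z = 0")
  case True
  then show ?thesis using transition(3)[OF f t] assms by simp
next
  case False
  let ?v = "transition A t f z"
  define u where "u = inverse (norm z) *\<^sub>R z"
  have u: "norm u = 1" using False by (simp add: u_def)
  have r0: "r \<ge> 0" "norm z \<le> r" using z by (auto intro: order_trans[OF norm_ge_zero])
  define P where "P = (?v \<bullet> u) / norm z"
  have vz: "?v \<bullet> z = P * (norm z)\<^sup>2"
    using False by (simp add: P_def u_def power2_eq_square)
  have h: "(1 - P) * (1 - r) \<le> (1 - (flow A t *v u) \<bullet> u) * (1 + r)"
    unfolding P_def using transition_harnack(2)[OF f t False r0(2) \<open>r < 1\<close>, of u] u by (simp add: u_def)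
  have uu: "u \<bullet> u = 1" using u by (simp add: power2_norm_eq_inner[symmetric])
  have "1 - (flow A t *v u) \<bullet> u = (u - flow A t *v u) \<bullet> u"
    by (simp add: inner_diff_left uu)
  also have "\<dots> \<le> norm (u - flow A t *v u) * norm u" by (rule norm_cauchy_schwarz)
  also have "\<dots> \<le> a * t"
    using flow_near_id[OF a A t, of u] u by (simp add: norm_minus_commute)
  finally have at: "1 - (flow A t *v u) \<bullet> u \<le> a * t" .
  have "(1 - (flow A t *v u) \<bullet> u) * (1 + r) \<le> (a * t) * 2"
    using at r0 \<open>r < 1\<close> a t by (intro mult_mono) auto
  then have "(1 - P) * (1 - r) \<le> 2 * a * t" using h by simp
  then have P: "1 - P \<le> 2 * a * t / (1 - r)" using \<open>r < 1\<close> by (simp add: le_divide_eq)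
  have zb: "z \<in> ball 0 1" using z \<open>r < 1\<close> by simp
  have "(norm (?v - z))\<^sup>2 = (norm ?v)\<^sup>2 + (norm z)\<^sup>2 - 2 * (?v \<bullet> z)"
    by (simp add: power2_norm_eq_inner inner_diff_left inner_diff_right inner_commute)
  also have "\<dots> \<le> (norm z)\<^sup>2 + (norm z)\<^sup>2 - 2 * (?v \<bullet> z)"
    using transition_norm_le[OF f t zb] by (simp add: power_mono)
  also have "\<dots> = 2 * (norm z)\<^sup>2 * (1 - P)" by (simp add: vz algebra_simps)
  also have "\<dots> \<le> 2 * (norm z)\<^sup>2 * (2 * a * t / (1 - r))"
    by (intro mult_left_mono P) auto
  also have "\<dots> \<le> 2 * 1 * (2 * a * t / (1 - r))"
    using zb a t \<open>r < 1\<close> by (intro mult_right_mono mult_left_mono) (auto simp: power_le_one)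
  finally show ?thesis by simp
qed

text \<open>For small t the difference of \<open>v\<close> and the identity is at most (r' - r)/2 on
  the ball of radius r', hence has Lipschitz constant 1/2 on the ball of radius r.\<close>

lemma transition_lower_lipschitz:
  assumes "0 \<le> r" "r < 1"
  obtains t where "t > 0"
    "\<And>f x y. f \<in> S_hat A \<Longrightarrow> x \<in> cball 0 r \<Longrightarrow> y \<in> cball 0 r \<Longrightarrow>
       norm (x - y) \<le> 2 * norm (transition A t f x - transition A t f y)"
proof -
  obtain a where a: "a > 0" "\<And>x::complex^'n. norm (A *v x) \<le> a * norm x" using matrix_bound by blast
  define r' where "r' = (1 + r) / 2"
  have r': "r < r'" "r' < 1" using assms by (auto simp: r'_def)
  define d where "d = (r' - r) / 2"
  \<comment> \<open>Chosen so that the bound of \<open>transition_near_id\<close> on the ball of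
    radius r' equals the square of \<open>d\<close>.\<close>
  define t where "t = d\<^sup>2 * (1 - r') / (4 * a)"
  have d: "d > 0" using r' by (simp add: d_def)
  have t: "t > 0" using d r' a by (simp add: t_def)
  have t4: "4 * a * t / (1 - r') = d\<^sup>2" using a r' by (simp add: t_def)
  show ?thesis
  proof (rule that[OF t])
    fix f and x y :: "complex^'n" assume f: "f \<in> S_hat A" and xy: "x \<in> cball 0 r" "y \<in> cball 0 r"
    let ?v = "transition A t f"
    let ?g = "\<lambda>z. ?v z - z"
    have sub: "ball 0 r' \<subseteq> ball (0::complex^'n) 1" using r' by auto
    have "norm (?g x - ?g y) \<le> d / (r' - r) * norm (x - y)"
    proof (rule holomorphic_map_lipschitz[OF _ r'(1)])
      show "holomorphic_map_on ?g (ball 0 r')"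
        by (intro holomorphic_map_on_diff holomorphic_map_on_id open_ball
            holomorphic_map_on_subset[OF transition(4)[OF f] sub]) (use t in simp)
      fix z :: "complex^'n" assume "z \<in> ball 0 r'"
      then have "(norm (?g z))\<^sup>2 \<le> 4 * a * t / (1 - r')"
        by (intro transition_near_id[OF f _ _ r'(2) a(2,1)]) (use t in auto)
      then have "(norm (?g z))\<^sup>2 \<le> d\<^sup>2" by (simp only: t4)
      then show "norm (?g z) \<le> d" by (rule power2_le_imp_le) (use d in simp)
    qed (use xy in auto)
    also have "d / (r' - r) = 1/2" using r' by (simp add: d_def)
    finally have "norm (?g x - ?g y) \<le> 1/2 * norm (x - y)" .
    moreover have "x - y = (?v x - ?v y) - (?g x - ?g y)" by simp
    then have "norm (x - y) \<le> norm (?v x - ?v y) + norm (?g x - ?g y)"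
      by (metis norm_triangle_ineq4)
    ultimately show "norm (x - y) \<le> 2 * norm (?v x - ?v y)" by simp
  qed
qed

section \<open>Taylor expansion of the functional equation\<close>

lemma S_hat_local_data:
  assumes f: "f \<in> S_hat A" and "r < 1" "r > 0"
  obtains M where "M \<ge> 0" "\<And>z. z \<in> ball 0 r \<Longrightarrow> norm (f z) \<le> M" "holomorphic_map_on f (ball 0 r)"
proof -
  note F = S_hatD[OF f]
  obtain M where M: "\<And>z. z \<in> cball 0 r \<Longrightarrow> norm (f z) \<le> M"
    using holomorphic_map_bounded[OF F(1) \<open>r < 1\<close>] by blast
  show ?thesis
  proof (rule that[of M])
    show "M \<ge> 0" by (rule order_trans[OF norm_ge_zero M[of 0]]) (use \<open>r > 0\<close> in simp)
    show "holomorphic_map_on f (ball 0 r)"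
      by (rule holomorphic_map_on_subset[OF F(1)]) (use \<open>r < 1\<close> in auto)
  qed (use M in auto)
qed

lemma S_hat_hpart_low:
  assumes f: "f \<in> S_hat A"
  shows "hpart 0 f z = 0" "hpart (Suc 0) f z = z"
proof -
  obtain M where "\<And>z. z \<in> ball 0 (1/2) \<Longrightarrow> norm (f z) \<le> M" and h: "holomorphic_map_on f (ball 0 (1/2))"
    using S_hat_local_data[OF f, of "1/2"] by auto
  note D = h _ this(1)
  show "hpart 0 f z = 0" using hpart_0[OF D] S_hatD(3)[OF f] by simp
  show "hpart (Suc 0) f z = z" using hpart_1[OF D] S_hatD(4)[OF f] by (simp add: matrix_vector_mul_lid)
qed

text \<open>Rescaling to the unit ball gains the factor s^k, because the values scale with degree k
  + 1 and the distances with degree 1.\<close>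

lemma homogeneous_lipschitz:
  fixes Q :: "complex^'n \<Rightarrow> complex^'n"
  assumes hom: "\<And>c z. Q (c *s z) = c ^ Suc k *s Q z"
    and L: "\<And>x y. x \<in> cball 0 1 \<Longrightarrow> y \<in> cball 0 1 \<Longrightarrow> norm (Q x - Q y) \<le> L * norm (x - y)"
    and xy: "norm x \<le> s" "norm y \<le> s"
  shows "norm (Q x - Q y) \<le> L * s ^ k * norm (x - y)"
proof (cases "s = 0")
  case True
  then show ?thesis using xy by simp
next
  case False
  then have s: "s > 0" using xy norm_ge_zero[of x] by linarith
  let ?c = "complex_of_real s"
  have eq: "z = ?c *s (inverse s *\<^sub>R z)" for z :: "complex^'n"
    using s by (simp add: smult_of_real)
  have "Q x - Q y = ?c ^ Suc k *s (Q (inverse s *\<^sub>R x) - Q (inverse s *\<^sub>R y))"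
    using hom[of ?c "inverse s *\<^sub>R x"] hom[of ?c "inverse s *\<^sub>R y"] eq[of x] eq[of y]
    by (simp add: vector_ssub_ldistrib)
  then have "norm (Q x - Q y) = s ^ Suc k * norm (Q (inverse s *\<^sub>R x) - Q (inverse s *\<^sub>R y))"
    by (simp only: norm_smult norm_power norm_of_real) (use s in simp)
  also have "\<dots> \<le> s ^ Suc k * (L * norm (inverse s *\<^sub>R x - inverse s *\<^sub>R y))"
    by (intro mult_left_mono L) (use s xy in \<open>auto simp: field_simps\<close>)
  also have "norm (inverse s *\<^sub>R x - inverse s *\<^sub>R y) = inverse s * norm (x - y)"
    using s by (simp flip: scaleR_diff_right)
  finally show ?thesis using s by (simp add: field_simps)
qed

text \<open>The identity f(v x) = e^{-tA} f(x) is expanded up to order k + 1. In the top part of the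
  left side, v x may be replaced by e^{-tA} x: their difference is quadratic in x, and the part of
  order k + 1 has a Lipschitz constant of size |x|^k at scale |x|. The constant depends on
  \<open>f\<close>, but only the order of the error is used later.\<close>

lemma transition_expansion:
  assumes f: "f \<in> S_hat A" and t: "t \<ge> 0"
  obtains C where "\<And>x. norm x < 1/2 \<Longrightarrow>
    norm ((\<Sum>j<Suc k. hpart j f (transition A t f x)) - (\<Sum>j<Suc (Suc k). flow A t *v hpart j f x)
      + hpart (Suc k) f (flow A t *v x)) \<le> C * norm x ^ Suc (Suc k)"
proof -
  note T = transition[OF f t]
  let ?v = "transition A t f" and ?E = "flow A t" and ?F = "\<lambda>j. hpart j f"
  let ?n = "real CARD('n)"
  obtain M where M: "M \<ge> 0" "\<And>z. z \<in> ball 0 (1/2) \<Longrightarrow> norm (f z) \<le> M" "holomorphic_map_on f (ball 0 (1/2))"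
    using S_hat_local_data[OF f, of "1/2"] by auto
  have half: "(1/2::real) > 0" by simp
  define K where "K = Suc (Suc k)"
  define C1 where "C1 = ?n * ((real K + 1) * M * 2 ^ K)"
  have C1: "C1 \<ge> 0" using M by (simp add: C1_def)
  have rem: "norm (f x - (\<Sum>j<K. ?F j x)) \<le> C1 * norm x ^ K" if "norm x < 1/2" for x
    using hpart_remainder[OF M(3) half M(2), of x K] that
    by (simp add: C1_def power_mult_distrib mult_ac)
  have Tv: "norm (?v x) \<le> 1" if "x \<in> ball 0 1" for x using T(1)[OF that] by simp
  have vE: "norm (?v x - ?E *v x) \<le> ?n * (3 * norm x ^ 2)" if "norm x < 1" for x
  proof -
    have one: "(1::real) > 0" by simp
    have "norm (?v x - (\<Sum>j<2. hpart j ?v x)) \<le> ?n * ((real 2 + 1) * 1 * (norm x / 1) ^ 2)"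
      by (rule hpart_remainder[OF T(4) one Tv]) (use that in auto)
    moreover have "(\<Sum>j<2. hpart j ?v x) = ?E *v x"
      using hpart_0[OF T(4) one Tv] hpart_1[OF T(4) one Tv] T(3,5)
      by (simp add: numeral_2_eq_2)
    ultimately show ?thesis by simp
  qed
  define L where "L = ?n * (M * 4 ^ Suc k)"
  have lip: "norm (?F (Suc k) x - ?F (Suc k) y) \<le> L * norm (x - y)" if "x \<in> cball 0 1" "y \<in> cball 0 1" for x y
  proof -
    have "norm (?F (Suc k) x - ?F (Suc k) y) \<le> L / (2 - 1) * norm (x - y)"
    proof (rule holomorphic_map_lipschitz[where \<rho> = 2 and r = 1])
      show "holomorphic_map_on (?F (Suc k)) (ball 0 2)"
        by (rule holomorphic_map_on_subset[OF holomorphic_hpart[OF M(3) half M(2)] subset_UNIV])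
      fix z :: "complex^'n" assume z: "z \<in> ball 0 2"
      have "norm (?F (Suc k) z) \<le> ?n * (M * (norm z / (1/2)) ^ Suc k)"
        by (rule hpart_bound[OF M(3) half M(2)])
      also have "\<dots> \<le> ?n * (M * 4 ^ Suc k)"
        using z M(1) by (intro mult_left_mono power_mono) auto
      finally show "norm (?F (Suc k) z) \<le> L" by (simp add: L_def)
    qed (use that in auto)
    then show ?thesis by simp
  qed
  have L0: "L \<ge> 0" using M by (simp add: L_def)
  show ?thesis
  proof (rule that[of "C1 + C1 + L * (?n * 3)"])
    fix x :: "complex^'n" assume x: "norm x < 1/2"
    have xb: "x \<in> ball 0 1" using x by simp
    have vx: "norm (?v x) \<le> norm x" by (rule transition_norm_le[OF f t xb])
    have "norm (f (?v x) - (\<Sum>j<K. ?F j (?v x))) \<le> C1 * norm (?v x) ^ K"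
      by (rule rem) (use vx x in simp)
    also have "\<dots> \<le> C1 * norm x ^ K" by (intro mult_left_mono power_mono vx C1) auto
    finally have 1: "norm (f (?v x) - (\<Sum>j<K. ?F j (?v x))) \<le> C1 * norm x ^ K" .
    have "norm (?E *v (f x - (\<Sum>j<K. ?F j x))) \<le> C1 * norm x ^ K"
      by (rule order_trans[OF flow_contraction[OF A t] rem[OF x]])
    moreover have lin: "?E *v (\<Sum>j<K. ?F j x) = (\<Sum>j<K. ?E *v ?F j x)"
      by (rule linear_sum) (rule bounded_linear.linear[OF matrix_vector_mul_bounded_linear])
    ultimately have 2: "norm (?E *v f x - (\<Sum>j<K. ?E *v ?F j x)) \<le> C1 * norm x ^ K"
      by (simp add: matrix_vector_mult_diff_distrib)
    have "norm (?F (Suc k) (?v x) - ?F (Suc k) (?E *v x)) \<le> L * norm x ^ k * norm (?v x - ?E *v x)"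
      by (rule homogeneous_lipschitz[OF hpart_homogeneous[OF M(3) half M(2)] lip vx flow_contraction[OF A t]])
    also have "\<dots> \<le> L * norm x ^ k * (?n * (3 * norm x ^ 2))"
      by (intro mult_left_mono vE) (use x L0 in auto)
    also have "\<dots> = L * (?n * 3) * norm x ^ K"
      by (simp add: K_def power2_eq_square)
    finally have 3: "norm (?F (Suc k) (?v x) - ?F (Suc k) (?E *v x)) \<le> L * (?n * 3) * norm x ^ K" .
    have eq: "(\<Sum>j<Suc k. ?F j (?v x)) - (\<Sum>j<K. ?E *v ?F j x) + ?F (Suc k) (?E *v x) =
       (?E *v f x - (\<Sum>j<K. ?E *v ?F j x)) - (f (?v x) - (\<Sum>j<K. ?F j (?v x)))
       - (?F (Suc k) (?v x) - ?F (Suc k) (?E *v x))"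
      by (simp add: T(2)[OF xb] K_def)
    have tri: "norm (a - b - c) \<le> norm a + norm b + norm c" for a b c :: "complex^'n"
      using norm_triangle_ineq4[of "a - b" c] norm_triangle_ineq4[of a b] by linarith
    have "norm ((\<Sum>j<Suc k. ?F j (?v x)) - (\<Sum>j<K. ?E *v ?F j x) + ?F (Suc k) (?E *v x)) \<le>
       norm (?E *v f x - (\<Sum>j<K. ?E *v ?F j x)) + norm (f (?v x) - (\<Sum>j<K. ?F j (?v x)))
       + norm (?F (Suc k) (?v x) - ?F (Suc k) (?E *v x))"
      unfolding eq by (rule tri)
    also have "\<dots> \<le> (C1 + C1 + L * (?n * 3)) * norm x ^ K"
      using 1 2 3 by (simp add: distrib_right)
    finally show "norm ((\<Sum>j<Suc k. ?F j (?v x)) - (\<Sum>j<Suc (Suc k). ?E *v ?F j x) + ?F (Suc k) (?E *v x))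
       \<le> (C1 + C1 + L * (?n * 3)) * norm x ^ Suc (Suc k)" by (simp add: K_def)
  qed
qed

text \<open>The commutator with the flow is the coefficient of order \<open>k + 1\<close> of the bounded function
  \<open>\<zeta> \<mapsto> \<Sum>\<^sub>j\<^sub>\<le>\<^sub>k F\<^sub>j (v (\<zeta> z))\<close>, where \<open>F\<^sub>j\<close> are the homogeneous parts of \<open>f\<close> and \<open>v\<close> is the
  transition map.\<close>

lemma hpart_commutator_bound:
  assumes f: "f \<in> S_hat A" and t: "t \<ge> 0" and z: "norm z \<le> 1"
    and B: "\<And>j x. j < Suc k \<Longrightarrow> norm x \<le> 1 \<Longrightarrow> norm (hpart j f x) \<le> B j"
  shows "norm (flow A t *v hpart (Suc k) f z - hpart (Suc k) f (flow A t *v z)) \<le> (\<Sum>j<Suc k. B j)"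
proof -
  note T = transition[OF f t]
  let ?v = "transition A t f" and ?E = "flow A t" and ?F = "\<lambda>j. hpart j f"
  obtain M where M: "M \<ge> 0" "\<And>z. z \<in> ball 0 (1/2) \<Longrightarrow> norm (f z) \<le> M" "holomorphic_map_on f (ball 0 (1/2))"
    using S_hat_local_data[OF f, of "1/2"] by auto
  have half: "(1/2::real) > 0" by simp
  note hom = hpart_homogeneous[OF M(3) half M(2)]
  define e where "e = ?E *v ?F (Suc k) z - ?F (Suc k) (?E *v z)"
  define S where "S = (\<Sum>j<Suc k. B j)"
  \<comment> \<open>These are the coefficients along the line through \<open>z\<close>, paired with
    \<open>e\<close>. At order k + 1 the commutator \<open>e\<close> itself appears, so pairing
    gives <e, e>.\<close>
  define c where "c = (\<lambda>j. if j = Suc k then cinner e e else cinner (?E *v ?F j z) e)"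
  obtain C where C: "\<And>x. norm x < 1/2 \<Longrightarrow>
    norm ((\<Sum>j<Suc k. ?F j (?v x)) - (\<Sum>j<Suc (Suc k). ?E *v ?F j x) + ?F (Suc k) (?E *v x)) \<le> C * norm x ^ Suc (Suc k)"
    using transition_expansion[OF f t, of k] by blast
  define P where "P = (\<lambda>x. \<Sum>j<Suc k. ?F j (?v x))"
  have P: "holomorphic_map_on P (ball 0 1)"
    unfolding P_def
    by (intro holomorphic_map_on_sum holomorphic_map_compose[OF holomorphic_hpart[OF M(3) half M(2)] T(4)]) auto
  have inb: "0 + \<zeta> *s z \<in> ball 0 1" if "\<zeta> \<in> ball 0 1" for \<zeta>
  proof -
    have "cmod \<zeta> * norm z \<le> cmod \<zeta> * 1" using z by (intro mult_left_mono) auto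
    then show ?thesis using that by (simp add: norm_smult)
  qed
  have Ple: "norm (P x) \<le> S" if "x \<in> ball 0 1" for x
    unfolding P_def S_def by (rule sum_norm_le, rule B) (use T(1)[OF that] in auto)
  have "cmod (c (Suc k)) \<le> S * norm e"
  proof (rule expansion_coeff_bound[where g = "\<lambda>\<zeta>. cinner (P (0 + \<zeta> *s z)) e" and k = "Suc (Suc k)" and \<delta> = "1/2" and C = "\<bar>C\<bar> * norm e"])
    show "(\<lambda>\<zeta>. cinner (P (0 + \<zeta> *s z)) e) holomorphic_on ball 0 1"
      by (rule line_hol_slice[OF line_hol_cinner[OF P open_ball] inb])
    show "cmod (cinner (P (0 + \<zeta> *s z)) e) \<le> S * norm e" if "\<zeta> \<in> ball 0 1" for \<zeta>
      by (rule order_trans[OF norm_cinner_le mult_right_mono[OF Ple[OF inb[OF that]]]]) simp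
    fix \<zeta> :: complex assume "norm \<zeta> < 1/2"
    have nz: "norm (\<zeta> *s z) \<le> norm \<zeta>"
      using mult_left_mono[OF z, of "norm \<zeta>"] by (simp add: norm_smult)
    have "norm ((\<Sum>j<Suc k. ?F j (?v (\<zeta> *s z))) - (\<Sum>j<Suc (Suc k). ?E *v ?F j (\<zeta> *s z)) + ?F (Suc k) (?E *v (\<zeta> *s z)))
        \<le> C * norm (\<zeta> *s z) ^ Suc (Suc k)"
      by (rule C) (use nz \<open>norm \<zeta> < 1/2\<close> in simp)
    also have "\<dots> \<le> \<bar>C\<bar> * norm \<zeta> ^ Suc (Suc k)"
      by (intro mult_mono power_mono nz) auto
    finally have b: "norm ((\<Sum>j<Suc k. ?F j (?v (\<zeta> *s z))) - (\<Sum>j<Suc (Suc k). ?E *v ?F j (\<zeta> *s z)) + ?F (Suc k) (?E *v (\<zeta> *s z)))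
        \<le> \<bar>C\<bar> * norm \<zeta> ^ Suc (Suc k)" .
    have e1: "(\<Sum>j<Suc (Suc k). ?E *v ?F j (\<zeta> *s z)) - ?F (Suc k) (?E *v (\<zeta> *s z))
       = (\<Sum>j<Suc k. \<zeta> ^ j *s (?E *v ?F j z)) + \<zeta> ^ Suc k *s e"
    proof -
      have "?F j (\<zeta> *s x) = \<zeta> ^ j *s ?F j x" for j x by (rule hom)
      then show ?thesis by (simp add: vector_scalar_commute e_def vector_ssub_ldistrib)
    qed
    have lin: "cinner (\<Sum>j\<in>I. X j) e = (\<Sum>j\<in>I. cinner (X j) e)" for I and X :: "nat \<Rightarrow> complex^'n"
      by (rule linear_sum) (rule bounded_linear.linear[OF bounded_linear_cinner])
    have add: "cinner (x + y) e = cinner x e + cinner y e" "cinner (x - y) e = cinner x e - cinner y e" for x y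
      by (simp_all add: cinner_def distrib_right left_diff_distrib sum.distrib sum_subtractf)
    have "(\<Sum>j<Suc (Suc k). c j * \<zeta> ^ j) = (\<Sum>j<Suc k. c j * \<zeta> ^ j) + c (Suc k) * \<zeta> ^ Suc k" by simp
    also have "(\<Sum>j<Suc k. c j * \<zeta> ^ j) = (\<Sum>j<Suc k. cinner (\<zeta> ^ j *s (?E *v ?F j z)) e)"
      by (rule sum.cong) (auto simp: c_def cinner_smult)
    also have "c (Suc k) * \<zeta> ^ Suc k = cinner (\<zeta> ^ Suc k *s e) e" by (simp only: c_def cinner_smult if_True simp_thms mult.commute)
    finally have "(\<Sum>j<Suc (Suc k). c j * \<zeta> ^ j) =
        cinner ((\<Sum>j<Suc (Suc k). ?E *v ?F j (\<zeta> *s z)) - ?F (Suc k) (?E *v (\<zeta> *s z))) e"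
      unfolding e1 add lin .
    then have "cinner (P (0 + \<zeta> *s z)) e - (\<Sum>j<Suc (Suc k). c j * \<zeta> ^ j) =
        cinner ((\<Sum>j<Suc k. ?F j (?v (\<zeta> *s z))) - (\<Sum>j<Suc (Suc k). ?E *v ?F j (\<zeta> *s z)) + ?F (Suc k) (?E *v (\<zeta> *s z))) e"
      by (simp only: add P_def add_0_left) (simp only: algebra_simps)
    then have "cmod (cinner (P (0 + \<zeta> *s z)) e - (\<Sum>j<Suc (Suc k). c j * \<zeta> ^ j)) \<le> (\<bar>C\<bar> * norm \<zeta> ^ Suc (Suc k)) * norm e"
      using order_trans[OF norm_cinner_le mult_right_mono[OF b norm_ge_zero]] by simp
    then show "cmod (cinner (P (0 + \<zeta> *s z)) e - (\<Sum>j<Suc (Suc k). c j * \<zeta> ^ j)) \<le> \<bar>C\<bar> * norm e * norm \<zeta> ^ Suc (Suc k)"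
      by (simp only: mult_ac)
  qed auto
  then have "(norm e)\<^sup>2 \<le> S * norm e" using norm_cinner_self_ge[of e] by (simp add: c_def)
  moreover have "S \<ge> 0" using order_trans[OF norm_ge_zero Ple[of 0]] by simp
  ultimately have "norm e \<le> S" using norm_le_from_square[of "norm e" S] by simp
  then show ?thesis by (simp add: e_def S_def)
qed

end

section \<open>Uniform bounds for the class\<close>

lemma homogeneous_norm_le:
  fixes Q :: "complex^'n \<Rightarrow> complex^'n"
  assumes hom: "\<And>c z. Q (c *s z) = c ^ k *s Q z" and N: "\<And>z. norm z \<le> 1 \<Longrightarrow> norm (Q z) \<le> N"
  shows "norm (Q z) \<le> N * norm z ^ k"
proof (cases "z = 0")
  case True
  then show ?thesis using hom[of 0 z] N[of 0] by (cases "k = 0") (auto simp: norm_smult zero_power)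
next
  case False
  have eq: "z = of_real (norm z) *s (inverse (norm z) *\<^sub>R z)" using False by (simp add: smult_of_real)
  have "norm (Q z) = norm z ^ k * norm (Q (inverse (norm z) *\<^sub>R z))"
    by (subst eq, subst hom) (simp add: norm_smult norm_power)
  also have "\<dots> \<le> norm z ^ k * N" by (intro mult_left_mono N) (use False in auto)
  finally show ?thesis by (simp add: mult.commute)
qed

context pos_generator begin

lemma hpart_facts:
  assumes f: "f \<in> S_hat A"
  shows "hpart k f (c *s z) = c ^ k *s hpart k f z" "holomorphic_map_on (hpart k f) UNIV"
    "r < 1 \<Longrightarrow> r > 0 \<Longrightarrow> \<exists>C\<ge>0. \<forall>z \<in> ball 0 r. norm (f z - (\<Sum>j<k. hpart j f z)) \<le> C * norm z ^ k"
proof -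
  obtain M where M: "M \<ge> 0" "\<And>z. z \<in> ball 0 (1/2) \<Longrightarrow> norm (f z) \<le> M" "holomorphic_map_on f (ball 0 (1/2))"
    using S_hat_local_data[OF f, of "1/2"] by auto
  have half: "(1/2::real) > 0" by simp
  show "hpart k f (c *s z) = c ^ k *s hpart k f z" by (rule hpart_homogeneous[OF M(3) half M(2)])
  show "holomorphic_map_on (hpart k f) UNIV" by (rule holomorphic_hpart[OF M(3) half M(2)])
  assume r: "r < 1" "r > 0"
  obtain M where M: "M \<ge> 0" "\<And>z. z \<in> ball 0 r \<Longrightarrow> norm (f z) \<le> M" "holomorphic_map_on f (ball 0 r)"
    using S_hat_local_data[OF f r] by auto
  show "\<exists>C\<ge>0. \<forall>z \<in> ball 0 r. norm (f z - (\<Sum>j<k. hpart j f z)) \<le> C * norm z ^ k"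
  proof (intro exI conjI ballI)
    fix z assume "z \<in> ball (0::complex^'n) r"
    then show "norm (f z - (\<Sum>j<k. hpart j f z)) \<le> (real CARD('n) * ((real k + 1) * M / r ^ k)) * norm z ^ k"
      using hpart_remainder[OF M(3) r(2) M(2), of z k] by (simp add: power_divide)
  qed (use M r in auto)
qed

text \<open>Dividing by the maximum over the closed unit ball, attained at \<open>x\<close>,
  produces maps of norm exactly 1, whose limits therefore cannot vanish.\<close>

lemma hpart_normalized_exists:
  assumes f: "f \<in> S_hat A" and "norm (hpart k f z) > C * norm z ^ k"
  obtains N x where "N > C" "norm x \<le> 1" "norm (hpart k f x) = N"
    "\<And>y. norm (hpart k f y) \<le> N * norm y ^ k"
proof -
  have "continuous_on (cball 0 1) (\<lambda>x. norm (hpart k f x))"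
    by (intro continuous_on_norm continuous_on_subset[OF holomorphic_map_on_continuous[OF hpart_facts(2)[OF f]]]) simp
  then obtain x where x: "x \<in> cball 0 1" "\<And>y. y \<in> cball 0 1 \<Longrightarrow> norm (hpart k f y) \<le> norm (hpart k f x)"
    using continuous_attains_sup[of "cball 0 1" "\<lambda>x. norm (hpart k f x)"] by auto
  have le: "norm (hpart k f y) \<le> norm (hpart k f x) * norm y ^ k" for y
    by (rule homogeneous_norm_le[OF hpart_facts(1)[OF f]]) (use x in simp)
  have "C * norm z ^ k < norm (hpart k f x) * norm z ^ k" using assms(2) le[of z] by linarith
  then have "norm (hpart k f x) > C" by (metis mult_right_mono norm_ge_zero zero_le_power not_le)
  then show ?thesis using that[of "norm (hpart k f x)" x] x le by simp
qed

text \<open>If the homogeneous parts of order \<open>k\<close> were unbounded over the class, then a limit of the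
  normalized ones would be a nonzero homogeneous map commuting with the flow.\<close>

lemma hpart_uniform_bound:
  assumes "nonresonant A"
  shows "\<exists>C\<ge>0. \<forall>f\<in>S_hat A. \<forall>z. norm (hpart k f z) \<le> C * norm z ^ k"
proof (induction k rule: less_induct)
  case (less k)
  \<comment> \<open>Orders 0 and 1 are fixed by the normalization of the class; nonresonance enters
    from order 2 on.\<close>
  consider "k = 0" | "k = Suc 0" | "k \<ge> 2" by linarith
  then show ?case
  proof cases
    case 1
    then show ?thesis using S_hat_hpart_low(1) by (intro exI[of _ 0]) simp
  next
    case 2
    then show ?thesis using S_hat_hpart_low(2) by (intro exI[of _ 1]) simp
  next
    case 3
    then obtain k' where k': "k = Suc k'" by (cases k) auto
    have "\<forall>j\<in>{..<k}. \<exists>C. 0 \<le> C \<and> (\<forall>f\<in>S_hat A. \<forall>z. norm (hpart j f z) \<le> C * norm z ^ j)"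
      using less by blast
    then obtain B where B: "\<And>j. j < k \<Longrightarrow> B j \<ge> 0"
      "\<And>j f z. j < k \<Longrightarrow> f \<in> S_hat A \<Longrightarrow> norm (hpart j f z) \<le> B j * norm z ^ j"
      unfolding bchoice_iff by blast
    define S where "S = (\<Sum>j<k. B j)"
    have S0: "S \<ge> 0" unfolding S_def by (intro sum_nonneg) (use B(1) in auto)
    \<comment> \<open>The bound involves only lower orders and is uniform in f and t, so division by
      \<open>N n\<close> > n makes the commutators of the normalized parts tend to 0.\<close>
    have comm: "norm (flow A t *v hpart k f z - hpart k f (flow A t *v z)) \<le> S"
      if f: "f \<in> S_hat A" and "t \<ge> 0" "norm z \<le> 1" for f t z
      unfolding S_def k'
    proof (rule hpart_commutator_bound[OF that])
      fix j and x :: "complex^'n" assume j: "j < Suc k'" and x: "norm x \<le> 1"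
      have "norm (hpart j f x) \<le> B j * norm x ^ j" using B(2) j k' f by blast
      also have "\<dots> \<le> B j * 1" using B(1)[of j] j k' x by (intro mult_left_mono power_le_one) auto
      finally show "norm (hpart j f x) \<le> B j" by simp
    qed
    show ?thesis
    proof (rule ccontr)
      assume neg: "\<not> ?thesis"
      have "\<exists>f N x. f \<in> S_hat A \<and> N > real n \<and> norm x \<le> 1 \<and> norm (hpart k f x) = N \<and>
          (\<forall>y. norm (hpart k f y) \<le> N * norm y ^ k)" for n
      proof -
        obtain f z where f: "f \<in> S_hat A" and "norm (hpart k f z) > real n * norm z ^ k"
          using neg by (metis not_le of_nat_0_le_iff)
        from hpart_normalized_exists[OF this] obtain N x where "N > real n" "norm x \<le> 1"
          "norm (hpart k f x) = N" "\<And>y. norm (hpart k f y) \<le> N * norm y ^ k" by metis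
        with f show ?thesis by blast
      qed
      then obtain f N x where f: "\<And>n. f n \<in> S_hat A" and N: "\<And>n. N n > real n"
        and x: "\<And>n. norm (x n) \<le> 1" "\<And>n. norm (hpart k (f n) (x n)) = N n"
        and le: "\<And>n y. norm (hpart k (f n) y) \<le> N n * norm y ^ k"
        by metis
      have Np: "N n > 0" for n using N[of n] of_nat_0_le_iff[of n] by linarith
      define q where "q = (\<lambda>n z. inverse (N n) *\<^sub>R hpart k (f n) z)"
      have q_hom: "q n (c *s z) = c ^ k *s q n z" for n c z
        using hpart_facts(1)[OF f] by (simp add: q_def vec_eq_iff)
      have q_le: "norm (q n z) \<le> norm z ^ k" for n z
        using le[of n z] Np[of n] by (simp add: q_def field_simps)
      have q_x: "norm (q n (x n)) = 1" for n using x(2)[of n] Np[of n] by (simp add: q_def)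
      have q_hol: "holomorphic_map_on (q n) UNIV" for n
      proof -
        have "holomorphic_map_on (\<lambda>z. (inverse (N n) *\<^sub>R mat 1) *v hpart k (f n) z) UNIV"
          by (rule holomorphic_map_on_matrix[OF hpart_facts(2)[OF f]])
        then show ?thesis by (simp add: q_def scaleR_matrix_vector matrix_vector_mul_lid)
      qed
      have q_lip: "norm (q n a - q n b) \<le> 2 ^ k * norm (a - b)" if "a \<in> cball 0 1" "b \<in> cball 0 1" for n a b
      proof -
        have "norm (q n a - q n b) \<le> 2 ^ k / (2 - 1) * norm (a - b)"
        proof (rule holomorphic_map_lipschitz[where \<rho> = 2 and r = 1])
          show "holomorphic_map_on (q n) (ball 0 2)" by (rule holomorphic_map_on_subset[OF q_hol subset_UNIV])
          show "norm (q n y) \<le> 2 ^ k" if "y \<in> ball 0 2" for y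
            by (rule order_trans[OF q_le power_mono]) (use that in auto)
        qed (use that in auto)
        then show ?thesis by simp
      qed
      have bnd: "norm (q n z) \<le> 1" if "z \<in> cball 0 1" for n z
        by (rule order_trans[OF q_le power_le_one]) (use that in auto)
      have equi: "\<exists>d>0. \<forall>n y. y \<in> cball 0 1 \<and> norm (z - y) < d \<longrightarrow> norm (q n z - q n y) < e"
        if z: "z \<in> cball 0 1" and e: "0 < e" for z e
      proof (intro exI[of _ "e / 2 ^ k"] conjI allI impI)
        fix n y assume y: "y \<in> cball 0 1 \<and> norm (z - y) < e / 2 ^ k"
        have "norm (q n z - q n y) \<le> 2 ^ k * norm (z - y)" by (rule q_lip) (use z y in auto)
        also have "\<dots> < e" using y by (simp add: field_simps)
        finally show "norm (q n z - q n y) < e" .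
      qed (use e in simp)
      have "\<exists>g r. strict_mono (r :: nat \<Rightarrow> nat) \<and>
          (\<forall>e>0. \<exists>n0. \<forall>n z. n \<ge> n0 \<and> z \<in> cball 0 1 \<longrightarrow> norm (q (r n) z - g z) < e)"
      proof (rule Arzela_Ascoli[OF compact_cball bnd equi])
        fix g and r :: "nat \<Rightarrow> nat"
        assume "strict_mono r" "\<And>e. 0 < e \<Longrightarrow> \<exists>n0. \<forall>n z. n0 \<le> n \<and> z \<in> cball 0 1 \<longrightarrow> norm (q (r n) z - g z) < e"
        then show ?thesis by blast
      qed
      then obtain g and r :: "nat \<Rightarrow> nat" where r: "strict_mono r"
        and g: "\<And>e. 0 < e \<Longrightarrow> \<exists>n0. \<forall>n z. n \<ge> n0 \<and> z \<in> cball 0 1 \<longrightarrow> norm (q (r n) z - g z) < e"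
        by blast
      \<comment> \<open>The limit \<open>g\<close> is known on the closed unit ball only; its
        homogeneous extension \<open>Q\<close> is approximated uniformly on every bounded
        set.\<close>
      define Q where "Q = (\<lambda>z. if z = 0 then 0 else of_real (norm z) ^ k *s g (inverse (norm z) *\<^sub>R z))"
      have q_err: "norm (q (r n) z - Q z) \<le> norm z ^ k * e"
        if n: "\<And>z. z \<in> cball 0 1 \<Longrightarrow> norm (q (r n) z - g z) < e" for n e z
      proof (cases "z = 0")
        case True
        have "e > 0" using n[of 0] norm_ge_zero by (smt (verit) centre_in_cball)
        moreover have "q (r n) 0 = 0" using q_hom[of "r n" 0 0] \<open>k \<ge> 2\<close> by (simp add: zero_power)
        ultimately show ?thesis using True by (simp add: Q_def)
      next
        case False
        let ?u = "inverse (norm z) *\<^sub>R z"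
        have "q (r n) z = of_real (norm z) ^ k *s q (r n) ?u"
          using q_hom[of "r n" "of_real (norm z)" ?u] False by (simp add: smult_of_real)
        then have "q (r n) z - Q z = of_real (norm z) ^ k *s (q (r n) ?u - g ?u)"
          using False by (simp add: Q_def vector_ssub_ldistrib)
        then have "norm (q (r n) z - Q z) = norm z ^ k * norm (q (r n) ?u - g ?u)"
          by (simp only: norm_smult norm_power norm_of_real abs_norm_cancel)
        also have "\<dots> \<le> norm z ^ k * e"
          by (intro mult_left_mono less_imp_le[OF n]) (use False in auto)
        finally show ?thesis .
      qed
      have unif: "eventually (\<lambda>n. \<forall>z. norm z \<le> R \<longrightarrow> norm (q (r n) z - Q z) < e) sequentially"
        if "R > 0" "e > 0" for R e
      proof -
        have "e / (2 * R ^ k) > 0" using that by simp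
        from g[OF this] obtain n0 where
          n0: "\<And>n z. n \<ge> n0 \<Longrightarrow> z \<in> cball 0 1 \<Longrightarrow> norm (q (r n) z - g z) < e / (2 * R ^ k)" by blast
        show ?thesis
        proof (rule eventually_sequentiallyI[of n0], intro allI impI)
          fix n and z :: "complex^'n" assume n: "n0 \<le> n" and z: "norm z \<le> R"
          have "norm (q (r n) z - Q z) \<le> norm z ^ k * (e / (2 * R ^ k))" by (rule q_err) (rule n0[OF n])
          also have "\<dots> \<le> R ^ k * (e / (2 * R ^ k))"
            using z that by (intro mult_right_mono power_mono) auto
          also have "\<dots> = e / 2" using that by simp
          finally show "norm (q (r n) z - Q z) < e" using that by simp
        qed
      qed
      have ptw: "(\<lambda>n. q (r n) z) \<longlonglongrightarrow> Q z" for z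
      proof (rule tendstoI)
        fix e :: real assume "e > 0"
        have "norm z + 1 > 0" using norm_ge_zero[of z] by linarith
        from unif[OF this \<open>e > 0\<close>] show "eventually (\<lambda>n. dist (q (r n) z) (Q z) < e) sequentially"
          by (rule eventually_mono) (simp add: dist_norm)
      qed
      have Qhom: "Q (c *s z) = c ^ k *s Q z" for c z
      proof -
        have "(\<lambda>n. q (r n) (c *s z)) \<longlonglongrightarrow> c ^ k *s Q z"
          unfolding q_hom by (intro tendsto_intros ptw)
        then show ?thesis using ptw LIMSEQ_unique by blast
      qed
      have "Q z = 0" for z
      proof (rule nonresonant_equivariant_eq_0[where Q = Q, OF \<open>nonresonant A\<close> _ _ \<open>k \<ge> 2\<close>])
        fix i
        show "line_hol (\<lambda>z. Q z $ i) UNIV"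
        proof (rule line_hol_uniform_limit[OF open_UNIV, where F = "\<lambda>n z. q (r n) z $ i" and G = "\<lambda>z. Q z $ i"])
          fix z :: "complex^'n"
          have lq: "line_hol (\<lambda>z. q (r n) z $ i) (ball z 1)" for n
            using holomorphic_map_on_subset[OF q_hol subset_UNIV, of "r n" "ball z 1"]
            by (simp add: holomorphic_map_on_iff_line_hol)
          have "uniform_limit (ball z 1) (\<lambda>n z. q (r n) z $ i) (\<lambda>z. Q z $ i) sequentially"
          proof (rule uniform_limitI)
            fix e :: real assume "e > 0"
            have "norm z + 1 > 0" using norm_ge_zero[of z] by linarith
            from unif[OF this \<open>e > 0\<close>]
            show "eventually (\<lambda>n. \<forall>y\<in>ball z 1. dist (q (r n) y $ i) (Q y $ i) < e) sequentially"
            proof eventually_elim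
              case (elim n)
              show ?case
              proof
                fix y assume "y \<in> ball z 1"
                then have "norm y \<le> norm z + 1" using dist_triangle[of 0 y z] by simp
                then have "norm (q (r n) y - Q y) < e" using elim by blast
                then show "dist (q (r n) y $ i) (Q y $ i) < e"
                  using Finite_Cartesian_Product.norm_nth_le[of "q (r n) y - Q y" i]
                  by (simp add: dist_norm)
              qed
            qed
          qed
          with lq show "\<exists>r'>0. ball z r' \<subseteq> UNIV \<and> (\<forall>n. line_hol (\<lambda>z. q (r n) z $ i) (ball z r')) \<and>
            uniform_limit (ball z r') (\<lambda>n z. q (r n) z $ i) (\<lambda>z. Q z $ i) sequentially"
            by (intro exI[of _ 1]) auto
        qed
      next
        show "Q (c *s z) = c ^ k *s Q z" for c z by (rule Qhom)
      next
        fix t :: real and z :: "complex^'n" assume t: "t \<ge> 0"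
        have small: "Q (flow A t *v z) = flow A t *v Q z" if z: "norm z \<le> 1" for z
        proof -
          have "(\<lambda>n. S * inverse (real (Suc n))) \<longlonglongrightarrow> S * 0"
            by (intro tendsto_intros LIMSEQ_inverse_real_of_nat)
          then have S_lim: "(\<lambda>n. S * inverse (real (Suc n))) \<longlonglongrightarrow> 0" by simp
          have b: "norm (flow A t *v q (r n) z - q (r n) (flow A t *v z)) \<le> S * inverse (real (Suc n)) * 2" if "n \<ge> 1" for n
          proof -
            have "real n \<le> real (r n)" using strict_mono_imp_increasing[OF r, of n] by simp
            then have Nn: "real n \<le> N (r n)" using N[of "r n"] by linarith
            have "flow A t *v q (r n) z - q (r n) (flow A t *v z) =
                inverse (N (r n)) *\<^sub>R (flow A t *v hpart k (f (r n)) z - hpart k (f (r n)) (flow A t *v z))"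
              by (simp add: q_def matrix_vector_scaleR scaleR_diff_right)
            then have "norm (flow A t *v q (r n) z - q (r n) (flow A t *v z)) \<le> inverse (N (r n)) * S"
              using comm[OF f t z] Np[of "r n"] by (simp add: mult_left_mono)
            also have "\<dots> \<le> inverse (real n) * S"
              using Nn that S0 by (intro mult_right_mono le_imp_inverse_le) auto
            also have "inverse (real n) \<le> inverse (real (Suc n)) * 2"
              using that by (simp add: field_simps)
            then have "inverse (real n) * S \<le> (inverse (real (Suc n)) * 2) * S"
              by (rule mult_right_mono) (rule S0)
            finally show ?thesis by (simp add: mult_ac)
          qed
          have "(\<lambda>n. flow A t *v q (r n) z - q (r n) (flow A t *v z)) \<longlonglongrightarrow> 0"
          proof (rule Lim_null_comparison)
            show "eventually (\<lambda>n. norm (flow A t *v q (r n) z - q (r n) (flow A t *v z)) \<le> S * inverse (real (Suc n)) * 2) sequentially"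
              by (rule eventually_sequentiallyI[of 1]) (rule b)
            show "(\<lambda>n. S * inverse (real (Suc n)) * 2) \<longlonglongrightarrow> 0"
              using tendsto_mult_right[OF S_lim, of 2] by simp
          qed
          moreover have "(\<lambda>n. flow A t *v q (r n) z - q (r n) (flow A t *v z)) \<longlonglongrightarrow> flow A t *v Q z - Q (flow A t *v z)"
            by (intro tendsto_diff ptw bounded_linear.tendsto[OF matrix_vector_mul_bounded_linear])
          ultimately have "flow A t *v Q z - Q (flow A t *v z) = 0" using LIMSEQ_unique by blast
          then show ?thesis by simp
        qed
        define s where "s = norm z + 1"
        have s: "s > 0" unfolding s_def using norm_ge_zero[of z] by linarith
        define z' where "z' = inverse s *\<^sub>R z"
        have z': "z = of_real s *s z'" "norm z' \<le> 1"
          using s by (simp_all add: z'_def smult_of_real) (simp add: s_def field_simps)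
        show "Q (flow A t *v z) = flow A t *v Q z"
          unfolding z'(1) using small[OF z'(2)] by (simp only: vector_scalar_commute Qhom)
      qed
      \<comment> \<open>A zero limit makes the normalized parts uniformly small on the unit ball,
        against the value of norm 1 at \<open>x (r n)\<close>.\<close>
      moreover obtain n where "\<And>z. norm z \<le> 1 \<Longrightarrow> norm (q (r n) z - Q z) < 1/2"
        using eventually_happens[OF unif[of 1 "1/2"]] by auto
      ultimately have "norm (q (r n) (x (r n))) < 1/2" using x(1)[of "r n"] by fastforce
      then show False using q_x[of "r n"] by simp
    qed
  qed
qed

section \<open>Local boundedness of the class\<close>

lemma flow_inverse_bound:
  assumes "t \<ge> 0"
  obtains b where "b > 0" "\<And>z. norm z \<le> b * norm (flow A t *v z)"
proof -
  obtain a where "a > 0" "\<And>x::complex^'n. norm (A *v x) \<le> a * norm x" using matrix_bound by blast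
  from flow_norm_ge[OF this(2) assms] show ?thesis by (intro that[of "exp (a * t)"]) auto
qed

text \<open>The Taylor polynomial \<open>P\<close> of degree less than \<open>K\<close> is bounded
  uniformly over the class. The remainder \<open>R\<close> obeys the functional equation up to an
  inhomogeneity \<open>G\<close>, which is at most 2 S and vanishes to order \<open>K\<close>
  because \<open>R\<close> does. Solving for \<open>R\<close> through the inverse of the flow and
  iterating makes the constants that depend on \<open>f\<close> disappear.\<close>

lemma S_hat_bound_half:
  assumes "nonresonant A"
  shows "\<exists>M\<ge>0. \<forall>f\<in>S_hat A. \<forall>z\<in>cball 0 (1/2). norm (f z) \<le> M"
proof -
  have t1: "(1::real) \<ge> 0" by simp
  obtain b where b: "b > 0" "\<And>z. norm z \<le> b * norm (flow A 1 *v z)" using flow_inverse_bound[OF t1] by blast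
  obtain q where q: "0 < q" "q < 1"
    "\<And>f z. f \<in> S_hat A \<Longrightarrow> z \<in> cball 0 (1/2) \<Longrightarrow> norm (transition A 1 f z) \<le> q * norm z"
    using transition_contraction[of "1/2" 1] by auto
  \<comment> \<open>Inverting the flow costs the factor b, while one transition gains q^K on terms
    of order \<open>K\<close>; the product is less than 1/2.\<close>
  obtain K where K: "q ^ K < 1 / (2 * b)"
    using real_arch_pow_inv[of "1 / (2 * b)" q] b q by auto
  have "\<forall>j\<in>{..<K}. \<exists>C. 0 \<le> C \<and> (\<forall>f\<in>S_hat A. \<forall>z. norm (hpart j f z) \<le> C * norm z ^ j)"
    using hpart_uniform_bound[OF assms] by blast
  then obtain B where B: "\<And>j. j < K \<Longrightarrow> B j \<ge> 0"
    "\<And>j f z. j < K \<Longrightarrow> f \<in> S_hat A \<Longrightarrow> norm (hpart j f z) \<le> B j * norm z ^ j"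
    unfolding bchoice_iff by blast
  define S where "S = (\<Sum>j<K. B j)"
  have S0: "S \<ge> 0" unfolding S_def by (intro sum_nonneg) (use B(1) in auto)
  show ?thesis
  proof (intro exI[of _ "S + 4 * b * S"] conjI ballI)
    show "0 \<le> S + 4 * b * S" using S0 b by simp
    fix f z0 assume f: "f \<in> S_hat A" and z0: "z0 \<in> cball (0::complex^'n) (1/2)"
    let ?v = "transition A 1 f" and ?E = "flow A 1"
    note T = transition[OF f t1]
    define P where "P = (\<lambda>z. \<Sum>j<K. hpart j f z)"
    define R where "R = (\<lambda>z. f z - P z)"
    define G where "G = (\<lambda>z. P (?v z) - ?E *v P z)"
    have P: "norm (P z) \<le> S" if "norm z \<le> 1" for z
      unfolding P_def S_def
    proof (rule sum_norm_le)
      fix j assume j: "j \<in> {..<K}"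
      have "norm (hpart j f z) \<le> B j * norm z ^ j" using B(2) j f by blast
      also have "\<dots> \<le> B j * 1" using B(1)[of j] j that by (intro mult_left_mono power_le_one) auto
      finally show "norm (hpart j f z) \<le> B j" by simp
    qed
    have Phol: "holomorphic_map_on P UNIV"
      unfolding P_def by (intro holomorphic_map_on_sum hpart_facts(2)[OF f]) auto
    obtain C where C: "C \<ge> 0" "\<And>z. z \<in> ball 0 (3/4) \<Longrightarrow> norm (R z) \<le> C * norm z ^ K"
      using hpart_facts(3)[OF f, of "3/4" K] by (auto simp: R_def P_def)
    have ER: "?E *v R z = R (?v z) + G z" if "z \<in> ball 0 1" for z
      by (simp add: R_def G_def T(2)[OF that] matrix_vector_mult_diff_distrib)
    have vle: "norm (?v z) \<le> norm z" if "z \<in> ball 0 1" for z by (rule transition_norm_le[OF f t1 that])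
    have G: "norm (G z) \<le> (2 * S) * (norm z / 1) ^ K" if "z \<in> ball 0 1" for z
    proof (rule holomorphic_map_schwarz_order[where \<delta> = "1/2" and C = "2 * C"])
      show "holomorphic_map_on G (ball 0 1)" unfolding G_def
        by (intro holomorphic_map_on_diff holomorphic_map_compose[OF Phol T(4)]
            holomorphic_map_on_matrix holomorphic_map_on_subset[OF Phol]) auto
      show "norm (G x) \<le> 2 * S" if x: "x \<in> ball 0 1" for x
      proof -
        have "norm (G x) \<le> norm (P (?v x)) + norm (?E *v P x)" unfolding G_def by (rule norm_triangle_ineq4)
        also have "\<dots> \<le> S + S"
          using T(1)[OF x] x by (intro add_mono P order_trans[OF flow_contraction[OF A t1] P]) auto
        finally show ?thesis by simp
      qed
      show "norm (G x) \<le> 2 * C * norm x ^ K" if x: "norm x < 1/2" for x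
      proof -
        have xb: "x \<in> ball 0 1" using x by simp
        have "G x = ?E *v R x - R (?v x)" using ER[OF xb] by simp
        then have "norm (G x) \<le> norm (?E *v R x) + norm (R (?v x))" by (metis norm_triangle_ineq4)
        also have "\<dots> \<le> C * norm x ^ K + C * norm (?v x) ^ K"
          using vle[OF xb] x by (intro add_mono C order_trans[OF flow_contraction[OF A t1] C(2)]) auto
        also have "\<dots> \<le> C * norm x ^ K + C * norm x ^ K"
          by (intro add_mono mult_left_mono power_mono vle[OF xb] C) auto
        finally show ?thesis by simp
      qed
    qed (use that in auto)
    \<comment> \<open>The recursion D \<mapsto> D/2 + 2 b S has the fixed point 4 b S, and the
      excess \<open>C\<close>, which depends on \<open>f\<close>, is halved in each step.\<close>
    have iter: "norm (R z) \<le> (4 * b * S + C / 2 ^ n) * norm z ^ K" if "z \<in> cball 0 (1/2)" for n z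
      using that
    proof (induction n arbitrary: z)
      case 0
      have "norm (R z) \<le> C * norm z ^ K" by (rule C) (use 0 in auto)
      also have "\<dots> \<le> (4 * b * S + C / 2 ^ 0) * norm z ^ K"
        using b S0 by (intro mult_right_mono) auto
      finally show ?case .
    next
      case (Suc n)
      let ?D = "4 * b * S + C / 2 ^ n"
      have D0: "?D \<ge> 0" using b S0 C by simp
      have zb: "z \<in> ball 0 1" using Suc.prems by simp
      have "norm (R (?v z)) \<le> ?D * norm (?v z) ^ K"
        by (rule Suc.IH) (use vle[OF zb] Suc.prems in simp)
      also have "\<dots> \<le> ?D * (q * norm z) ^ K"
        by (intro mult_left_mono power_mono q(3)[OF f Suc.prems] D0) auto
      finally have r1: "norm (R (?v z)) \<le> ?D * q ^ K * norm z ^ K" by (simp add: power_mult_distrib)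
      have "norm (R z) \<le> b * norm (?E *v R z)" by (rule b)
      also have "\<dots> \<le> b * (norm (R (?v z)) + norm (G z))"
        unfolding ER[OF zb] by (intro mult_left_mono norm_triangle_ineq) (use b in simp)
      also have "\<dots> \<le> b * (?D * q ^ K * norm z ^ K + 2 * S * norm z ^ K)"
        using r1 G[OF zb] b by (intro mult_left_mono add_mono) auto
      also have "\<dots> = (b * q ^ K * ?D + 2 * b * S) * norm z ^ K" by (simp add: algebra_simps)
      also have "\<dots> \<le> (1/2 * ?D + 2 * b * S) * norm z ^ K"
      proof -
        have "b * q ^ K \<le> 1/2" using K b by (simp add: field_simps)
        then have "b * q ^ K * ?D \<le> 1/2 * ?D" using D0 by (rule mult_right_mono)
        then have "b * q ^ K * ?D + 2 * b * S \<le> 1/2 * ?D + 2 * b * S" by (rule add_right_mono)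
        then show ?thesis by (rule mult_right_mono) simp
      qed
      also have "1/2 * ?D + 2 * b * S = 4 * b * S + C / 2 ^ Suc n" by (simp add: field_simps)
      finally show ?case .
    qed
    have "norm (R z0) \<le> 4 * b * S * norm z0 ^ K"
    proof (rule LIMSEQ_le_const)
      have "(\<lambda>n. (4 * b * S + C * (1/2) ^ n) * norm z0 ^ K) \<longlonglongrightarrow> (4 * b * S + C * 0) * norm z0 ^ K"
        by (intro tendsto_intros LIMSEQ_power_zero) auto
      then show "(\<lambda>n. (4 * b * S + C / 2 ^ n) * norm z0 ^ K) \<longlonglongrightarrow> 4 * b * S * norm z0 ^ K"
        by (simp add: power_divide)
      show "\<exists>n0. \<forall>n\<ge>n0. norm (R z0) \<le> (4 * b * S + C / 2 ^ n) * norm z0 ^ K"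
        using iter[OF z0] by blast
    qed
    also have "\<dots> \<le> 4 * b * S * 1"
      using z0 b S0 by (intro mult_left_mono power_le_one) auto
    finally have "norm (R z0) \<le> 4 * b * S" by simp
    moreover have "norm (f z0) \<le> norm (P z0) + norm (R z0)"
      using norm_triangle_ineq[of "P z0" "R z0"] by (simp add: R_def)
    moreover have "norm (P z0) \<le> S" by (rule P) (use z0 in simp)
    ultimately show "norm (f z0) \<le> S + 4 * b * S" by linarith
  qed
qed

lemma transition_funpow:
  assumes f: "f \<in> S_hat A" and "t \<ge> 0" and z: "z \<in> ball 0 1" "z \<in> cball 0 r" and q: "q > 0" "q \<le> 1"
    and c: "\<And>z. z \<in> cball 0 r \<Longrightarrow> norm (transition A t f z) \<le> q * norm z"
  shows "norm ((transition A t f ^^ n) z) \<le> q ^ n * norm z"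
    and "(transition A t f ^^ n) z \<in> ball 0 1" and "(transition A t f ^^ n) z \<in> cball 0 r"
proof (induction n)
  case 0
  show "norm ((transition A t f ^^ 0) z) \<le> q ^ 0 * norm z" "(transition A t f ^^ 0) z \<in> ball 0 1"
    "(transition A t f ^^ 0) z \<in> cball 0 r" using z by auto
next
  case (Suc n)
  let ?v = "transition A t f"
  let ?y = "(?v ^^ n) z"
  have "norm (?v ?y) \<le> q * norm ?y" by (rule c[OF Suc(3)])
  also have "\<dots> \<le> q * (q ^ n * norm z)" using Suc(1) q by (intro mult_left_mono) auto
  finally show "norm ((?v ^^ Suc n) z) \<le> q ^ Suc n * norm z" by simp
  show "(?v ^^ Suc n) z \<in> ball 0 1" using transition(1)[OF f \<open>t \<ge> 0\<close> Suc(2)] by simp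
  show "(?v ^^ Suc n) z \<in> cball 0 r"
    using transition_norm_le[OF f \<open>t \<ge> 0\<close> Suc(2)] Suc(3) by simp
qed

text \<open>A number N of transitions, the same for all \<open>f\<close>, moves the ball of radius r
  into the half ball; each step back along the functional equation costs the factor b.\<close>

lemma S_hat_locally_bounded:
  assumes "nonresonant A" "r < 1"
  shows "\<exists>M. \<forall>f\<in>S_hat A. \<forall>z\<in>cball 0 r. norm (f z) \<le> M"
proof (cases "r \<ge> 0")
  case True
  have t1: "(1::real) \<ge> 0" by simp
  obtain b where b: "b > 0" "\<And>z. norm z \<le> b * norm (flow A 1 *v z)" using flow_inverse_bound[OF t1] by blast
  obtain q where q: "0 < q" "q < 1"
    "\<And>f z. f \<in> S_hat A \<Longrightarrow> z \<in> cball 0 r \<Longrightarrow> norm (transition A 1 f z) \<le> q * norm z"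
    using transition_contraction[OF \<open>r < 1\<close> True, of 1] by auto
  obtain M where M: "M \<ge> 0" "\<And>f z. f \<in> S_hat A \<Longrightarrow> z \<in> cball 0 (1/2) \<Longrightarrow> norm (f z) \<le> M"
    using S_hat_bound_half[OF assms(1)] by blast
  obtain N where N: "q ^ N < 1/2" using real_arch_pow_inv[of "1/2" q] q by auto
  show ?thesis
  proof (intro exI[of _ "b ^ N * M"] ballI)
    fix f z assume f: "f \<in> S_hat A" and z: "z \<in> cball (0::complex^'n) r"
    let ?v = "transition A 1 f"
    have zb: "z \<in> ball 0 1" using z \<open>r < 1\<close> by simp
    note fp = transition_funpow[OF f t1 zb z q(1) less_imp_le[OF q(2)] q(3)[OF f]]
    have "norm (f z) \<le> b ^ n * norm (f ((?v ^^ n) z))" for n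
    proof (induction n)
      case 0
      then show ?case by simp
    next
      case (Suc n)
      have "norm (f ((?v ^^ n) z)) \<le> b * norm (flow A 1 *v f ((?v ^^ n) z))" by (rule b)
      also have "flow A 1 *v f ((?v ^^ n) z) = f ((?v ^^ Suc n) z)"
        using transition(2)[OF f t1 fp(2)[of n]] by simp
      finally have "b ^ n * norm (f ((?v ^^ n) z)) \<le> b ^ n * (b * norm (f ((?v ^^ Suc n) z)))"
        using b by (intro mult_left_mono) auto
      then show ?case using Suc by (simp add: mult_ac)
    qed
    moreover have "(?v ^^ N) z \<in> cball 0 (1/2)"
    proof -
      have "q ^ N * norm z \<le> (1/2) * 1" using N zb q by (intro mult_mono) auto
      then show ?thesis using fp(1)[of N] by simp
    qed
    ultimately show "norm (f z) \<le> b ^ N * M"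
      using M(2)[OF f] b by (meson mult_left_mono order_trans zero_le_power less_imp_le)
  qed
next
  case False
  then show ?thesis by (intro exI[of _ 0]) auto
qed

section \<open>Lower Lipschitz bounds\<close>

lemma S_hat_quadratic:
  assumes "nonresonant A"
  obtains C where "C > 0" "\<And>f z. f \<in> S_hat A \<Longrightarrow> z \<in> ball 0 (1/2) \<Longrightarrow> norm (f z - z) \<le> C * norm z ^ 2"
proof -
  obtain M where M: "M \<ge> 0" "\<And>f z. f \<in> S_hat A \<Longrightarrow> z \<in> cball 0 (1/2) \<Longrightarrow> norm (f z) \<le> M"
    using S_hat_bound_half[OF assms] by blast
  show ?thesis
  \<comment> \<open>On the half ball f - id is bounded by M + 1, and the Schwarz lemma of order 2
    there divides by the square of 1/2.\<close>
  proof (rule that[of "4 * (M + 1)"])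
    fix f z assume f: "f \<in> S_hat A" and z: "z \<in> ball (0::complex^'n) (1/2)"
    obtain C where C: "\<And>z. z \<in> ball 0 (1/2) \<Longrightarrow> norm (f z - (\<Sum>j<2. hpart j f z)) \<le> C * norm z ^ 2"
    proof -
      have "\<exists>C\<ge>0. \<forall>z\<in>ball 0 (1/2). norm (f z - (\<Sum>j<2. hpart j f z)) \<le> C * norm z ^ 2"
        by (rule hpart_facts(3)[OF f]) auto
      then show ?thesis using that by blast
    qed
    have "norm (f z - z) \<le> (M + 1) * (norm z / (1/2)) ^ 2"
    proof (rule holomorphic_map_schwarz_order[where f = "\<lambda>z. f z - z" and \<delta> = "1/2" and C = C])
      show "holomorphic_map_on (\<lambda>z. f z - z) (ball 0 (1/2))"
        by (intro holomorphic_map_on_diff holomorphic_map_on_id open_ball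
            holomorphic_map_on_subset[OF S_hatD(1)[OF f]]) auto
      show "norm (f w - w) \<le> M + 1" if "w \<in> ball 0 (1/2)" for w
        using norm_triangle_ineq4[of "f w" w] M(2)[OF f, of w] that by simp
      show "norm (f w - w) \<le> C * norm w ^ 2" if "norm w < 1/2" for w
        using C[of w] that S_hat_hpart_low[OF f] by (simp add: numeral_2_eq_2)
    qed (use z in auto)
    then show "norm (f z - z) \<le> 4 * (M + 1) * norm z ^ 2"
      by (simp add: power_mult_distrib algebra_simps)
  qed (use M in auto)
qed

text \<open>On the ball of radius 2 s, the difference f - id is at most 4 C s^2, hence it is
  Lipschitz with constant 4 C s on the ball of radius s; \<open>s\<close> is chosen to make this at
  most 1/2.\<close>

lemma S_hat_lower_lipschitz_origin:
  assumes "nonresonant A"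
  obtains s where "s > 0" "s < 1"
    "\<And>f x y. f \<in> S_hat A \<Longrightarrow> x \<in> cball 0 s \<Longrightarrow> y \<in> cball 0 s \<Longrightarrow> norm (x - y) \<le> 2 * norm (f x - f y)"
proof -
  obtain C where C: "C > 0" "\<And>f z. f \<in> S_hat A \<Longrightarrow> z \<in> ball 0 (1/2) \<Longrightarrow> norm (f z - z) \<le> C * norm z ^ 2"
    using S_hat_quadratic[OF assms] by blast
  define s where "s = 1 / (8 * (C + 1))"
  have s: "s > 0" "s \<le> 1/8" using C(1) by (auto simp: s_def divide_simps)
  have Cs: "4 * C * s \<le> 1/2" using C(1) by (simp add: s_def divide_simps)
  show ?thesis
  proof (rule that[of s])
    fix f and x y :: "complex^'n" assume f: "f \<in> S_hat A" and xy: "x \<in> cball 0 s" "y \<in> cball 0 s"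
    define g where "g = (\<lambda>z. f z - z)"
    have "norm (g x - g y) \<le> (4 * C * s * s) / (2 * s - s) * norm (x - y)"
    proof (rule holomorphic_map_lipschitz[where \<rho> = "2 * s" and r = s])
      show "holomorphic_map_on g (ball 0 (2 * s))" unfolding g_def
        by (intro holomorphic_map_on_diff holomorphic_map_on_id open_ball
            holomorphic_map_on_subset[OF S_hatD(1)[OF f]]) (use s in auto)
      fix z :: "complex^'n" assume z: "z \<in> ball 0 (2 * s)"
      have "norm (g z) \<le> C * norm z ^ 2" unfolding g_def by (rule C(2)[OF f]) (use z s in auto)
      also have "\<dots> \<le> C * (2 * s) ^ 2"
        using z C(1) by (intro mult_left_mono power_mono) auto
      finally show "norm (g z) \<le> 4 * C * s * s" by (simp add: power2_eq_square)
    qed (use s xy in auto)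
    also have "(4 * C * s * s) / (2 * s - s) = 4 * C * s" using s by simp
    also have "4 * C * s * norm (x - y) \<le> 1/2 * norm (x - y)" by (rule mult_right_mono[OF Cs]) simp
    finally have "norm (g x - g y) \<le> 1/2 * norm (x - y)" .
    moreover have "x - y = (f x - f y) - (g x - g y)" by (simp add: g_def)
    then have "norm (x - y) \<le> norm (f x - f y) + norm (g x - g y)" by (metis norm_triangle_ineq4)
    ultimately show "norm (x - y) \<le> 2 * norm (f x - f y)" by simp
  qed (use s in auto)
qed

text \<open>Iterated transitions carry both points into the small ball around 0 where the bound is
  known. Each step shrinks their distance at most by half, while the images under \<open>f\<close>
  only come closer, because the flow contracts.\<close>

lemma S_hat_lower_lipschitz:
  assumes "nonresonant A" "0 \<le> r" "r < 1"
  obtains c where "c > 0"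
    "\<And>f x y. f \<in> S_hat A \<Longrightarrow> x \<in> cball 0 r \<Longrightarrow> y \<in> cball 0 r \<Longrightarrow> norm (x - y) \<le> c * norm (f x - f y)"
proof -
  obtain s where s: "s > 0" "s < 1"
    "\<And>f x y. f \<in> S_hat A \<Longrightarrow> x \<in> cball 0 s \<Longrightarrow> y \<in> cball 0 s \<Longrightarrow> norm (x - y) \<le> 2 * norm (f x - f y)"
    using S_hat_lower_lipschitz_origin[OF assms(1)] by blast
  obtain t where t: "t > 0" "\<And>f x y. f \<in> S_hat A \<Longrightarrow> x \<in> cball 0 r \<Longrightarrow> y \<in> cball 0 r \<Longrightarrow>
       norm (x - y) \<le> 2 * norm (transition A t f x - transition A t f y)"
    using transition_lower_lipschitz[OF assms(2,3)] by blast
  obtain q where q: "0 < q" "q < 1"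
    "\<And>f z. f \<in> S_hat A \<Longrightarrow> z \<in> cball 0 r \<Longrightarrow> norm (transition A t f z) \<le> q * norm z"
    using transition_contraction[OF assms(3,2) t(1)] by blast
  obtain N where N: "q ^ N < s" using real_arch_pow_inv[of s q] q s by auto
  show ?thesis
  proof (rule that[of "2 ^ N * 2"])
    fix f and x y :: "complex^'n" assume f: "f \<in> S_hat A" and x: "x \<in> cball 0 r" and y: "y \<in> cball 0 r"
    let ?v = "transition A t f"
    have t0: "t \<ge> 0" using t by simp
    have b: "x \<in> ball 0 1" "y \<in> ball 0 1" using x y \<open>r < 1\<close> by auto
    note fx = transition_funpow[OF f t0 b(1) x q(1) less_imp_le[OF q(2)] q(3)[OF f]]
    note fy = transition_funpow[OF f t0 b(2) y q(1) less_imp_le[OF q(2)] q(3)[OF f]]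
    have v: "norm (x - y) \<le> 2 ^ n * norm ((?v ^^ n) x - (?v ^^ n) y)" for n
    proof (induction n)
      case 0
      then show ?case by simp
    next
      case (Suc n)
      have "2 ^ n * norm ((?v ^^ n) x - (?v ^^ n) y) \<le> 2 ^ n * (2 * norm (?v ((?v ^^ n) x) - ?v ((?v ^^ n) y)))"
        by (intro mult_left_mono t(2)[OF f fx(3) fy(3)]) auto
      from order_trans[OF Suc this] show ?case by (simp add: mult_ac)
    qed
    have g: "norm (f ((?v ^^ n) x) - f ((?v ^^ n) y)) \<le> norm (f x - f y)" for n
    proof (induction n)
      case 0
      then show ?case by simp
    next
      case (Suc n)
      have "f ((?v ^^ Suc n) x) - f ((?v ^^ Suc n) y) = flow A t *v (f ((?v ^^ n) x) - f ((?v ^^ n) y))"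
        using transition(2)[OF f t0 fx(2)[of n]] transition(2)[OF f t0 fy(2)[of n]]
        by (simp add: matrix_vector_mult_diff_distrib)
      then have "norm (f ((?v ^^ Suc n) x) - f ((?v ^^ Suc n) y)) \<le> norm (f ((?v ^^ n) x) - f ((?v ^^ n) y))"
        using flow_contraction[OF A t0] by simp
      then show ?case using Suc by simp
    qed
    have small: "(?v ^^ N) x \<in> cball 0 s" "(?v ^^ N) y \<in> cball 0 s"
    proof -
      have "q ^ N * norm x \<le> s * 1" "q ^ N * norm y \<le> s * 1" using N b q s by (intro mult_mono; simp)+
      then show "(?v ^^ N) x \<in> cball 0 s" "(?v ^^ N) y \<in> cball 0 s"
        using fx(1)[of N] fy(1)[of N] by auto
    qed
    have "norm (x - y) \<le> 2 ^ N * norm ((?v ^^ N) x - (?v ^^ N) y)" by (rule v)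
    also have "\<dots> \<le> 2 ^ N * (2 * norm (f ((?v ^^ N) x) - f ((?v ^^ N) y)))"
      by (intro mult_left_mono s(3)[OF f small]) auto
    also have "\<dots> \<le> 2 ^ N * (2 * norm (f x - f y))" by (intro mult_left_mono g) auto
    finally show "norm (x - y) \<le> 2 ^ N * 2 * norm (f x - f y)" by simp
  qed simp
qed

end

section \<open>Compactness\<close>

lemma has_derivative_id_quadratic:
  fixes f :: "complex^'n \<Rightarrow> complex^'n"
  assumes "f 0 = 0" "d > 0" "\<And>z. z \<in> ball 0 d \<Longrightarrow> norm (f z - z) \<le> C * norm z ^ 2"
  shows "(f has_derivative (\<lambda>h. h)) (at 0)"
  unfolding has_derivative_at
proof
  show "bounded_linear (\<lambda>h::complex^'n. h)" by (rule bounded_linear_ident)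
  show "((\<lambda>h. norm (f (0 + h) - f 0 - h) / norm h) \<longlongrightarrow> 0) (at 0)"
  proof (rule Lim_null_comparison)
    show "((\<lambda>h. C * norm h) \<longlongrightarrow> 0) (at (0::complex^'n))"
      by (intro tendsto_mult_right_zero tendsto_norm_zero tendsto_ident_at)
    have "eventually (\<lambda>h::complex^'n. h \<in> ball 0 d - {0}) (at 0)"
      using assms(2) eventually_at_in_open[of "ball 0 d" "0::complex^'n"] by simp
    then show "eventually (\<lambda>h. norm (norm (f (0 + h) - f 0 - h) / norm h) \<le> C * norm h) (at 0)"
    proof eventually_elim
      case (elim h)
      then have "norm (f h - h) \<le> C * norm h * norm h" using assms(3)[of h] by (simp add: power2_eq_square mult.assoc)
      then show ?case using elim assms(1) by (simp add: divide_le_eq)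
    qed
  qed
qed

lemma norm_triangle_diff_add:
  fixes a b c :: "'a::real_normed_vector"
  shows "norm (a - b + c) \<le> norm a + norm b + norm c"
  using norm_triangle_ineq[of "a - b" c] norm_triangle_ineq4[of a b] by linarith

lemma tendsto_matrix_vector:
  assumes "(g \<longlongrightarrow> l) F" shows "((\<lambda>x. (M::complex^'n^'n) *v g x) \<longlongrightarrow> M *v l) F"
  using bounded_linear.tendsto[OF matrix_vector_mul_bounded_linear assms] .

context pos_generator begin

text \<open>For spirallikeness of the limit, the points to which the transition maps send
  \<open>z\<close> stay in the closed ball of radius |z|. A cluster point y satisfies g(y) = e^{-tA}
  g(z), so the flow does not leave the image of \<open>g\<close>.\<close>

lemma S_hat_limit:
  assumes nr: "nonresonant A" and f: "\<And>n. f n \<in> S_hat A" and g: "g \<in> extensional (ball 0 1)"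
    and lim: "\<And>r. r < 1 \<Longrightarrow> uniform_limit (cball 0 r) f g sequentially"
  shows "g \<in> S_hat A"
proof -
  have ptw: "(\<lambda>n. f n z) \<longlonglongrightarrow> g z" if "z \<in> ball 0 1" for z
    by (rule tendsto_uniform_limitI[OF lim[of "norm z"]]) (use that in auto)
  have hol: "holomorphic_map_on g (ball 0 1)"
    unfolding holomorphic_map_on_iff_line_hol[OF open_ball]
  proof
    fix i
    show "line_hol (\<lambda>z. g z $ i) (ball 0 1)"
    proof (rule line_hol_uniform_limit[OF open_ball, where F = "\<lambda>n z. f n z $ i" and G = "\<lambda>z. g z $ i"])
      fix z :: "complex^'n" assume z: "z \<in> ball 0 1"
      define r where "r = (1 + norm z) / 2"
      define d where "d = (1 - norm z) / 2"
      have r: "r < 1" "d > 0" using z by (auto simp: r_def d_def)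
      have sub: "ball z d \<subseteq> cball 0 r"
      proof
        fix x assume "x \<in> ball z d"
        then show "x \<in> cball 0 r" using dist_triangle[of 0 x z] by (simp add: r_def d_def field_simps)
      qed
      have "line_hol (\<lambda>z. f n z $ i) (ball z d)" for n
      proof -
        have "holomorphic_map_on (f n) (ball z d)"
          by (rule holomorphic_map_on_subset[OF S_hatD(1)[OF f]]) (use sub r in force)
        then show ?thesis by (simp add: holomorphic_map_on_iff_line_hol)
      qed
      moreover have "uniform_limit (ball z d) (\<lambda>n z. f n z $ i) (\<lambda>z. g z $ i) sequentially"
        by (rule uniform_limit_on_subset[OF bounded_linear.uniform_limit[OF bounded_linear_vec_nth lim[OF r(1)]] sub])
      moreover have "ball z d \<subseteq> ball 0 1" using sub r by force
      ultimately show "\<exists>r>0. ball z r \<subseteq> ball 0 1 \<and> (\<forall>k. line_hol (\<lambda>z. f k z $ i) (ball z r)) \<and>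
          uniform_limit (ball z r) (\<lambda>n z. f n z $ i) (\<lambda>z. g z $ i) sequentially"
        using r(2) by blast
    qed
  qed
  have g0: "g 0 = 0"
    using LIMSEQ_unique[OF ptw[of 0]] S_hatD(3)[OF f] by simp
  have inj: "inj_on g (ball 0 1)"
  proof (rule inj_onI)
    fix x y :: "complex^'n" assume xy: "x \<in> ball 0 1" "y \<in> ball 0 1" "g x = g y"
    define r where "r = max (norm x) (norm y)"
    have r: "0 \<le> r" "r < 1" "x \<in> cball 0 r" "y \<in> cball 0 r" using xy by (auto simp: r_def le_max_iff_disj)
    obtain c where c: "c > 0"
      "\<And>f x y. f \<in> S_hat A \<Longrightarrow> x \<in> cball 0 r \<Longrightarrow> y \<in> cball 0 r \<Longrightarrow> norm (x - y) \<le> c * norm (f x - f y)"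
      using S_hat_lower_lipschitz[OF nr r(1,2)] by blast
    have "(\<lambda>n. c * norm (f n x - f n y)) \<longlonglongrightarrow> c * norm (g x - g y)"
      by (intro tendsto_intros ptw xy)
    then have "norm (x - y) \<le> c * norm (g x - g y)"
      by (rule LIMSEQ_le_const) (use c(2)[OF f r(3,4)] in blast)
    then show "x = y" using xy(3) by simp
  qed
  have der: "(g has_derivative (\<lambda>h. h)) (at 0)"
  proof -
    obtain C where C: "C > 0" "\<And>f z. f \<in> S_hat A \<Longrightarrow> z \<in> ball 0 (1/2) \<Longrightarrow> norm (f z - z) \<le> C * norm z ^ 2"
      using S_hat_quadratic[OF nr] by blast
    show ?thesis
    proof (rule has_derivative_id_quadratic[where d = "1/2" and C = C])
      fix z :: "complex^'n" assume z: "z \<in> ball 0 (1/2)"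
      have "(\<lambda>n. norm (f n z - z)) \<longlonglongrightarrow> norm (g z - z)" by (intro tendsto_intros ptw) (use z in auto)
      then show "norm (g z - z) \<le> C * norm z ^ 2"
        by (rule LIMSEQ_le_const2) (use C(2)[OF f z] in blast)
    qed (use g0 in auto)
  qed
  have contg: "continuous_on (ball 0 1) g" by (rule holomorphic_map_on_continuous[OF hol])
  have "spirallike A (g ` ball 0 1)"
    unfolding spirallike_def
  proof (intro conjI ballI allI impI)
    show "open (g ` ball 0 1)" by (rule invariance_of_domain[OF contg open_ball inj])
    show "connected (g ` ball 0 1)" by (rule connected_continuous_image[OF contg connected_ball])
    show "0 \<in> g ` ball 0 1" by (rule image_eqI[of _ _ 0]) (auto simp: g0)
    fix w and t :: real assume "w \<in> g ` ball 0 1" and t: "t \<ge> 0"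
    then obtain z where z: "z \<in> ball 0 1" "w = g z" by blast
    define v where "v = (\<lambda>n. transition A t (f n) z)"
    have "\<forall>n. v n \<in> cball 0 (norm z)" using transition_norm_le[OF f t z(1)] by (simp add: v_def)
    then obtain y r where y: "y \<in> cball 0 (norm z)" "strict_mono r" "(v \<circ> r) \<longlonglongrightarrow> y"
      using compact_cball[of "0::complex^'n" "norm z"] unfolding compact_def by meson
    have yb: "y \<in> ball 0 1" using y(1) z(1) by simp
    have "(\<lambda>n. g (v (r n))) \<longlonglongrightarrow> g y"
      using isCont_tendsto_compose[OF _ y(3), of g] contg yb
      by (simp add: continuous_on_eq_continuous_at o_def)
    moreover have "(\<lambda>n. f (r n) (v (r n)) - g (v (r n))) \<longlonglongrightarrow> 0"
    proof (rule tendstoI)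
      fix e :: real assume "e > 0"
      have "eventually (\<lambda>n. \<forall>x\<in>cball 0 (norm z). dist (f n x) (g x) < e) sequentially"
        using lim[of "norm z"] z(1) \<open>e > 0\<close> by (simp add: uniform_limit_iff)
      then have "eventually (\<lambda>n. \<forall>x\<in>cball 0 (norm z). dist (f (r n) x) (g x) < e) sequentially"
        using y(2) eventually_subseq by blast
      then show "eventually (\<lambda>n. dist (f (r n) (v (r n)) - g (v (r n))) 0 < e) sequentially"
        by (rule eventually_mono) (use \<open>\<forall>n. v n \<in> cball 0 (norm z)\<close> in \<open>auto simp: dist_norm\<close>)
    qed
    ultimately have "(\<lambda>n. (f (r n) (v (r n)) - g (v (r n))) + g (v (r n))) \<longlonglongrightarrow> 0 + g y"
      by (intro tendsto_add)
    moreover have "f (r n) (v (r n)) = flow A t *v f (r n) z" for n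
      unfolding v_def by (rule transition(2)[OF f t z(1)])
    ultimately have "(\<lambda>n. flow A t *v f (r n) z) \<longlonglongrightarrow> g y" by simp
    moreover have "(\<lambda>n. flow A t *v f (r n) z) \<longlonglongrightarrow> flow A t *v g z"
      using LIMSEQ_subseq_LIMSEQ[OF ptw[OF z(1)] y(2)] by (intro tendsto_matrix_vector) (simp add: o_def)
    ultimately have "flow A t *v g z = g y" using LIMSEQ_unique by blast
    then show "matrix_exp (- (t *\<^sub>R A)) *v w \<in> g ` ball 0 1"
      using yb z(2) by (simp add: flow_def)
  qed
  then show ?thesis
    using hol inj g0 der g by (simp add: S_hat_def S_ball_def holo_ball_def)
qed

section \<open>Equicontinuity, pointwise and locally uniform topology\<close>

lemma S_hat_equilipschitz:
  assumes "nonresonant A" "r < 1"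
  obtains L where "L > 0" "\<And>f. f \<in> S_hat A \<Longrightarrow> L-lipschitz_on (cball 0 r) f"
proof -
  define \<rho> where "\<rho> = (1 + r) / 2"
  have \<rho>: "r < \<rho>" "\<rho> < 1" using \<open>r < 1\<close> by (auto simp: \<rho>_def)
  obtain M where M: "\<forall>f\<in>S_hat A. \<forall>z\<in>cball 0 \<rho>. norm (f z) \<le> M"
    using S_hat_locally_bounded[OF assms(1) \<rho>(2)] by blast
  show ?thesis
  proof (rule that[of "\<bar>M\<bar> / (\<rho> - r) + 1"])
    show L0: "\<bar>M\<bar> / (\<rho> - r) + 1 > 0" using \<rho> by (simp add: add_nonneg_pos)
    fix f assume f: "f \<in> S_hat A"
    show "(\<bar>M\<bar> / (\<rho> - r) + 1)-lipschitz_on (cball 0 r) f"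
    proof (rule lipschitz_onI)
      fix x y :: "complex^'n" assume xy: "x \<in> cball 0 r" "y \<in> cball 0 r"
      have "norm (f x - f y) \<le> \<bar>M\<bar> / (\<rho> - r) * norm (x - y)"
      proof (rule holomorphic_map_lipschitz[OF _ \<rho>(1) _ xy])
        show "holomorphic_map_on f (ball 0 \<rho>)"
          by (rule holomorphic_map_on_subset[OF S_hatD(1)[OF f]]) (use \<rho> in auto)
        show "norm (f z) \<le> \<bar>M\<bar>" if "z \<in> ball 0 \<rho>" for z
        proof -
          have "norm (f z) \<le> M" using M f that by auto
          then show ?thesis by linarith
        qed
      qed
      then show "dist (f x) (f y) \<le> (\<bar>M\<bar> / (\<rho> - r) + 1) * dist x y"
        by (simp add: dist_norm distrib_right add_increasing2)
    qed (use L0 in simp)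
  qed
qed

text \<open>An e/3 argument over a finite net of mesh e / (3 L), whose choice does not depend on the
  two maps.\<close>

lemma lipschitz_net:
  fixes r L e :: real
  assumes "e > 0" "L > 0"
  shows "\<exists>T. finite T \<and> T \<subseteq> cball (0::complex^'n) r \<and>
    (\<forall>g h :: complex^'n \<Rightarrow> complex^'n. L-lipschitz_on (cball 0 r) g \<longrightarrow> L-lipschitz_on (cball 0 r) h \<longrightarrow>
       (\<forall>x\<in>T. norm (g x - h x) < e / 3) \<longrightarrow> (\<forall>x\<in>cball 0 r. norm (g x - h x) < e))"
proof -
  define d where "d = e / (3 * L)"
  have d: "d > 0" using assms by (simp add: d_def)
  obtain T where T: "T \<subseteq> cball (0::complex^'n) r" "finite T" "cball 0 r \<subseteq> (\<Union>x\<in>T. ball x d)"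
    by (rule compactE_image[OF compact_cball, of "cball 0 r" "\<lambda>x. ball x d" 0 r]) (use d in auto)
  show ?thesis
  proof (intro exI[of _ T] conjI allI impI ballI T)
    fix g h :: "complex^'n \<Rightarrow> complex^'n" and x :: "complex^'n"
    assume g: "L-lipschitz_on (cball 0 r) g" and h: "L-lipschitz_on (cball 0 r) h"
      and gh: "\<forall>x\<in>T. norm (g x - h x) < e / 3" and x: "x \<in> cball 0 r"
    obtain y where y: "y \<in> T" "dist y x < d" using T(3) x by auto
    have yr: "y \<in> cball 0 r" using T(1) y(1) by blast
    have "L * dist x y \<le> L * d" using y(2) assms(2) by (intro mult_left_mono) (auto simp: dist_commute)
    also have "L * d = e / 3" using assms by (simp add: d_def)
    finally have Ld: "L * dist x y \<le> e / 3" .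
    have eq: "g x - h x = (g x - g y) - (h x - h y) + (g y - h y)" by simp
    have "norm (g x - h x) \<le> norm (g x - g y) + norm (h x - h y) + norm (g y - h y)"
      by (subst eq) (rule norm_triangle_diff_add)
    moreover have "norm (g x - g y) \<le> L * dist x y" "norm (h x - h y) \<le> L * dist x y"
      using lipschitz_onD[OF g x yr] lipschitz_onD[OF h x yr] by (simp_all add: dist_norm)
    moreover have "norm (g y - h y) < e / 3" using gh y(1) by blast
    ultimately show "norm (g x - h x) < e" using Ld by linarith
  qed
qed

text \<open>Tychonoff's theorem applies to this product; its points are the extensional functions,
  in accordance with the encoding of \<open>holo_ball\<close>.\<close>

abbreviation pointwise_topology :: "(complex^'n \<Rightarrow> complex^'n) topology" where
  "pointwise_topology \<equiv> product_topology (\<lambda>_. euclidean) (ball 0 1)"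

lemma openin_pointwise_nhd:
  assumes "finite T" "T \<subseteq> ball 0 1"
  shows "openin pointwise_topology {g \<in> extensional (ball 0 1). \<forall>x\<in>T. norm (g x - f x) < e}"
proof -
  have "openin pointwise_topology (\<Pi>\<^sub>E x\<in>ball 0 1. if x \<in> T then ball (f x) e else UNIV)"
    by (rule product_topology_basis) (auto intro: finite_subset[OF _ assms(1)])
  also have "(\<Pi>\<^sub>E x\<in>ball 0 1. if x \<in> T then ball (f x) e else UNIV) =
      {g \<in> extensional (ball 0 1). \<forall>x\<in>T. norm (g x - f x) < e}"
  proof (intro set_eqI iffI)
    fix g assume "g \<in> (\<Pi>\<^sub>E x\<in>ball 0 1. if x \<in> T then ball (f x) e else UNIV)"
    then have "g \<in> extensional (ball 0 1)" "\<And>x. x \<in> ball 0 1 \<Longrightarrow> g x \<in> (if x \<in> T then ball (f x) e else UNIV)"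
      unfolding PiE_iff by blast+
    then show "g \<in> {g \<in> extensional (ball 0 1). \<forall>x\<in>T. norm (g x - f x) < e}"
      using assms(2) by (force simp: dist_norm norm_minus_commute)
  next
    fix g assume "g \<in> {g \<in> extensional (ball 0 1). \<forall>x\<in>T. norm (g x - f x) < e}"
    then show "g \<in> (\<Pi>\<^sub>E x\<in>ball 0 1. if x \<in> T then ball (f x) e else UNIV)"
      by (simp add: PiE_iff dist_norm norm_minus_commute)
  qed
  finally show ?thesis .
qed

lemma S_hat_extensional: "f \<in> S_hat A \<Longrightarrow> f \<in> extensional (ball 0 1)"
  by (simp add: S_hat_def S_ball_def holo_ball_def)

text \<open>A point of the pointwise closure is not given as the limit of a sequence. The common
  Lipschitz bounds pass to it, so approximation at finitely many points becomes uniform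
  approximation on smaller balls; letting the radius and the accuracy improve together yields a
  sequence for \<open>S_hat_limit\<close>.\<close>

lemma compactin_pointwise_S_hat:
  assumes nr: "nonresonant A"
  shows "compactin pointwise_topology (S_hat A)"
proof -
  have "\<exists>M. \<forall>f\<in>S_hat A. norm (f z) \<le> M" if "z \<in> ball 0 1" for z
  proof -
    have "norm z < 1" "z \<in> cball 0 (norm z)" using that by auto
    then show ?thesis using S_hat_locally_bounded[OF nr, of "norm z"] by blast
  qed
  then obtain M where M: "\<And>z f. z \<in> ball 0 1 \<Longrightarrow> f \<in> S_hat A \<Longrightarrow> norm (f z) \<le> M z" by metis
  let ?P = "\<Pi>\<^sub>E z\<in>ball 0 1. cball 0 (M z)"
  have "compactin pointwise_topology ?P"
    by (subst compactin_PiE) auto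
  moreover have sub: "S_hat A \<subseteq> ?P"
    using M S_hat_extensional by (intro subsetI) (simp add: PiE_iff)
  moreover have "closedin pointwise_topology (S_hat A)"
    unfolding closure_of_subset_eq[symmetric]
  proof
    show "S_hat A \<subseteq> topspace pointwise_topology"
      using S_hat_extensional by (intro subsetI) (simp add: PiE_iff)
    show "pointwise_topology closure_of S_hat A \<subseteq> S_hat A"
    proof
      fix g assume g: "g \<in> pointwise_topology closure_of S_hat A"
      then have gext: "g \<in> extensional (ball 0 1)" by (auto simp: in_closure_of PiE_iff)
      have approx: "\<exists>f\<in>S_hat A. \<forall>x\<in>T. norm (f x - g x) < e" if T: "finite T" "T \<subseteq> ball 0 1" "e > 0" for T e
      proof -
        let ?N = "{h \<in> extensional (ball 0 1). \<forall>x\<in>T. norm (h x - g x) < e}"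
        have N: "g \<in> ?N \<and> openin pointwise_topology ?N"
          by (rule conjI[OF _ openin_pointwise_nhd[OF T(1,2)]]) (use gext T(3) in simp)
        have "\<forall>N. g \<in> N \<and> openin pointwise_topology N \<longrightarrow> (\<exists>f. f \<in> S_hat A \<and> f \<in> N)"
          using g unfolding in_closure_of by (rule conjunct2)
        then have "g \<in> ?N \<and> openin pointwise_topology ?N \<longrightarrow> (\<exists>f. f \<in> S_hat A \<and> f \<in> ?N)"
          by (rule spec)
        then have "\<exists>f. f \<in> S_hat A \<and> f \<in> ?N" using N by (rule mp)
        then show ?thesis by blast
      qed
      have glip: "L-lipschitz_on (cball 0 r) g"
        if L: "L > 0" "\<And>f. f \<in> S_hat A \<Longrightarrow> L-lipschitz_on (cball 0 r) f" and "r < 1" for L r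
      proof (rule lipschitz_onI, rule field_le_epsilon)
        fix x y :: "complex^'n" and e :: real assume xy: "x \<in> cball 0 r" "y \<in> cball 0 r" and "e > 0"
        have "\<exists>f\<in>S_hat A. \<forall>u\<in>{x, y}. norm (f u - g u) < e / 2"
          by (rule approx) (use xy \<open>r < 1\<close> \<open>e > 0\<close> in auto)
        then obtain f where f: "f \<in> S_hat A" "norm (f x - g x) < e / 2" "norm (f y - g y) < e / 2" by blast
        have eq: "g x - g y = (f x - f y) - (f x - g x) + (f y - g y)" by simp
        have "norm (g x - g y) \<le> norm (f x - f y) + norm (f x - g x) + norm (f y - g y)"
          by (subst eq) (rule norm_triangle_diff_add)
        moreover have "norm (f x - f y) \<le> L * dist x y"
          using lipschitz_onD[OF L(2)[OF f(1)] xy] by (simp add: dist_norm)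
        ultimately show "dist (g x) (g y) \<le> L * dist x y + e"
          using f(2,3) unfolding dist_norm by linarith
      qed (use L(1) in simp)
      have ball_approx: "\<exists>f\<in>S_hat A. \<forall>x\<in>cball 0 r. norm (f x - g x) < e" if "r < 1" "e > 0" for r e
      proof -
        obtain L where L: "L > 0" "\<And>f. f \<in> S_hat A \<Longrightarrow> L-lipschitz_on (cball 0 r) f"
          using S_hat_equilipschitz[OF nr \<open>r < 1\<close>] by blast
        obtain T where T: "finite T" "T \<subseteq> cball (0::complex^'n) r"
          "\<forall>g h :: complex^'n \<Rightarrow> complex^'n. L-lipschitz_on (cball 0 r) g \<longrightarrow> L-lipschitz_on (cball 0 r) h \<longrightarrow>
            (\<forall>x\<in>T. norm (g x - h x) < e / 3) \<longrightarrow> (\<forall>x\<in>cball 0 r. norm (g x - h x) < e)"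
          using lipschitz_net[OF \<open>e > 0\<close> L(1), of r] by (elim exE conjE)
        have "T \<subseteq> ball 0 1" using T(2) \<open>r < 1\<close> by force
        then obtain f where f: "f \<in> S_hat A" "\<forall>x\<in>T. norm (f x - g x) < e / 3"
          using approx[OF T(1), of "e / 3"] \<open>e > 0\<close> by auto
        have "\<forall>x\<in>cball 0 r. norm (f x - g x) < e"
          using T(3) L(2)[OF f(1)] glip[OF L \<open>r < 1\<close>] f by blast
        then show ?thesis using f(1) by blast
      qed
      define s where "s = (\<lambda>n. inverse (real (Suc n)))"
      have s: "s n > 0" for n by (simp add: s_def)
      have s0: "s \<longlonglongrightarrow> 0" unfolding s_def by (rule LIMSEQ_inverse_real_of_nat)
      have "\<exists>f\<in>S_hat A. \<forall>x\<in>cball 0 (1 - s n). norm (f x - g x) < s n" for n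
        by (rule ball_approx) (use s[of n] in auto)
      then obtain f where f: "\<And>n. f n \<in> S_hat A" "\<And>n x. x \<in> cball 0 (1 - s n) \<Longrightarrow> norm (f n x - g x) < s n"
        by metis
      show "g \<in> S_hat A"
      proof (rule S_hat_limit[OF nr f(1) gext])
        fix r :: real assume "r < 1"
        show "uniform_limit (cball 0 r) f g sequentially"
        proof (rule uniform_limitI)
          fix e :: real assume "e > 0"
          have "eventually (\<lambda>n. s n < min e (1 - r)) sequentially"
            by (rule order_tendstoD(2)[OF s0]) (use \<open>e > 0\<close> \<open>r < 1\<close> in simp)
          then show "eventually (\<lambda>n. \<forall>x\<in>cball 0 r. dist (f n x) (g x) < e) sequentially"
          proof eventually_elim
            case (elim n)
            show ?case
            proof
              fix x :: "complex^'n" assume "x \<in> cball 0 r"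
              then have "norm (f n x - g x) < s n" by (intro f(2)) (use elim in auto)
              then show "dist (f n x) (g x) < e" using elim by (simp add: dist_norm)
            qed
          qed
        qed
      qed
    qed
  qed
  ultimately show ?thesis by (rule closed_compactin)
qed

text \<open>By \<open>lipschitz_net\<close>, every locally uniform neighbourhood within the class
  contains one cut out by finitely many points. The identity is therefore continuous from the
  pointwise topology and carries compactness over.\<close>

lemma compactin_S_hat:
  assumes nr: "nonresonant A"
  shows "compactin loc_unif_topology (S_hat A)"
proof -
  let ?X = "subtopology pointwise_topology (S_hat A)"
  have "S_hat A \<subseteq> extensional (ball 0 1)" using S_hat_extensional by blast
  then have tX: "topspace ?X = S_hat A" by (auto simp: PiE_UNIV_domain PiE_def)
  have sub: "S_hat A \<subseteq> holo_ball" by (auto simp: S_hat_def S_ball_def)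
  have "continuous_map ?X loc_unif_topology (\<lambda>f. f)"
    unfolding continuous_map_def tX topspace_loc_unif_topology
  proof (intro conjI allI impI)
    show "(\<lambda>f. f) \<in> S_hat A \<rightarrow> holo_ball" using sub by auto
    fix U :: "(complex^'n \<Rightarrow> complex^'n) set" assume "openin loc_unif_topology U"
    then have U: "openin_loc_unif U" by (simp add: openin_loc_unif_topology)
    show "openin ?X {f \<in> S_hat A. f \<in> U}"
      unfolding openin_subopen[where S = "{f \<in> S_hat A. f \<in> U}"]
    proof
      fix f assume "f \<in> {f \<in> S_hat A. f \<in> U}"
      then have f: "f \<in> S_hat A" "f \<in> U" by auto
      obtain K e where K: "compact K" "K \<subseteq> ball 0 1" "e > 0"
        "{g \<in> holo_ball. \<forall>z\<in>K. dist (g z) (f z) < e} \<subseteq> U"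
        using U f(2) unfolding openin_loc_unif_def by blast
      obtain r where r: "r < 1" "K \<subseteq> cball 0 r"
      proof (cases "K = {}")
        case True
        then show ?thesis using that[of 0] by simp
      next
        case False
        then obtain x where x: "x \<in> K" "\<And>y. y \<in> K \<Longrightarrow> norm y \<le> norm x"
          using continuous_attains_sup[OF K(1) False continuous_on_norm_id] by auto
        show ?thesis by (rule that[of "norm x"]) (use x K(2) in auto)
      qed
      obtain L where L: "L > 0" "\<And>f. f \<in> S_hat A \<Longrightarrow> L-lipschitz_on (cball 0 r) f"
        using S_hat_equilipschitz[OF nr \<open>r < 1\<close>] by blast
      obtain T where T: "finite T" "T \<subseteq> cball (0::complex^'n) r"
        "\<forall>g h :: complex^'n \<Rightarrow> complex^'n. L-lipschitz_on (cball 0 r) g \<longrightarrow> L-lipschitz_on (cball 0 r) h \<longrightarrow>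
          (\<forall>x\<in>T. norm (g x - h x) < e / 3) \<longrightarrow> (\<forall>x\<in>cball 0 r. norm (g x - h x) < e)"
        using lipschitz_net[OF \<open>e > 0\<close> L(1), of r] by (elim exE conjE)
      have T1: "T \<subseteq> ball 0 1" using T(2) \<open>r < 1\<close> by force
      let ?W = "S_hat A \<inter> {g \<in> extensional (ball 0 1). \<forall>x\<in>T. norm (g x - f x) < e / 3}"
      have "openin ?X ?W" by (rule openin_subtopology_Int2) (rule openin_pointwise_nhd[OF T(1) T1])
      moreover have "f \<in> ?W" using f(1) S_hat_extensional K(3) by auto
      moreover have "?W \<subseteq> {f \<in> S_hat A. f \<in> U}"
      proof
        fix g assume g: "g \<in> ?W"
        then have gS: "g \<in> S_hat A" by simp
        have "\<forall>x\<in>cball 0 r. norm (g x - f x) < e"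
          using T(3) L(2)[OF gS] L(2)[OF f(1)] g by blast
        then have "g \<in> {g \<in> holo_ball. \<forall>z\<in>K. dist (g z) (f z) < e}"
          using gS sub r(2) by (auto simp: dist_norm)
        then show "g \<in> {f \<in> S_hat A. f \<in> U}" using K(4) gS by blast
      qed
      ultimately show "\<exists>T. openin ?X T \<and> f \<in> T \<and> T \<subseteq> {f \<in> S_hat A. f \<in> U}" by blast
    qed
  qed
  moreover have "compactin ?X (S_hat A)"
    by (simp add: compactin_pointwise_S_hat[OF nr])
  ultimately have "compactin loc_unif_topology ((\<lambda>f. f) ` S_hat A)" by (rule image_compactin[rotated])
  then show ?thesis by simp
qed

end

section \<open>Resonances and unbounded families\<close>

lemma compactin_loc_unif_bounded_at:
  assumes "compactin loc_unif_topology S" "z \<in> ball 0 1"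
  obtains B where "\<And>f. f \<in> S \<Longrightarrow> norm (f z) \<le> B"
proof -
  have "continuous_map loc_unif_topology euclidean (\<lambda>f. f z)"
    unfolding continuous_map_def topspace_loc_unif_topology openin_loc_unif_topology openin_loc_unif_def
  proof (intro conjI allI impI ballI)
    fix U f assume U: "openin euclidean U" and f: "f \<in> {f \<in> holo_ball. f z \<in> U}"
    then obtain e where e: "e > 0" "ball (f z) e \<subseteq> U" by (auto elim: openE)
    show "\<exists>K e. compact K \<and> K \<subseteq> ball 0 1 \<and> 0 < e \<and>
        {g \<in> holo_ball. \<forall>z\<in>K. dist (g z) (f z) < e} \<subseteq> {f \<in> holo_ball. f z \<in> U}"
      using e assms(2) by (intro exI[of _ "{z}"] exI[of _ e]) (auto simp: dist_commute subset_iff)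
  qed auto
  from image_compactin[OF assms(1) this] have "bounded ((\<lambda>f. f z) ` S)"
    by (simp add: compact_imp_bounded)
  then show ?thesis using that unfolding bounded_iff by auto
qed

text \<open>Starting from a point good for the earlier forms, one moves along an axis on which the
  new form is nonzero; only finitely many parameters are forbidden.\<close>

lemma linear_forms_common_nonzero:
  fixes l :: "'i \<Rightarrow> complex^'n"
  assumes "finite I" "\<And>i. i \<in> I \<Longrightarrow> l i \<noteq> 0"
  shows "\<exists>z. \<forall>i\<in>I. dotp (l i) z \<noteq> 0"
  using assms
proof (induction I rule: finite_induct)
  case (insert i I)
  then obtain z where z: "\<forall>j\<in>I. dotp (l j) z \<noteq> 0" by auto
  obtain k where "l i $ k \<noteq> 0" using insert.prems by (auto simp: vec_eq_iff)
  then have w: "dotp (l i) (axis k 1) \<noteq> 0"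
    by (simp add: dotp_def axis_def if_distrib cong: if_cong)
  define w where "w = (axis k 1 :: complex^'n)"
  have "finite ((\<lambda>j. - dotp (l j) z / dotp (l j) w) ` insert i I \<union> {0})" using insert by simp
  then obtain e where e: "e \<notin> (\<lambda>j. - dotp (l j) z / dotp (l j) w) ` insert i I \<union> {0}"
    using ex_new_if_finite[OF infinite_UNIV_char_0] by blast
  have "dotp (l j) (z + e *s w) \<noteq> 0" if j: "j \<in> insert i I" for j
  proof
    assume "dotp (l j) (z + e *s w) = 0"
    then have eq: "dotp (l j) z + e * dotp (l j) w = 0" by (simp add: dotp_simps)
    show False
    proof (cases "dotp (l j) w = 0")
      case True
      then show False using eq j z w by (auto simp: w_def)
    next
      case False
      then have "e = - dotp (l j) z / dotp (l j) w" using eq by (simp add: eq_neg_iff_add_eq_0 field_simps)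
      then show False using e j by blast
    qed
  qed
  then show ?case by blast
qed simp

lemma line_hol_nth: "line_hol (\<lambda>z::complex^'n. z $ i) U"
proof -
  have "holomorphic_map_on (\<lambda>z::complex^'n. z) UNIV" by (rule holomorphic_map_on_id)
  then have "line_hol (\<lambda>z::complex^'n. z $ i) UNIV" by (simp add: holomorphic_map_on_iff_line_hol)
  then show ?thesis by (rule line_hol_subset) simp
qed

lemma line_hol_dotp: "line_hol (dotp l) U"
proof -
  have "line_hol (\<lambda>z. \<Sum>i\<in>UNIV. l $ i * z $ i) U"
    by (intro line_hol_sum line_hol_mult line_hol_const line_hol_nth)
  then show ?thesis by (simp add: dotp_def[abs_def])
qed

lemma line_hol_power: "line_hol F U \<Longrightarrow> line_hol (\<lambda>z. F z ^ k) U"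
  by (induction k) (auto intro!: line_hol_mult)

text \<open>Pairing the eigenvector equation with \<open>u\<close> shows that the real part of \<mu>
  is at least m(A).\<close>

lemma eigenvalue_Re_pos:
  assumes "m_op A > 0" "A *v u = \<mu> *s u" "u \<noteq> 0"
  shows "Re \<mu> > 0"
proof -
  have "cinner u u = (\<Sum>i\<in>UNIV. of_real ((cmod (u $ i))\<^sup>2))"
    by (simp add: cinner_def complex_norm_square del: of_real_power)
  then have "Im (cinner u u) = 0" by simp
  moreover have "Re (cinner u u) = (norm u)\<^sup>2" by (simp add: Re_cinner power2_norm_eq_inner)
  moreover have "(A *v u) \<bullet> u = Re (\<mu> * cinner u u)"
    by (simp only: assms(2) Re_cinner[symmetric] cinner_smult)
  ultimately have "m_op A * (norm u)\<^sup>2 \<le> Re \<mu> * (norm u)\<^sup>2"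
    using m_op_le[of A u] by simp
  then have "m_op A \<le> Re \<mu>" using \<open>u \<noteq> 0\<close> by simp
  then show ?thesis using assms(1) by simp
qed

text \<open>At a resonance \<open>\<lambda>\<^sub>s = \<Sum> m\<^sub>i \<lambda>\<^sub>i\<close> take left eigenvectors \<open>l\<^sub>i\<close> and a right eigenvector \<open>u\<close>
  for \<open>\<lambda>\<^sub>s\<close>. As \<open>Re \<lambda>\<^sub>i > 0\<close>, no \<open>\<lambda>\<^sub>i\<close> with \<open>m\<^sub>i > 0\<close> equals \<open>\<lambda>\<^sub>s\<close>, so these \<open>l\<^sub>i\<close> vanish at \<open>u\<close> and
  \<open>z \<mapsto> z + c \<Prod> l\<^sub>i(z)\<^bsup>m\<^sub>i\<^esup> u\<close> is a shear commuting with the flow, for every \<open>c\<close>.\<close>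

lemma nonresonant_if_compact:
  fixes A :: "complex^'n^'n"
  assumes A: "m_op A > 0" and cpt: "compactin loc_unif_topology (S_hat A)"
  shows "nonresonant A"
  unfolding nonresonant_def
proof (intro allI impI notI)
  fix ev s and m :: "'n \<Rightarrow> nat"
  assume ev: "is_eigenvalue_family A ev" and m2: "(\<Sum>i\<in>UNIV. m i) \<ge> 2"
    and "(\<Sum>i\<in>UNIV. of_nat (m i) * ev i) - ev s = 0"
  then have res: "(\<Sum>i\<in>UNIV. of_nat (m i) * ev i) = ev s" by simp
  have det: "det (A - mat (ev i)) = 0" for i using eigenvalue_family_iff[OF ev] by blast
  have Re_pos: "Re (ev i) > 0" for i
    using eigenvector_exists[OF det[of i]] eigenvalue_Re_pos[OF A] by metis
  obtain u where u: "u \<noteq> 0" "A *v u = ev s *s u" using eigenvector_exists[OF det] by blast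
  have "\<exists>l. l \<noteq> 0 \<and> transpose A *v l = ev i *s l" for i
    using eigenvector_exists[of "transpose A" "ev i"] det[of i] by (metis det_transpose_diff_mat)
  then obtain l where l: "\<And>i. l i \<noteq> 0" "\<And>i. transpose A *v l i = ev i *s l i" by metis
  \<comment> \<open>All eigenvalues have positive real part, so one with \<open>m i > 0\<close> that
    equals \<open>ev s\<close> would exhaust the whole sum, leaving total order 1.\<close>
  have ne: "ev i \<noteq> ev s" if "m i > 0" for i
  proof
    assume eq: "ev i = ev s"
    have "(\<Sum>j\<in>UNIV. real (m j) * Re (ev j)) = Re (ev i)"
      using arg_cong[OF res, of Re] eq by (simp add: Re_sum)
    then have s1: "real (m i) * Re (ev i) + (\<Sum>j\<in>UNIV - {i}. real (m j) * Re (ev j)) = Re (ev i)"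
      by (simp add: sum.remove[of UNIV i])
    have nn: "real (m j) * Re (ev j) \<ge> 0" for j using Re_pos[of j] by simp
    have "real (m i) * Re (ev i) \<ge> 1 * Re (ev i)"
      by (rule mult_right_mono) (use that Re_pos[of i] in auto)
    moreover have "(\<Sum>j\<in>UNIV - {i}. real (m j) * Re (ev j)) \<ge> 0" by (intro sum_nonneg nn)
    ultimately have z: "(\<Sum>j\<in>UNIV - {i}. real (m j) * Re (ev j)) = 0" "real (m i) * Re (ev i) = 1 * Re (ev i)"
      using s1 by linarith+
    have "m j = 0" if "j \<noteq> i" for j
      using z(1) nn that Re_pos[of j] by (subst (asm) sum_nonneg_eq_0_iff) auto
    then have "(\<Sum>j\<in>UNIV - {i}. m j) = 0" by auto
    moreover have "m i = 1" using z(2) Re_pos[of i] by simp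
    ultimately have "(\<Sum>j\<in>UNIV. m j) = 1" by (simp add: sum.remove[of UNIV i])
    with m2 show False by simp
  qed
  \<comment> \<open>Left and right eigenvectors for different eigenvalues annihilate each other
    under the bilinear pairing.\<close>
  have lu: "dotp (l i) u = 0" if "m i > 0" for i
  proof -
    have "ev s * dotp (l i) u = dotp (l i) (A *v u)" by (simp add: u(2) dotp_simps)
    also have "\<dots> = ev i * dotp (l i) u" by (simp only: dotp_transpose l(2) dotp_simps)
    finally show ?thesis using ne[OF that] by simp
  qed
  define p where "p = (\<lambda>z. \<Prod>i\<in>UNIV. dotp (l i) z ^ m i)"
  have p_scale: "p (c *s z) = c ^ (\<Sum>i\<in>UNIV. m i) * p z" for c z
    by (simp add: p_def dotp_simps power_mult_distrib prod.distrib power_sum)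
  have p_flow: "p (flow A t *v z) = exp (- (t * ev s)) * p z" for t z
  proof -
    have "dotp (l i) (flow A t *v z) ^ m i = exp (of_nat (m i) * (- (t * ev i))) * dotp (l i) z ^ m i" for i
      by (simp add: dotp_flow flow_eigenvector[OF l(2)] dotp_simps power_mult_distrib flip: exp_of_nat_mult)
    then have "p (flow A t *v z) = exp (\<Sum>i\<in>UNIV. of_nat (m i) * (- (t * ev i))) * p z"
      by (simp add: p_def prod.distrib exp_sum)
    also have "(\<Sum>i\<in>UNIV. of_nat (m i) * (- (t * ev i))) = - (t * (\<Sum>i\<in>UNIV. of_nat (m i) * ev i))"
      by (simp add: sum_distrib_left sum_negf mult_ac)
    finally show ?thesis by (simp add: res)
  qed
  \<comment> \<open>The factors that occur in \<open>p\<close> vanish at \<open>u\<close>, so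
    \<open>p\<close> is constant along \<open>u\<close>; injectivity of the shears rests on
    this.\<close>
  have p_shift: "p (z + a *s u) = p z" for z a
    unfolding p_def
  proof (rule prod.cong[OF refl])
    fix i
    show "dotp (l i) (z + a *s u) ^ m i = dotp (l i) z ^ m i"
      by (cases "m i = 0") (use lu[of i] in \<open>simp_all add: dotp_simps\<close>)
  qed
  have p_hol: "line_hol p U" for U
    unfolding p_def by (intro line_hol_prod line_hol_power line_hol_dotp)
  obtain C where C: "\<And>z. z \<in> cball 0 1 \<Longrightarrow> cmod (p z) \<le> C"
  proof -
    have "compact (p ` cball 0 1)"
      by (intro compact_continuous_image line_hol_continuous[OF p_hol]) auto
    then have "bounded (p ` cball 0 1)" by (rule compact_imp_bounded)
    then obtain C where "\<forall>x\<in>p ` cball 0 1. cmod x \<le> C" unfolding bounded_iff by auto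
    then show ?thesis by (intro that[of C]) auto
  qed
  have p_small: "cmod (p z) \<le> C * norm z ^ 2" if "norm z < 1" for z
  proof (cases "z = 0")
    case True
    have "(0::complex) ^ (\<Sum>i\<in>UNIV. m i) = 0" by (rule zero_power) (use m2 in linarith)
    then have "p 0 = 0" using p_scale[of 0 0] by (simp only: vector_smult_lzero mult_zero_left)
    then show ?thesis using True by simp
  next
    case False
    let ?k = "\<Sum>i\<in>UNIV. m i"
    have "p z = p (of_real (norm z) *s (inverse (norm z) *\<^sub>R z))" using False by (simp add: smult_of_real)
    then have "cmod (p z) = norm z ^ ?k * cmod (p (inverse (norm z) *\<^sub>R z))"
      by (simp only: p_scale norm_mult norm_power norm_of_real abs_norm_cancel)
    also have "\<dots> \<le> norm z ^ 2 * C"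
      using that m2 False by (intro mult_mono C power_decreasing) auto
    finally show ?thesis by (simp add: mult.commute)
  qed
  define F where "F = (\<lambda>c::complex. restrict (\<lambda>z. z + (c * p z) *s u) (ball 0 1))"
  have F_in: "F c \<in> S_hat A" for c
  proof -
    let ?G = "\<lambda>z. z + (c * p z) *s u"
    have FG: "F c z = ?G z" if "z \<in> ball 0 1" for z using that by (simp add: F_def)
    have "line_hol (\<lambda>z. F c z $ i) (ball 0 1)" for i
    proof -
      have "line_hol (\<lambda>z. z $ i + (c * p z) * u $ i) (ball 0 1)"
        by (intro line_hol_add line_hol_mult line_hol_const p_hol line_hol_nth)
      then show ?thesis by (subst line_hol_cong[where G = "\<lambda>z. ?G z $ i"]) (auto simp: FG)
    qed
    then have hol: "holomorphic_map_on (F c) (ball 0 1)" by (simp add: holomorphic_map_on_iff_line_hol)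
    have inj: "inj_on (F c) (ball 0 1)"
    proof (rule inj_onI)
      fix x y assume xy: "x \<in> ball 0 1" "y \<in> ball 0 1" "F c x = F c y"
      then have eq: "x + (c * p x) *s u = y + (c * p y) *s u" by (simp add: FG)
      have "p x = p (x + (c * p x) *s u)" by (rule p_shift[symmetric])
      also have "\<dots> = p y" by (simp only: eq p_shift)
      finally show "x = y" using eq by simp
    qed
    have p0: "p 0 = 0" using p_small[of 0] by simp
    then have F0: "F c 0 = 0" by (simp add: FG)
    have der: "(F c has_derivative (\<lambda>h. h)) (at 0)"
    proof (rule has_derivative_id_quadratic[where f = "F c" and d = 1 and C = "cmod c * C * norm u"])
      fix z :: "complex^'n" assume z: "z \<in> ball 0 1"
      have "norm (F c z - z) = cmod c * cmod (p z) * norm u" using z by (simp add: FG norm_smult norm_mult)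
      also have "\<dots> \<le> cmod c * (C * norm z ^ 2) * norm u"
        by (intro mult_right_mono mult_left_mono p_small) (use z in auto)
      finally show "norm (F c z - z) \<le> cmod c * C * norm u * norm z ^ 2" by (simp add: mult_ac)
    qed (use F0 in auto)
    have cont: "continuous_on (ball 0 1) (F c)" by (rule holomorphic_map_on_continuous[OF hol])
    have "spirallike A (F c ` ball 0 1)"
      unfolding spirallike_def
    proof (intro conjI ballI allI impI)
      show "open (F c ` ball 0 1)" by (rule invariance_of_domain[OF cont open_ball inj])
      show "connected (F c ` ball 0 1)" by (rule connected_continuous_image[OF cont connected_ball])
      show "0 \<in> F c ` ball 0 1" by (rule image_eqI[of _ _ 0]) (auto simp: F0)
      fix w and t :: real assume "w \<in> F c ` ball 0 1" and t: "t \<ge> 0"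
      then obtain z where z: "z \<in> ball 0 1" "w = F c z" by blast
      have b: "flow A t *v z \<in> ball 0 1" using flow_contraction[OF A t, of z] z(1) by simp
      \<comment> \<open>By the resonance, \<open>p\<close> and the eigenvector \<open>u\<close>
        acquire the same factor under the flow, so the shear commutes with it.\<close>
      have "F c (flow A t *v z) = flow A t *v z + (c * p z) *s (exp (- (t * ev s)) *s u)"
        by (simp only: FG[OF b] p_flow vector_smult_assoc mult_ac)
      also have "\<dots> = flow A t *v F c z"
        by (simp add: FG[OF z(1)] matrix_vector_right_distrib vector_scalar_commute flow_eigenvector[OF u(2)])
      finally show "matrix_exp (- (t *\<^sub>R A)) *v w \<in> F c ` ball 0 1"
        using b z(2) by (metis flow_def image_eqI)
    qed
    then show ?thesis
      using hol inj F0 der by (simp add: S_hat_def S_ball_def holo_ball_def F_def)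
  qed
  obtain z1 where z1: "\<forall>i\<in>UNIV. dotp (l i) z1 \<noteq> 0"
    using linear_forms_common_nonzero[of UNIV l] l(1) by auto
  define a where "a = inverse (norm z1 + 1)"
  define z0 where "z0 = complex_of_real a *s z1"
  have np: "norm z1 + 1 > 0" using norm_ge_zero[of z1] by linarith
  then have a: "a > 0" "a * norm z1 < 1" by (simp_all add: a_def divide_simps)
  then have z0: "z0 \<in> ball 0 1" by (simp add: z0_def norm_smult)
  have "p z1 \<noteq> 0" using z1 by (simp add: p_def)
  then have pz0: "p z0 \<noteq> 0" using a(1) by (simp add: z0_def p_scale)
  obtain B where B: "\<And>f. f \<in> S_hat A \<Longrightarrow> norm (f z0) \<le> B"
    using compactin_loc_unif_bounded_at[OF cpt z0] by blast
  define K where "K = cmod (p z0) * norm u"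
  have K: "K > 0" using pz0 u(1) by (simp add: K_def)
  \<comment> \<open>The shear then moves \<open>z0\<close> by |B| + 2, whereas a value of norm at
    most \<open>B\<close> permits a displacement of at most B + 1.\<close>
  define c where "c = (\<bar>B\<bar> + 2) / K"
  have c0: "c > 0" using K by (simp add: c_def add_nonneg_pos)
  have "(of_real c * p z0) *s u = F (of_real c) z0 - z0" using z0 by (simp add: F_def)
  then have "c * K = norm (F (of_real c) z0 - z0)"
    using c0 by (metis K_def norm_smult norm_mult norm_of_real abs_of_pos mult.assoc)
  also have "\<dots> \<le> norm (F (of_real c) z0) + norm z0" by (rule norm_triangle_ineq4)
  also have "\<dots> \<le> B + 1" using B[OF F_in] z0 by (intro add_mono) auto
  finally have "\<bar>B\<bar> + 2 \<le> B + 1" using K by (simp add: c_def)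
  then show False by linarith
qed

theorem theorem3p1:
  fixes A :: "complex^'n^'n"
  assumes "m_op A > 0"
  shows "compactin loc_unif_topology (S_hat A) \<longleftrightarrow> nonresonant A"
proof
  interpret pos_generator A by unfold_locales (rule assms)
  show "compactin loc_unif_topology (S_hat A)" if "nonresonant A" by (rule compactin_S_hat[OF that])
qed (rule nonresonant_if_compact[OF assms])

end
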